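(* Let $\gamma>0$ be fixed and let the plant data and the value set $\mathbf V$ be given as in the context. The following are equivalent. (a) There exist a structured controller (i.e. dimensions $n^c$, $r^c=r^c_1+r^c_2$, structured controller matrices $A^c_{ij},B^c_i,C^c_j,D^c$ and a lower block-triangular scheduling function $\Delta_c:\mathbf V\to\mathbb R^{r^c\times r^c}$, as in the context) and some symmetric $\mathcal X_1\succ0$, $\mathcal P\in\mathbf P$, $Z\succ0$ with $\operatorname{tr}(Z)<1$ such that the closed-loop matrices of the lifted plant satisfy $$ \mathcal L_{\rm sub}\!\left(\begin{pmatrix}-\mathcal X_1&0\\ 0&0\end{pmatrix},\begin{pmatrix}0&\mathcal P\\ \mathcal P&0\end{pmatrix},P_Z,\begin{pmatrix}\mathcal A_{ij}\\ \mathcal C_j\end{pmatrix}\right)\prec0,\qquad \mathcal L\!\left(\begin{pmatrix}0&\mathcal X_1\\ \mathcal X_1&0\end{pmatrix},\begin{pmatrix}0&\mathcal P\\ \mathcal P&0\end{pmatrix},P_\gamma,\begin{pmatrix}\mathcal A_{ij}&\mathcal B_i\\ \mathcal C_j&\mathcal D\end{pmatrix}\right)\prec0 . $$ (b) There exist $X_1,Y_1\in\mathbb S^{n^s}$, matrices $Q_2,Q_3\in\mathbf P_p$ and $\tilde Q_1\in\mathbf P_d$ defining $$X_2=\begin{pmatrix}Q_2&Q_3\end{pmatrix},\qquad Y_2=\begin{pmatrix}\tilde Q_1&I_{r^s}\end{pmatrix},$$ unstructured matrices $\bar K_{ij},\bar L_i,\bar M_j$ defining $$ \begin{pmatrix}\boldsymbol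 K_{11}&\boldsymbol K_{12}&\boldsymbol L_1\\ \boldsymbol K_{21}&\boldsymbol K_{22}&\boldsymbol L_2\\ \boldsymbol M_1&\boldsymbol M_2&\boldsymbol N\end{pmatrix}:=\left(\begin{array}{c|cc|c}\bar K_{11}&\bar K_{12}&\bar K_{13}&\bar L_1\\ \hline\bar K_{21}&\bar K_{22}&Q_2^TA_{22}&0\\ \bar K_{31}&\bar K_{32}&\bar K_{33}&\bar L_3\\ \hline\bar M_1&\bar M_2&0&0\end{array}\right) $$ of partition $(n^s+(r^s+r^s)+m)\times(n^s+(r^s+r^s)+k)$, and some symmetric $Z\succ0$ with $\operatorname{tr}(Z)<1$ such that $$ \mathcal L_{\rm sub}\!\left(\begin{pmatrix}-\boldsymbol X&0\\ 0&0\end{pmatrix},\begin{pmatrix}0&I\\ I&0\end{pmatrix},P_Z,\begin{pmatrix}\boldsymbol A_{ij}\\ \boldsymbol C_j\end{pmatrix}\right)\prec0,\qquad \mathcal L\!\left(\begin{pmatrix}0&I\\ I&0\end{pmatrix},\begin{pmatrix}0&I\\ I&0\end{pmatrix},P_\gamma,\begin{pmatrix}\boldsymbol A_{ij}&\boldsymbol B_i\\ \boldsymbol C_j&\boldsymbol D\end{pmatrix}\right)\prec0, $$ where $\boldsymbol X:=\begin{pmatrix}Y_1&I_{n^s}\\ I_{n^s}&X_1\end{pmatrix}$ and, for $i,j=1,2$, $$ \begin{pmatrix}\boldsymbol A_{ij}&\boldsymbol B_i\\ \boldsymbol C_j&\boldsymbol D\end{pmatrix}:=\begin{pmatrix}A_{ij}Y_j&A_{ij}&B_i^p\\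 0&X_i^TA_{ij}&X_i^TB_i^p\\ C_j^pY_j&C_j^p&D^p\end{pmatrix}+\begin{pmatrix}0&B_i\\ I&0\\ 0&D_1\end{pmatrix}\begin{pmatrix}\boldsymbol K_{ij}&\boldsymbol L_i\\ \boldsymbol M_j&\boldsymbol N\end{pmatrix}\begin{pmatrix}I&0&0\\ 0&C_j&D_2\end{pmatrix} $$ (here the last block row and last block column of the left-hand side correspond to $z_p$ and $w_p$).
   Context: All matrices are real. $\mathbb S^n$ is the set of symmetric $n\times n$ matrices, $\operatorname{He}(M):=M+M^T$, and $\prec,\succ$ denote negative/positive definiteness of symmetric matrices. For matrices of compatible sizes ($i,j=1,2$), $$ \mathcal L\!\left(X,R,S,\begin{pmatrix}A_{ij}&B_i\\ C_j&D\end{pmatrix}\right):=F^T\begin{pmatrix}X&0&0\\ 0&R&0\\ 0&0&S\end{pmatrix}F,\qquad F:=\begin{pmatrix}I&0&0\\ A_{11}&A_{12}&B_1\\ 0&I&0\\ A_{21}&A_{22}&B_2\\ 0&0&I\\ C_1&C_2&D\end{pmatrix}, $$ where $X$, $R$, $S$ act on the first, second and third pair of block rows of $F$, respectively, and $\mathcal L_{\rm sub}(X,R,S,\begin{pmatrix}A_{ij}\\ C_j\end{pmatrix})$ is the same expression with the third block column of $F$ removed (i.e. the left upper $2\times2$ sub-block of $\mathcal L$). **Original plant.** Signals: state $x\in\mathbb R^{n^s}$, uncertainty channel $\hat w=\operatorname{col}(\hat w_1,\hat w_2)\in\mathbb R^{\hat u}$, $\hat z=\operatorname{col}(\hat z_1,\hat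 z_2)\in\mathbb R^{\hat v}$, performance channel $w_p,z_p$, control input $u\in\mathbb R^m$, measurement $y\in\mathbb R^k$: $$ \begin{pmatrix}\dot x\\ \hat z\\ z_p\\ y\end{pmatrix}=\begin{pmatrix}A_{11}&\hat A_{12}&B_1^p&B_1\\ \hat A_{21}&\hat A_{22}&\hat B_2^p&\hat B_2\\ C_1^p&\hat C_2^p&D^p&D_1\\ C_1&\hat C_2&D_2&0\end{pmatrix}\begin{pmatrix}x\\ \hat w\\ w_p\\ u\end{pmatrix},\qquad \hat w=\Delta\hat z, $$ where $D^p=0$ and, with respect to the partitions of $\hat w,\hat z$, $$\hat A_{22}=\begin{pmatrix}\bar A_{22}&0\\ \bar A_{32}&\bar A_{33}\end{pmatrix},\quad \hat B_2^p=\begin{pmatrix}0\\ \bar B_3^p\end{pmatrix},\quad \hat C_2^p=\begin{pmatrix}\bar C_2^p&0\end{pmatrix},$$ the remaining blocks being unstructured. Here $\Delta$ is a continuous function on $[0,\infty)$ with values in $\mathbf V=\mathrm{Co}\{\Delta_1,\dots,\Delta_N\}\ni0$, the convex hull of finitely many matrices $\Delta_l\in\mathbb R^{\hat u\times\hat v}$; the elements of $\mathbf V$ are block-diagonal of the form $\operatorname{diag}(\hat V,\hat V)$, compatibly with the partition of $\hat A_{22}$. **Lifted plant.** With $r^s:=\hat u+\hat v$, put $\Delta_l(V):=\begin{pmatrix}-I_{\hat u}&2V\\ 0&I_{\hat v}\end{pmatrix}$ for $V\in\mathbf V$. The lifted plant has the same $A_{11},B_1^p,B_1,C_1^p,D^p,D_1,C_1,D_2$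 and uncertainty channel $w\to z$ of size $r^s\times r^s$, $w=\Delta_l(\Delta)z$, with $$A_{12}=\begin{pmatrix}\hat A_{12}&0\end{pmatrix},\ A_{21}=\begin{pmatrix}0\\ 2\hat A_{21}\end{pmatrix},\ A_{22}=\begin{pmatrix}I_{\hat u}&0\\ 2\hat A_{22}&-I_{\hat v}\end{pmatrix},\ B_2^p=\begin{pmatrix}0\\ 2\hat B_2^p\end{pmatrix},\ B_2=\begin{pmatrix}0\\ 2\hat B_2\end{pmatrix},$$ $$C_2^p=\begin{pmatrix}\hat C_2^p&0\end{pmatrix},\ C_2=\begin{pmatrix}\hat C_2&0\end{pmatrix}.$$ **Structured controller.** Given by dimensions $n^c$ and $r^c=r^c_1+r^c_2$ (free, part of the design), a function $\Delta_c:\mathbf V\to\mathbb R^{r^c\times r^c}$ of the lower block-triangular form $\Delta_c(V)=\begin{pmatrix}\Delta^c_{11}(V)&0\\ \Delta^c_{21}(V)&\Delta^c_{22}(V)\end{pmatrix}$ (partition $r^c_1+r^c_2$; possibly nonlinear in $V$), and $$ \begin{pmatrix}\dot x_c\\ \hat z_c\\ u\end{pmatrix}=\begin{pmatrix}A^c_{11}&A^c_{12}&B^c_1\\ A^c_{21}&A^c_{22}&B^c_2\\ C^c_1&C^c_2&D^c\end{pmatrix}\begin{pmatrix}x_c\\ \hat w_c\\ y\end{pmatrix},\quad \hat w_c=\Delta_c(\Delta)\hat z_c, $$ with $A^c_{11}\in\mathbb R^{n^c\times n^c}$, $A^c_{22}\in\mathbb R^{r^c\times r^c}$, and with respect to $r^c=r^c_1+r^c_2$,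 $$A^c_{22}=\begin{pmatrix}\bar A^c_{22}&0\\ \bar A^c_{32}&\bar A^c_{33}\end{pmatrix},\quad B^c_2=\begin{pmatrix}0\\ \bar B^c_3\end{pmatrix},\quad C^c_2=\begin{pmatrix}\bar C^c_2&0\end{pmatrix},\quad D^c=0.$$ **Closed-loop matrices of the lifted plant.** For $i,j=1,2$, $$ \begin{pmatrix}\mathcal A_{ij}&\mathcal B_i\\ \mathcal C_j&\mathcal D\end{pmatrix}=\begin{pmatrix}A_{ij}&0&B_i^p\\ 0&0&0\\ C_j^p&0&D^p\end{pmatrix}+\begin{pmatrix}0&B_i\\ I&0\\ 0&D_1\end{pmatrix}\begin{pmatrix}A^c_{ij}&B^c_i\\ C^c_j&D^c\end{pmatrix}\begin{pmatrix}0&I&0\\ C_j&0&D_2\end{pmatrix}. $$ **Scalings.** With $\Delta_{lc}(V):=\begin{pmatrix}\Delta_l(V)&0\\ 0&\Delta_c(V)\end{pmatrix}$ and $r:=r^s+r^c$, $$\mathbf P:=\{\mathcal P\in\mathbb S^{r}\mid \operatorname{He}[\mathcal P\Delta_{lc}(V)]\succ0\text{ for all }V\in\mathbf V\},$$ $$\mathbf P_p:=\{P\in\mathbb S^{r^s}\mid \operatorname{He}[P\Delta_l(V)]\succ0\text{ for all }V\in\mathbf V\},$$ $$\mathbf P_d:=\{\tilde P\in\mathbb S^{r^s}\mid \operatorname{He}[\tilde P\Delta_l(V)^T]\succ0\text{ for all }V\in\mathbf V\}.$$ Moreover $P_Z:=\begin{pmatrix}0&0\\ 0&Z^{-1}\end{pmatrix}$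 and $P_\gamma:=\begin{pmatrix}-\gamma I&0\\ 0&0\end{pmatrix}$, partitioned according to the dimensions of $(w_p,z_p)$. *)

theory Defs
  imports
    Complex_Main
    "Jordan_Normal_Form.Matrix"
    "Jordan_Normal_Form.Gauss_Jordan_Elimination"
begin

text \<open>
  All dimensions are natural numbers and may be zero, so that empty blocks (for instance a controller
  without states) are ordinary \<open>0 \<times> n\<close> or \<open>n \<times> 0\<close> matrices. The two channel indices \<open>i, j = 1, 2\<close>
  are naturals; the values of indexed families at any other index are irrelevant.
\<close>

section \<open>Matrices\<close>

definition append_cols :: "'a :: zero mat \<Rightarrow> 'a mat \<Rightarrow> 'a mat"  (infixr \<open>@\<^sub>c\<close> 66) where
  "A @\<^sub>c B = four_block_mat A B (0\<^sub>m 0 (dim_col A)) (0\<^sub>m 0 (dim_col B))"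

lemma carrier_append_cols [simp, intro]:
  "A \<in> carrier_mat nr nc1 \<Longrightarrow> B \<in> carrier_mat nr nc2 \<Longrightarrow> A @\<^sub>c B \<in> carrier_mat nr (nc1 + nc2)"
  unfolding append_cols_def carrier_mat_def by auto

definition pair :: "'a \<Rightarrow> 'a \<Rightarrow> nat \<Rightarrow> 'a" where
  "pair x\<^sub>1 x\<^sub>2 i = (if i = 1 then x\<^sub>1 else x\<^sub>2)"

definition pair2 :: "'a \<Rightarrow> 'a \<Rightarrow> 'a \<Rightarrow> 'a \<Rightarrow> nat \<Rightarrow> nat \<Rightarrow> 'a" where
  "pair2 x\<^sub>1\<^sub>1 x\<^sub>1\<^sub>2 x\<^sub>2\<^sub>1 x\<^sub>2\<^sub>2 i = pair (pair x\<^sub>1\<^sub>1 x\<^sub>1\<^sub>2) (pair x\<^sub>2\<^sub>1 x\<^sub>2\<^sub>2) i"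

lemma pair_simps [simp]:
  "pair x\<^sub>1 x\<^sub>2 1 = x\<^sub>1" "pair x\<^sub>1 x\<^sub>2 (Suc 0) = x\<^sub>1" "pair x\<^sub>1 x\<^sub>2 2 = x\<^sub>2"
  by (auto simp: pair_def)

definition sym_mats :: "nat \<Rightarrow> real mat set" where
  "sym_mats n = {M \<in> carrier_mat n n. M\<^sup>T = M}"

definition He :: "real mat \<Rightarrow> real mat" where
  "He M = M + M\<^sup>T"

definition pos_def :: "real mat \<Rightarrow> bool" where
  "pos_def M \<longleftrightarrow> M \<in> sym_mats (dim_row M) \<and>
     (\<forall>v \<in> carrier_vec (dim_row M). v \<noteq> 0\<^sub>v (dim_row M) \<longrightarrow> v \<bullet> (M *\<^sub>v v) > 0)"

definition neg_def :: "real mat \<Rightarrow> bool" where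
  "neg_def M \<longleftrightarrow> M \<in> sym_mats (dim_row M) \<and>
     (\<forall>v \<in> carrier_vec (dim_row M). v \<noteq> 0\<^sub>v (dim_row M) \<longrightarrow> v \<bullet> (M *\<^sub>v v) < 0)"

definition tr :: "real mat \<Rightarrow> real" where
  "tr M = sum_list (diag_mat M)"

text \<open>
  The library's \<open>convex hull\<close> needs a real vector space type, which matrices with a carrier are not.
\<close>

definition mat_convex_hull :: "nat \<Rightarrow> nat \<Rightarrow> nat \<Rightarrow> (nat \<Rightarrow> real mat) \<Rightarrow> real mat set" where
  "mat_convex_hull nr nc N \<Delta> =
     {mat nr nc (\<lambda>ij. \<Sum>l<N. c l * \<Delta> l $$ ij) | c. (\<forall>l<N. 0 \<le> c l) \<and> (\<Sum>l<N. c l) = 1}"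


section \<open>The quadratic expressions\<close>

text \<open>Matrix tuples of the form \<open>(A\<^sub>i\<^sub>j, B\<^sub>i; C\<^sub>j, D)\<close> for \<open>i, j = 1, 2\<close>.\<close>

record lfr =
  lfr_A :: "nat \<Rightarrow> nat \<Rightarrow> real mat"
  lfr_B :: "nat \<Rightarrow> real mat"
  lfr_C :: "nat \<Rightarrow> real mat"
  lfr_D :: "real mat"

definition lfr_mat :: "lfr \<Rightarrow> nat \<Rightarrow> nat \<Rightarrow> real mat" where
  "lfr_mat S i j = four_block_mat (lfr_A S i j) (lfr_B S i) (lfr_C S j) (lfr_D S)"

definition outer_factor :: "lfr \<Rightarrow> real mat" where
  "outer_factor S = (let A = lfr_A S; B = lfr_B S; C = lfr_C S; D = lfr_D S;
       n = dim_col (A 1 1); r = dim_col (A 2 2); q = dim_col D in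
       (1\<^sub>m n   @\<^sub>c 0\<^sub>m n r @\<^sub>c 0\<^sub>m n q) @\<^sub>r
       (A 1 1  @\<^sub>c A 1 2  @\<^sub>c B 1) @\<^sub>r
       (0\<^sub>m r n @\<^sub>c 1\<^sub>m r   @\<^sub>c 0\<^sub>m r q) @\<^sub>r
       (A 2 1  @\<^sub>c A 2 2  @\<^sub>c B 2) @\<^sub>r
       (0\<^sub>m q n @\<^sub>c 0\<^sub>m q r @\<^sub>c 1\<^sub>m q) @\<^sub>r
       (C 1    @\<^sub>c C 2    @\<^sub>c D))"

definition outer_factor_sub :: "lfr \<Rightarrow> real mat" where
  "outer_factor_sub S = (let A = lfr_A S; C = lfr_C S; D = lfr_D S;
       n = dim_col (A 1 1); r = dim_col (A 2 2); q = dim_col D in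
       (1\<^sub>m n   @\<^sub>c 0\<^sub>m n r) @\<^sub>r
       (A 1 1  @\<^sub>c A 1 2) @\<^sub>r
       (0\<^sub>m r n @\<^sub>c 1\<^sub>m r) @\<^sub>r
       (A 2 1  @\<^sub>c A 2 2) @\<^sub>r
       (0\<^sub>m q n @\<^sub>c 0\<^sub>m q r) @\<^sub>r
       (C 1    @\<^sub>c C 2))"

definition LL :: "real mat \<Rightarrow> real mat \<Rightarrow> real mat \<Rightarrow> lfr \<Rightarrow> real mat" where
  "LL X R S M = (outer_factor M)\<^sup>T * diag_block_mat [X, R, S] * outer_factor M"

definition LL_sub :: "real mat \<Rightarrow> real mat \<Rightarrow> real mat \<Rightarrow> lfr \<Rightarrow> real mat" where
  "LL_sub X R S M = (outer_factor_sub M)\<^sup>T * diag_block_mat [X, R, S] * outer_factor_sub M"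

text \<open>The outer matrices \<open>(0, M; M, 0)\<close> and \<open>(-X, 0; 0, 0)\<close> for square blocks.\<close>

definition offdiag :: "real mat \<Rightarrow> real mat" where
  "offdiag M = (let n = dim_row M in four_block_mat (0\<^sub>m n n) M M (0\<^sub>m n n))"

definition neg_corner :: "real mat \<Rightarrow> real mat" where
  "neg_corner X = (let n = dim_row X in four_block_mat (- X) (0\<^sub>m n n) (0\<^sub>m n n) (0\<^sub>m n n))"

definition P_Z :: "nat \<Rightarrow> real mat \<Rightarrow> real mat" where
  "P_Z n\<^sub>w Z = diag_block_mat [0\<^sub>m n\<^sub>w n\<^sub>w, the (mat_inverse Z)]"

definition P_gamma :: "nat \<Rightarrow> nat \<Rightarrow> real \<Rightarrow> real mat" where
  "P_gamma n\<^sub>w n\<^sub>z \<gamma> = diag_block_mat [- (\<gamma> \<cdot>\<^sub>m 1\<^sub>m n\<^sub>w), 0\<^sub>m n\<^sub>z n\<^sub>z]"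


section \<open>Plants\<close>

text \<open>
  Plants \<open>(A\<^sub>i\<^sub>j, B\<^sup>p\<^sub>i, B\<^sub>i; C\<^sup>p\<^sub>j, D\<^sup>p, D\<^sub>1; C\<^sub>j, D\<^sub>2, 0)\<close>: index \<open>1\<close> is the state, index \<open>2\<close> the uncertainty
  channel. The feedthrough from \<open>u\<close> to \<open>y\<close> is zero and is not recorded.
\<close>

record plant =
  pl_A  :: "nat \<Rightarrow> nat \<Rightarrow> real mat"
  pl_Bp :: "nat \<Rightarrow> real mat"
  pl_B  :: "nat \<Rightarrow> real mat"
  pl_Cp :: "nat \<Rightarrow> real mat"
  pl_C  :: "nat \<Rightarrow> real mat"
  pl_Dp :: "real mat"
  pl_D1 :: "real mat"
  pl_D2 :: "real mat"

text \<open>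
  The original plant, with hats. The elements of the value set have the form \<open>diag(V, V)\<close> with the
  same block \<open>V\<close> of size \<open>a \<times> b\<close> in both places, so that \<open>w\<close>-hat and \<open>z\<close>-hat are partitioned as
  \<open>a + a\<close> and \<open>b + b\<close>.
\<close>

definition original_plant ::
  "nat \<Rightarrow> nat \<Rightarrow> nat \<Rightarrow> nat \<Rightarrow> nat \<Rightarrow> nat \<Rightarrow> nat \<Rightarrow> plant \<Rightarrow> bool" where
  "original_plant n\<^sub>s a b n\<^sub>w n\<^sub>z m k G \<longleftrightarrow>
     pl_A G 1 1 \<in> carrier_mat n\<^sub>s n\<^sub>s \<and>
     pl_A G 1 2 \<in> carrier_mat n\<^sub>s (a + a) \<and>
     pl_A G 2 1 \<in> carrier_mat (b + b) n\<^sub>s \<and>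
     (\<exists>A22 \<in> carrier_mat b a. \<exists>A32 \<in> carrier_mat b a. \<exists>A33 \<in> carrier_mat b a.
        pl_A G 2 2 = four_block_mat A22 (0\<^sub>m b a) A32 A33) \<and>
     pl_Bp G 1 \<in> carrier_mat n\<^sub>s n\<^sub>w \<and>
     (\<exists>Bp3 \<in> carrier_mat b n\<^sub>w. pl_Bp G 2 = 0\<^sub>m b n\<^sub>w @\<^sub>r Bp3) \<and>
     pl_B G 1 \<in> carrier_mat n\<^sub>s m \<and>
     pl_B G 2 \<in> carrier_mat (b + b) m \<and>
     pl_Cp G 1 \<in> carrier_mat n\<^sub>z n\<^sub>s \<and>
     (\<exists>Cp2 \<in> carrier_mat n\<^sub>z a. pl_Cp G 2 = Cp2 @\<^sub>c 0\<^sub>m n\<^sub>z a) \<and>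
     pl_C G 1 \<in> carrier_mat k n\<^sub>s \<and>
     pl_C G 2 \<in> carrier_mat k (a + a) \<and>
     pl_Dp G = 0\<^sub>m n\<^sub>z n\<^sub>w \<and>
     pl_D1 G \<in> carrier_mat n\<^sub>z m \<and>
     pl_D2 G \<in> carrier_mat k n\<^sub>w"

definition lifted_plant :: "plant \<Rightarrow> plant" where
  "lifted_plant G = (let
       n\<^sub>s = dim_row (pl_A G 1 1); u = dim_col (pl_A G 2 2); v = dim_row (pl_A G 2 2);
       n\<^sub>w = dim_col (pl_Dp G); n\<^sub>z = dim_row (pl_Dp G);
       m = dim_col (pl_D1 G); k = dim_row (pl_D2 G) in
     \<lparr>pl_A = pair2
        (pl_A G 1 1)                      (pl_A G 1 2 @\<^sub>c 0\<^sub>m n\<^sub>s v)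
        (0\<^sub>m u n\<^sub>s @\<^sub>r 2 \<cdot>\<^sub>m pl_A G 2 1)   (four_block_mat (1\<^sub>m u) (0\<^sub>m u v) (2 \<cdot>\<^sub>m pl_A G 2 2) (- 1\<^sub>m v)),
      pl_Bp = pair (pl_Bp G 1) (0\<^sub>m u n\<^sub>w @\<^sub>r 2 \<cdot>\<^sub>m pl_Bp G 2),
      pl_B  = pair (pl_B G 1) (0\<^sub>m u m @\<^sub>r 2 \<cdot>\<^sub>m pl_B G 2),
      pl_Cp = pair (pl_Cp G 1) (pl_Cp G 2 @\<^sub>c 0\<^sub>m n\<^sub>z v),
      pl_C  = pair (pl_C G 1) (pl_C G 2 @\<^sub>c 0\<^sub>m k v),
      pl_Dp = pl_Dp G, pl_D1 = pl_D1 G, pl_D2 = pl_D2 G\<rparr>)"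

definition Delta_l :: "nat \<Rightarrow> nat \<Rightarrow> real mat \<Rightarrow> real mat" where
  "Delta_l u v V = four_block_mat (- 1\<^sub>m u) (2 \<cdot>\<^sub>m V) (0\<^sub>m v u) (1\<^sub>m v)"

definition value_set :: "nat \<Rightarrow> nat \<Rightarrow> nat \<Rightarrow> (nat \<Rightarrow> real mat) \<Rightarrow> real mat set \<Rightarrow> bool" where
  "value_set a b N \<Delta> VV \<longleftrightarrow>
     (\<forall>l<N. \<Delta> l \<in> carrier_mat (a + a) (b + b)) \<and>
     VV = mat_convex_hull (a + a) (b + b) N \<Delta> \<and>
     0\<^sub>m (a + a) (b + b) \<in> VV \<and>
     (\<forall>V \<in> VV. \<exists>V' \<in> carrier_mat a b. V = diag_block_mat [V', V'])"


section \<open>Structured controllers and the closed loop\<close>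

definition structured_controller :: "nat \<Rightarrow> nat \<Rightarrow> nat \<Rightarrow> nat \<Rightarrow> nat \<Rightarrow> lfr \<Rightarrow> bool" where
  "structured_controller n\<^sub>c r\<^sub>1 r\<^sub>2 m k K \<longleftrightarrow>
     lfr_A K 1 1 \<in> carrier_mat n\<^sub>c n\<^sub>c \<and>
     lfr_A K 1 2 \<in> carrier_mat n\<^sub>c (r\<^sub>1 + r\<^sub>2) \<and>
     lfr_A K 2 1 \<in> carrier_mat (r\<^sub>1 + r\<^sub>2) n\<^sub>c \<and>
     (\<exists>A22 \<in> carrier_mat r\<^sub>1 r\<^sub>1. \<exists>A32 \<in> carrier_mat r\<^sub>2 r\<^sub>1. \<exists>A33 \<in> carrier_mat r\<^sub>2 r\<^sub>2.
        lfr_A K 2 2 = four_block_mat A22 (0\<^sub>m r\<^sub>1 r\<^sub>2) A32 A33) \<and>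
     lfr_B K 1 \<in> carrier_mat n\<^sub>c k \<and>
     (\<exists>B3 \<in> carrier_mat r\<^sub>2 k. lfr_B K 2 = 0\<^sub>m r\<^sub>1 k @\<^sub>r B3) \<and>
     lfr_C K 1 \<in> carrier_mat m n\<^sub>c \<and>
     (\<exists>C2 \<in> carrier_mat m r\<^sub>1. lfr_C K 2 = C2 @\<^sub>c 0\<^sub>m m r\<^sub>2) \<and>
     lfr_D K = 0\<^sub>m m k"

definition structured_scheduling ::
  "real mat set \<Rightarrow> nat \<Rightarrow> nat \<Rightarrow> (real mat \<Rightarrow> real mat) \<Rightarrow> bool" where
  "structured_scheduling VV r\<^sub>1 r\<^sub>2 \<Delta>\<^sub>c \<longleftrightarrow>
     (\<forall>V \<in> VV. \<exists>\<Delta>11 \<in> carrier_mat r\<^sub>1 r\<^sub>1. \<exists>\<Delta>21 \<in> carrier_mat r\<^sub>2 r\<^sub>1. \<exists>\<Delta>22 \<in> carrier_mat r\<^sub>2 r\<^sub>2.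
        \<Delta>\<^sub>c V = four_block_mat \<Delta>11 (0\<^sub>m r\<^sub>1 r\<^sub>2) \<Delta>21 \<Delta>22)"

text \<open>
  Reads off \<open>A\<^sub>i\<^sub>j, B\<^sub>i, C\<^sub>j, D\<close> from the four matrices \<open>M i j = (A\<^sub>i\<^sub>j, B\<^sub>i; C\<^sub>j, D)\<close>, where \<open>A\<^sub>i\<^sub>j\<close> has size
  \<open>s i \<times> s j\<close>. In such a family \<open>B\<^sub>i\<close> does not depend on \<open>j\<close>, nor \<open>C\<^sub>j\<close> on \<open>i\<close>, nor \<open>D\<close> on either, and
  \<open>1\<close> is used for the free indices.
\<close>

definition lfr_of :: "(nat \<Rightarrow> nat) \<Rightarrow> (nat \<Rightarrow> nat \<Rightarrow> real mat) \<Rightarrow> lfr" where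
  "lfr_of s M = \<lparr>
     lfr_A = (\<lambda>i j. case split_block (M i j) (s i) (s j) of (A, B, C, D) \<Rightarrow> A),
     lfr_B = (\<lambda>i. case split_block (M i 1) (s i) (s 1) of (A, B, C, D) \<Rightarrow> B),
     lfr_C = (\<lambda>j. case split_block (M 1 j) (s 1) (s j) of (A, B, C, D) \<Rightarrow> C),
     lfr_D = (case split_block (M 1 1) (s 1) (s 1) of (A, B, C, D) \<Rightarrow> D)\<rparr>"

lemma lfr_of_eq:
  assumes "\<And>i j. i \<in> {1,2} \<Longrightarrow> j \<in> {1,2} \<Longrightarrow> M i j = lfr_mat S i j"
    and "\<And>i j. i \<in> {1,2} \<Longrightarrow> j \<in> {1,2} \<Longrightarrow> lfr_A S i j \<in> carrier_mat (s i) (s j)"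
    and "\<And>i. i \<in> {1,2} \<Longrightarrow> lfr_B S i \<in> carrier_mat (s i) q"
    and "\<And>j. j \<in> {1,2} \<Longrightarrow> lfr_C S j \<in> carrier_mat p (s j)"
    and "lfr_D S \<in> carrier_mat p q"
    and i: "i \<in> {1,2}" and j: "j \<in> {1,2}"
  shows "lfr_A (lfr_of s M) i j = lfr_A S i j" "lfr_B (lfr_of s M) i = lfr_B S i"
    "lfr_C (lfr_of s M) j = lfr_C S j" "lfr_D (lfr_of s M) = lfr_D S"
proof -
  have 1: "(1::nat) \<in> {1,2}" by simp
  note B = assms(2)[OF i j] assms(2)[OF i 1] assms(2)[OF 1 j] assms(2)[OF 1 1] assms(3)[OF i] assms(3)[OF 1]
     assms(4)[OF j] assms(4)[OF 1] assms(5)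
  note E = assms(1)[OF i j] assms(1)[OF i 1] assms(1)[OF 1 j] assms(1)[OF 1 1]
  show "lfr_A (lfr_of s M) i j = lfr_A S i j" "lfr_B (lfr_of s M) i = lfr_B S i"
    "lfr_C (lfr_of s M) j = lfr_C S j" "lfr_D (lfr_of s M) = lfr_D S"
    unfolding lfr_of_def split_block_def Let_def lfr.simps prod.case E lfr_mat_def
    using B by auto
qed

text \<open>
  In the following, \<open>d\<close> and \<open>e\<close> are the channel dimensions of the plant and of the controller.
\<close>

definition input_factor :: "plant \<Rightarrow> lfr \<Rightarrow> nat \<Rightarrow> real mat" where
  "input_factor G K i = (let
       d = (\<lambda>i. dim_row (pl_A G i i)); e = (\<lambda>i. dim_row (lfr_A K i i));
       n\<^sub>z = dim_row (pl_Dp G); m = dim_col (pl_D1 G) in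
     (0\<^sub>m (d i) (e i) @\<^sub>c pl_B G i) @\<^sub>r
     (1\<^sub>m (e i)       @\<^sub>c 0\<^sub>m (e i) m) @\<^sub>r
     (0\<^sub>m n\<^sub>z (e i)    @\<^sub>c pl_D1 G))"

definition closed_loop_mat :: "plant \<Rightarrow> lfr \<Rightarrow> nat \<Rightarrow> nat \<Rightarrow> real mat" where
  "closed_loop_mat G K i j = (let
       d = (\<lambda>i. dim_row (pl_A G i i)); e = (\<lambda>i. dim_row (lfr_A K i i));
       n\<^sub>w = dim_col (pl_Dp G); n\<^sub>z = dim_row (pl_Dp G); k = dim_row (pl_D2 G) in
     ((pl_A G i j      @\<^sub>c 0\<^sub>m (d i) (e j) @\<^sub>c pl_Bp G i) @\<^sub>r
      (0\<^sub>m (e i) (d j) @\<^sub>c 0\<^sub>m (e i) (e j) @\<^sub>c 0\<^sub>m (e i) n\<^sub>w) @\<^sub>r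
      (pl_Cp G j       @\<^sub>c 0\<^sub>m n\<^sub>z (e j)    @\<^sub>c pl_Dp G))
     + input_factor G K i * lfr_mat K i j *
     ((0\<^sub>m (e j) (d j) @\<^sub>c 1\<^sub>m (e j)   @\<^sub>c 0\<^sub>m (e j) n\<^sub>w) @\<^sub>r
      (pl_C G j        @\<^sub>c 0\<^sub>m k (e j) @\<^sub>c pl_D2 G)))"

definition closed_loop :: "plant \<Rightarrow> lfr \<Rightarrow> lfr" where
  "closed_loop G K =
     lfr_of (\<lambda>i. dim_row (pl_A G i i) + dim_row (lfr_A K i i)) (closed_loop_mat G K)"

text \<open>The transformed closed loop, affine in the variables \<open>X\<^sub>i, Y\<^sub>j\<close> and \<open>K = (K\<^sub>i\<^sub>j, L\<^sub>i; M\<^sub>j, N)\<close>.\<close>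

definition transformed_loop_mat ::
  "plant \<Rightarrow> (nat \<Rightarrow> real mat) \<Rightarrow> (nat \<Rightarrow> real mat) \<Rightarrow> lfr \<Rightarrow> nat \<Rightarrow> nat \<Rightarrow> real mat" where
  "transformed_loop_mat G X Y K i j = (let
       d = (\<lambda>i. dim_row (pl_A G i i)); e = (\<lambda>i. dim_row (lfr_A K i i));
       n\<^sub>w = dim_col (pl_Dp G); k = dim_row (pl_D2 G) in
     ((pl_A G i j * Y j  @\<^sub>c pl_A G i j          @\<^sub>c pl_Bp G i) @\<^sub>r
      (0\<^sub>m (e i) (e j)   @\<^sub>c (X i)\<^sup>T * pl_A G i j @\<^sub>c (X i)\<^sup>T * pl_Bp G i) @\<^sub>r
      (pl_Cp G j * Y j   @\<^sub>c pl_Cp G j           @\<^sub>c pl_Dp G))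
     + input_factor G K i * lfr_mat K i j *
     ((1\<^sub>m (e j)   @\<^sub>c 0\<^sub>m (e j) (d j) @\<^sub>c 0\<^sub>m (e j) n\<^sub>w) @\<^sub>r
      (0\<^sub>m k (e j) @\<^sub>c pl_C G j        @\<^sub>c pl_D2 G)))"

definition transformed_loop ::
  "plant \<Rightarrow> (nat \<Rightarrow> real mat) \<Rightarrow> (nat \<Rightarrow> real mat) \<Rightarrow> lfr \<Rightarrow> lfr" where
  "transformed_loop G X Y K =
     lfr_of (\<lambda>i. dim_row (pl_A G i i) + dim_row (lfr_A K i i)) (transformed_loop_mat G X Y K)"


section \<open>Scalings\<close>

definition scalings :: "real mat set \<Rightarrow> nat \<Rightarrow> (real mat \<Rightarrow> real mat) \<Rightarrow> real mat set" where
  "scalings VV r \<Delta> = {P \<in> sym_mats r. \<forall>V \<in> VV. pos_def (He (P * \<Delta> V))}"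

definition primal_scalings :: "real mat set \<Rightarrow> nat \<Rightarrow> nat \<Rightarrow> real mat set" where
  "primal_scalings VV u v = scalings VV (u + v) (Delta_l u v)"

definition dual_scalings :: "real mat set \<Rightarrow> nat \<Rightarrow> nat \<Rightarrow> real mat set" where
  "dual_scalings VV u v = scalings VV (u + v) (\<lambda>V. (Delta_l u v V)\<^sup>T)"

definition loop_scalings ::
  "real mat set \<Rightarrow> nat \<Rightarrow> nat \<Rightarrow> nat \<Rightarrow> (real mat \<Rightarrow> real mat) \<Rightarrow> real mat set" where
  "loop_scalings VV u v r\<^sub>c \<Delta>\<^sub>c =
     scalings VV (u + v + r\<^sub>c) (\<lambda>V. diag_block_mat [Delta_l u v V, \<Delta>\<^sub>c V])"

end

(*
  Evaluated on vectors, both inequalities become quadratic forms in block vectors. Let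
  Y_1, T be the first block column of the inverse of the Lyapunov matrix and X_1, U the first
  block column of the matrix itself, and put
    yt_1 = [Y_1 I; T 0],   so that   \<X> yt_1 = [I X_1; 0 U].
  For the multiplier the controller channel is split as r_1 + r_2, and a third column is inserted:
  with (Qt; Va; Vb) the first block column of the inverse of \<P>, and W chosen to annihilate the last
  block row,
    yt_2 = [Qt I I; Va 0 0; Vb W 0],   \<P> yt_2 = [I Q_2 Q_3; 0 S Ua; 0 0 Ub].
  The zero pattern of the controller then forces exactly the zeros and the entry Q_2^T A_22 of the
  transformed controller, and the triangular shape of \<Delta>_c makes the diagonal blocks of
  yt_2^T He[\<P> \<Delta>_lc] yt_2 equal to He[\<Delta>_l Qt], He[Q_2 \<Delta>_l], He[Q_3 \<Delta>_l], with free off-diagonal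
  blocks. So the two forms agree under the substitution by yt_1 and yt_2.

  Neither substitution need be invertible. From (a) to (b), yt_1 and yt_2 may have a kernel; there
  a small change of X_1 and of the transformed controller makes the form negative, and a
  compactness argument keeps it negative elsewhere. From (b) to (a), I - Qt Q_2 and Q_2 - Q_3 must be
  nonsingular; scaling Q_2 by 1 + e achieves this for all but finitely many e and stays in the cone
  of scalings.
*)

theory Submission
  imports Defs "HOL-Library.Function_Algebras" "HOL-Analysis.Function_Topology"
    "Jordan_Normal_Form.Spectral_Radius"
begin

text \<open>The three columns of \<open>yt_2\<close> are nested eliminations of the controller
  channel: \<open>Q3\<close> is the leading block of \<open>\<P>\<close>, \<open>Q2\<close> is the
  Schur complement left after eliminating the second part only, and eliminating both parts leaves
  the inverse of \<open>Qt\<close>. The intermediate step is available because the triangular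
  \<open>\<Delta>\<^sub>c\<close> feeds nothing from the second part into the first. In the converse
  direction the same shape leaves three free blocks of \<open>\<Delta>\<^sub>c\<close>, one for each
  cross term between the three columns; the controller built there has \<open>n\<close> states and
  two scheduling parts of size \<open>r\<close>. Both repairs of a singular substitution have to
  respect membership in the cones of scalings. Toward (b), \<open>Y_1\<close>, \<open>Qt\<close>,
  \<open>Q2\<close> and \<open>Q3\<close> are therefore left untouched and only \<open>X_1\<close>
  and the transformed controller move; toward (a), \<open>Q2\<close> moves along its own ray. In
  either case the two forms are affine in the size of the change, so one first-order argument serves
  both inequalities and a common size can be chosen. \<open>Z\<close> never changes.\<close>

declare One_nat_def [simp del]

section \<open>Block vectors\<close>

text \<open>
  Vectors of length \<open>n\<close> are functions vanishing from \<open>n\<close> on. Unlike \<^typ>\<open>real vec\<close>, they form a group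
  as a whole, so that no carrier conditions are needed for linear combinations.
\<close>

definition fvecs :: "nat \<Rightarrow> (nat \<Rightarrow> real) set" where
  "fvecs n = {f. \<forall>i\<ge>n. f i = 0}"

definition dot :: "nat \<Rightarrow> (nat \<Rightarrow> real) \<Rightarrow> (nat \<Rightarrow> real) \<Rightarrow> real" where
  "dot n f g = (\<Sum>i<n. f i * g i)"

text \<open>Entries of the argument from \<open>dim_col M\<close> on are ignored and the result
  vanishes from \<open>dim_row M\<close> on. Hence composition needs only the inner dimensions to
  agree, and a leading block can be applied to a whole stacked vector.\<close>

definition act :: "real mat \<Rightarrow> (nat \<Rightarrow> real) \<Rightarrow> nat \<Rightarrow> real" where
  "act M f = (\<lambda>i. if i < dim_row M then \<Sum>j<dim_col M. M $$ (i, j) * f j else 0)"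

definition cat :: "nat \<Rightarrow> (nat \<Rightarrow> real) \<Rightarrow> (nat \<Rightarrow> real) \<Rightarrow> nat \<Rightarrow> real" where
  "cat n f g = (\<lambda>i. if i < n then f i else g (i - n))"

definition initial :: "nat \<Rightarrow> (nat \<Rightarrow> real) \<Rightarrow> nat \<Rightarrow> real" where
  "initial n f = (\<lambda>i. if i < n then f i else 0)"

definition tail :: "nat \<Rightarrow> (nat \<Rightarrow> real) \<Rightarrow> nat \<Rightarrow> real" where
  "tail n f = (\<lambda>i. f (i + n))"

definition scl :: "real \<Rightarrow> (nat \<Rightarrow> real) \<Rightarrow> nat \<Rightarrow> real" where
  "scl c f = (\<lambda>i. c * f i)"

section \<open>Linear maps on stacked vectors\<close>

lemma fvecs_act [simp, intro]: "dim_row M = n \<Longrightarrow> act M f \<in> fvecs n"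
  by (simp add: fvecs_def act_def)

lemma fvecs_zero [simp, intro]: "0 \<in> fvecs n"
  by (simp add: fvecs_def)

lemma fvecs_add [intro]: "f \<in> fvecs n \<Longrightarrow> g \<in> fvecs n \<Longrightarrow> f + g \<in> fvecs n"
  by (simp add: fvecs_def)

lemma fvecs_diff [intro]: "f \<in> fvecs n \<Longrightarrow> g \<in> fvecs n \<Longrightarrow> f - g \<in> fvecs n"
  by (simp add: fvecs_def)

lemma fvecs_minus [intro]: "f \<in> fvecs n \<Longrightarrow> - f \<in> fvecs n"
  by (simp add: fvecs_def)

lemma fvecs_scl [intro]: "f \<in> fvecs n \<Longrightarrow> scl c f \<in> fvecs n"
  by (simp add: fvecs_def scl_def)

lemma fvecs_cat [intro]: "g \<in> fvecs m \<Longrightarrow> cat n f g \<in> fvecs (n + m)"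
  by (simp add: fvecs_def cat_def)

lemma fvecs_initial [simp, intro]: "initial n f \<in> fvecs n"
  by (simp add: fvecs_def initial_def)

lemma initial_id: "f \<in> fvecs n \<Longrightarrow> initial n f = f"
  by (auto simp: fvecs_def initial_def)

lemma cat_exhaust:
  assumes "h \<in> fvecs (n + m)"
  obtains f g where "f \<in> fvecs n" "g \<in> fvecs m" "h = cat n f g"
proof
  show "initial n h \<in> fvecs n" by simp
  show "tail n h \<in> fvecs m" using assms by (auto simp: fvecs_def tail_def)
  show "h = cat n (initial n h) (tail n h)" by (auto simp: cat_def initial_def tail_def)
qed

lemma tail_cat [simp]: "tail n (cat n f g) = g"
  by (simp add: tail_def cat_def)

lemma initial_cat: "f \<in> fvecs n \<Longrightarrow> initial n (cat n f g) = f"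
  by (auto simp: fvecs_def initial_def cat_def)

lemma cat_eq_iff: "f \<in> fvecs n \<Longrightarrow> f' \<in> fvecs n \<Longrightarrow> cat n f g = cat n f' g' \<longleftrightarrow> f = f' \<and> g = g'"
  by (metis initial_cat tail_cat)

lemma cat_zero [simp]: "cat n 0 0 = 0"
  by (auto simp: cat_def)

lemma cat_0_right [simp]: "f \<in> fvecs n \<Longrightarrow> cat n f 0 = f"
  by (auto simp: cat_def fvecs_def)

lemma cat_eq_0_iff: "f \<in> fvecs n \<Longrightarrow> cat n f g = 0 \<longleftrightarrow> f = 0 \<and> g = 0"
  using cat_eq_iff[of f n 0 g 0] by simp

lemma cat_add: "cat n f g + cat n f' g' = cat n (f + f') (g + g')"
  by (auto simp: cat_def)

lemma cat_assoc: "cat n f (cat m g h) = cat (n + m) (cat n f g) h"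
  by (auto simp: cat_def fun_eq_iff)

lemma act_add [simp]: "act M (f + g) = act M f + act M g"
  by (auto simp: act_def sum.distrib algebra_simps)

lemma act_diff [simp]: "act M (f - g) = act M f - act M g"
  by (auto simp: act_def sum_subtractf algebra_simps)

lemma act_minus [simp]: "act M (- f) = - act M f"
  by (auto simp: act_def sum_negf)

lemma act_0 [simp]: "act M 0 = 0"
  by (auto simp: act_def)

lemma act_scl [simp]: "act M (scl c f) = scl c (act M f)"
  by (auto simp: act_def scl_def sum_distrib_left algebra_simps)

lemma act_zero_mat [simp]: "act (0\<^sub>m n m) f = 0"
  by (auto simp: act_def)

lemma act_one_mat: "act (1\<^sub>m n) f = initial n f"
proof
  fix i
  show "act (1\<^sub>m n) f i = initial n f i"
    by (cases "i < n") (simp_all add: act_def initial_def if_distrib[of "\<lambda>x. x * _"] sum.If_cases)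
qed

lemma act_one_mat_id [simp]: "f \<in> fvecs n \<Longrightarrow> act (1\<^sub>m n) f = f"
  by (simp add: act_one_mat initial_id)

lemma act_plus_mat:
  assumes "dim_row A = dim_row B" "dim_col A = dim_col B"
  shows "act (A + B) f = act A f + act B f"
proof
  fix i
  show "act (A + B) f i = (act A f + act B f) i"
    using assms by (simp add: act_def sum.distrib distrib_right)
qed

lemma act_minus_mat:
  assumes "dim_row A = dim_row B" "dim_col A = dim_col B"
  shows "act (A - B) f = act A f - act B f"
proof
  fix i
  show "act (A - B) f i = (act A f - act B f) i"
    using assms by (simp add: act_def sum_subtractf left_diff_distrib)
qed

lemma act_uminus_mat [simp]: "act (- A) f = - act A f"
  by (auto simp: act_def sum_negf[symmetric])

lemma act_smult_mat [simp]: "act (c \<cdot>\<^sub>m A) f = scl c (act A f)"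
  by (auto simp: act_def scl_def sum_distrib_left algebra_simps)

lemma act_mult_mat:
  assumes "dim_col A = dim_row B"
  shows "act (A * B) f = act A (act B f)"
proof
  fix i
  show "act (A * B) f i = act A (act B f) i"
  proof (cases "i < dim_row A")
    case True
    then have "act (A * B) f i
        = (\<Sum>j<dim_col B. \<Sum>l<dim_row B. A $$ (i, l) * B $$ (l, j) * f j)"
      using assms by (simp add: act_def scalar_prod_def sum_distrib_right atLeast0LessThan)
    also have "\<dots> = (\<Sum>l<dim_row B. \<Sum>j<dim_col B. A $$ (i, l) * B $$ (l, j) * f j)"
      by (rule sum.swap)
    also have "\<dots> = act A (act B f) i"
      using True assms by (simp add: act_def sum_distrib_left algebra_simps)
    finally show ?thesis .
  qed (simp add: act_def)
qed

lemma sum_lessThan_add: "(\<Sum>j<n + m. h j) = (\<Sum>j<n. h j) + (\<Sum>j<m. h (j + n))" for h :: "nat \<Rightarrow> real"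
  by (induction m) (simp_all add: add.commute add.left_commute)

lemma act_cat:
  "dim_col A \<le> n \<Longrightarrow> act A (cat n f g) = act A f"
  by (auto simp: act_def cat_def intro!: sum.cong)

lemma act_initial:
  "dim_col A \<le> n \<Longrightarrow> act A (initial n f) = act A f"
  by (auto simp: act_def initial_def intro!: sum.cong)

lemma act_four_block_mat:
  assumes "dim_row B = dim_row A" "dim_col B = dim_col D" "dim_row C = dim_row D" "dim_col C = dim_col A"
  shows "act (four_block_mat A B C D) f
    = cat (dim_row A) (act A f + act B (tail (dim_col A) f)) (act C f + act D (tail (dim_col A) f))"
proof
  fix i
  show "act (four_block_mat A B C D) f i
    = cat (dim_row A) (act A f + act B (tail (dim_col A) f)) (act C f + act D (tail (dim_col A) f)) i"
    using assms by (auto simp: act_def cat_def tail_def sum_lessThan_add)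
qed

lemma dim_append_cols [simp]:
  "dim_row (A @\<^sub>c B) = dim_row A" "dim_col (A @\<^sub>c B) = dim_col A + dim_col B"
  by (simp_all add: append_cols_def)

lemma dim_append_rows [simp]:
  "dim_row (A @\<^sub>r B) = dim_row A + dim_row B" "dim_col (A @\<^sub>r B) = dim_col A"
  by (simp_all add: append_rows_def)

lemma act_append_cols:
  assumes "dim_row A = dim_row B"
  shows "act (A @\<^sub>c B) f = act A f + act B (tail (dim_col A) f)"
proof
  fix i
  show "act (A @\<^sub>c B) f i = (act A f + act B (tail (dim_col A) f)) i"
    using assms by (simp add: append_cols_def act_def tail_def sum_lessThan_add)
qed

lemma act_transpose_append_cols:
  "dim_row A = dim_row B \<Longrightarrow> act (A @\<^sub>c B)\<^sup>T f = cat (dim_col A) (act A\<^sup>T f) (act B\<^sup>T f)"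
  by (auto simp: act_def append_cols_def cat_def fun_eq_iff)

lemma act_append_rows:
  assumes "dim_col A = dim_col B"
  shows "act (A @\<^sub>r B) f = cat (dim_row A) (act A f) (act B f)"
proof
  fix i
  show "act (A @\<^sub>r B) f i = cat (dim_row A) (act A f) (act B f) i"
    using assms by (simp add: append_rows_def act_def cat_def)
qed

lemma act_diag_block_mat2:
  "act (diag_block_mat [A, B]) f = cat (dim_row A) (act A f) (act B (tail (dim_col A) f))"
  by (simp add: Let_def act_four_block_mat)

lemma dot_commute: "dot n f g = dot n g f"
  by (simp add: dot_def mult.commute)

lemma dot_add_left [simp]: "dot n (f + g) h = dot n f h + dot n g h"
  by (simp add: dot_def sum.distrib algebra_simps)

lemma dot_add_right [simp]: "dot n h (f + g) = dot n h f + dot n h g"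
  by (simp add: dot_def sum.distrib algebra_simps)

lemma dot_diff_left [simp]: "dot n (f - g) h = dot n f h - dot n g h"
  by (simp add: dot_def sum_subtractf algebra_simps)

lemma dot_diff_right [simp]: "dot n h (f - g) = dot n h f - dot n h g"
  by (simp add: dot_def sum_subtractf algebra_simps)

lemma dot_minus_left [simp]: "dot n (- f) g = - dot n f g"
  by (simp add: dot_def sum_negf)

lemma dot_minus_right [simp]: "dot n f (- g) = - dot n f g"
  by (simp add: dot_def sum_negf)

lemma dot_scl_left [simp]: "dot n (scl c f) g = c * dot n f g"
  by (simp add: dot_def scl_def sum_distrib_left algebra_simps)

lemma dot_scl_right [simp]: "dot n f (scl c g) = c * dot n f g"
  by (simp add: dot_def scl_def sum_distrib_left algebra_simps)

lemma dot_0 [simp]: "dot n 0 f = 0" "dot n f 0 = 0" "dot 0 f g = 0"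
  by (simp_all add: dot_def)

lemma dot_initial [simp]: "dot n (initial n f) g = dot n f g" "dot n f (initial n g) = dot n f g"
  by (auto simp: dot_def initial_def intro!: sum.cong)

lemma dot_cat: "dot (n + m) (cat n f g) (cat n f' g') = dot n f f' + dot m g g'"
  by (simp add: dot_def cat_def sum_lessThan_add)

lemma dot_self_ge0: "0 \<le> dot n f f"
  by (simp add: dot_def sum_nonneg)

lemma dot_self_pos: "f \<in> fvecs n \<Longrightarrow> f \<noteq> 0 \<Longrightarrow> 0 < dot n f f"
proof -
  assume f: "f \<in> fvecs n" "f \<noteq> 0"
  then obtain i where i: "f i \<noteq> 0" by (auto simp: fun_eq_iff)
  with f have "i < n" by (auto simp: fvecs_def not_less[symmetric])
  with i show ?thesis unfolding dot_def
    by (intro sum_pos2[of _ i]) (auto simp: zero_less_mult_iff)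
qed

lemma dot_eqI:
  assumes "\<And>h. h \<in> fvecs n \<Longrightarrow> dot n h f = dot n h g" "f \<in> fvecs n" "g \<in> fvecs n"
  shows "f = g"
  using dot_self_pos[of "f - g" n] assms(1)[of "f - g"] assms(2,3) by (force intro: fvecs_diff)

lemma dot_act_left:
  assumes "dim_row A = n"
  shows "dot n (act A f) g = dot (dim_col A) f (act A\<^sup>T g)"
proof -
  have "dot n (act A f) g = (\<Sum>i<n. \<Sum>j<dim_col A. A $$ (i,j) * f j * g i)"
    using assms by (simp add: dot_def act_def sum_distrib_right)
  also have "\<dots> = (\<Sum>j<dim_col A. \<Sum>i<n. A $$ (i,j) * f j * g i)" by (rule sum.swap)
  also have "\<dots> = dot (dim_col A) f (act A\<^sup>T g)"
    using assms by (simp add: dot_def act_def sum_distrib_left algebra_simps)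
  finally show ?thesis .
qed

lemma dot_act_right: "dim_row A = n \<Longrightarrow> dot n g (act A f) = dot (dim_col A) (act A\<^sup>T g) f"
  using dot_act_left[of A n f g] by (simp add: dot_commute)

section \<open>Definiteness, symmetry and inverses of matrices\<close>

lemma mult_mat_vec_act: "v \<in> carrier_vec (dim_col M) \<Longrightarrow> M *\<^sub>v v = vec (dim_row M) (act M (\<lambda>i. v $ i))"
  by (intro eq_vecI) (auto simp: act_def scalar_prod_def atLeast0LessThan)

lemma scalar_prod_mult_mat_vec:
  assumes "M \<in> carrier_mat n n" "v \<in> carrier_vec n"
  shows "v \<bullet> (M *\<^sub>v v) = dot n (\<lambda>i. v $ i) (act M (\<lambda>i. v $ i))"
  using assms mult_mat_vec_act[of v M] by (auto simp: dot_def scalar_prod_def atLeast0LessThan)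

text \<open>An arbitrary predicate \<open>P\<close> lets positive and negative definiteness transfer
  by the same argument.\<close>

lemma ball_carrier_vec_fvecs:
  assumes M: "M \<in> carrier_mat n n"
  shows "(\<forall>v \<in> carrier_vec n. v \<noteq> 0\<^sub>v n \<longrightarrow> P (v \<bullet> (M *\<^sub>v v)))
    \<longleftrightarrow> (\<forall>f \<in> fvecs n. f \<noteq> 0 \<longrightarrow> P (dot n f (act M f)))"
proof safe
  fix f assume *: "\<forall>v \<in> carrier_vec n. v \<noteq> 0\<^sub>v n \<longrightarrow> P (v \<bullet> (M *\<^sub>v v))" and f: "f \<in> fvecs n" "f \<noteq> 0"
  have "vec n f \<noteq> 0\<^sub>v n"
  proof
    assume "vec n f = 0\<^sub>v n"
    then have "vec n f $ i = 0" if "i < n" for i using that by simp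
    then have "f i = 0" for i using f(1) by (cases "i < n") (auto simp: fvecs_def)
    with f(2) show False by (simp add: fun_eq_iff)
  qed
  with * have "P (vec n f \<bullet> (M *\<^sub>v vec n f))" by simp
  also have "vec n f \<bullet> (M *\<^sub>v vec n f) = dot n (\<lambda>i. vec n f $ i) (act M (\<lambda>i. vec n f $ i))"
    by (rule scalar_prod_mult_mat_vec[OF M]) simp
  also have "act M (\<lambda>i. vec n f $ i) = act M f"
    using M by (auto simp: act_def intro!: sum.cong)
  also have "dot n (\<lambda>i. vec n f $ i) (act M f) = dot n f (act M f)"
    by (auto simp: dot_def intro!: sum.cong)
  finally show "P (dot n f (act M f))" .
next
  fix v :: "real vec"
  assume *: "\<forall>f\<in>fvecs n. f \<noteq> 0 \<longrightarrow> P (dot n f (act M f))" and v: "v \<in> carrier_vec n" "v \<noteq> 0\<^sub>v n"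
  define f where "f = initial n (\<lambda>i. v $ i)"
  have "f \<noteq> 0"
  proof
    assume "f = 0"
    then have "v $ i = 0" if "i < n" for i
      using that by (auto simp: f_def initial_def fun_eq_iff dest: spec[of _ i])
    with v show False by (auto intro!: eq_vecI)
  qed
  moreover have "f \<in> fvecs n" by (simp add: f_def)
  ultimately have "P (dot n f (act M f))" using * by blast
  moreover have "dot n f (act M f) = v \<bullet> (M *\<^sub>v v)"
    using M by (simp add: scalar_prod_mult_mat_vec[OF M v(1)] f_def act_initial)
  ultimately show "P (v \<bullet> (M *\<^sub>v v))" by simp
qed

lemma neg_def_iff:
  assumes "M \<in> sym_mats n"
  shows "neg_def M \<longleftrightarrow> (\<forall>f \<in> fvecs n. f \<noteq> 0 \<longrightarrow> dot n f (act M f) < 0)"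
  using assms ball_carrier_vec_fvecs[of M n "\<lambda>x. x < 0"] by (auto simp: neg_def_def sym_mats_def)

lemma pos_def_iff:
  assumes "M \<in> sym_mats n"
  shows "pos_def M \<longleftrightarrow> (\<forall>f \<in> fvecs n. f \<noteq> 0 \<longrightarrow> dot n f (act M f) > 0)"
  using assms ball_carrier_vec_fvecs[of M n "\<lambda>x. x > 0"] by (auto simp: pos_def_def sym_mats_def)

lemma act_unit: "M \<in> carrier_mat nr nc \<Longrightarrow> i < nr \<Longrightarrow> j < nc \<Longrightarrow>
    act M (\<lambda>l. if l = j then 1 else 0) i = M $$ (i, j)"
  by (simp add: act_def if_distrib sum.If_cases)

lemma mat_eqI_act:
  assumes "A \<in> carrier_mat nr nc" "B \<in> carrier_mat nr nc" "\<And>f. f \<in> fvecs nc \<Longrightarrow> act A f = act B f"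
  shows "A = B"
proof (rule eq_matI)
  fix i j assume ij: "i < dim_row B" "j < dim_col B"
  have "(\<lambda>l. if l = j then 1 else (0::real)) \<in> fvecs nc"
    using ij assms(2) by (auto simp: fvecs_def)
  from assms(3)[OF this] have "act A (\<lambda>l. if l = j then 1 else 0) i = act B (\<lambda>l. if l = j then 1 else 0) i"
    by simp
  with ij show "A $$ (i,j) = B $$ (i,j)"
    using act_unit[OF assms(1), of i j] act_unit[OF assms(2), of i j] assms(1,2) by auto
qed (use assms in auto)

text \<open>This criterion suits matrices whose action is explicit on substituted vectors, such as
  the multipliers constructed later.\<close>

lemma sym_matsI:
  assumes M: "M \<in> carrier_mat n n"
    and "\<And>f g. f \<in> fvecs n \<Longrightarrow> g \<in> fvecs n \<Longrightarrow> dot n f (act M g) = dot n (act M f) g"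
  shows "M \<in> sym_mats n"
proof -
  have "M\<^sup>T = M"
  proof (rule mat_eqI_act)
    fix g assume g: "g \<in> fvecs n"
    show "act M\<^sup>T g = act M g"
    proof (rule dot_eqI)
      fix h assume "h \<in> fvecs n"
      with assms(2)[OF this g] show "dot n h (act M\<^sup>T g) = dot n h (act M g)"
        using dot_act_left[of M n h g] M by simp
    qed (use M in auto)
  qed (use M in auto)
  with M show ?thesis by (simp add: sym_mats_def)
qed

lemma sym_matsD:
  assumes "M \<in> sym_mats n"
  shows "dim_row M = n" "dim_col M = n" "M \<in> carrier_mat n n" "M\<^sup>T = M"
    "dot n f (act M g) = dot n (act M f) g"
  using assms dot_act_left[of M n f g] by (auto simp: sym_mats_def)

text \<open>Injectivity is the shape in which definiteness yields invertibility: a nonzero kernel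
  vector would annihilate an expression that has to be positive.\<close>

lemma act_inj_imp_inverse:
  assumes M: "M \<in> carrier_mat n n" and inj: "\<And>f. f \<in> fvecs n \<Longrightarrow> act M f = 0 \<Longrightarrow> f = 0"
  obtains B where "B \<in> carrier_mat n n" "M * B = 1\<^sub>m n" "B * M = 1\<^sub>m n"
proof -
  have "det M \<noteq> 0"
  proof
    assume "det M = 0"
    then obtain v where v: "v \<in> carrier_vec n" "v \<noteq> 0\<^sub>v n" "M *\<^sub>v v = 0\<^sub>v n"
      using det_0_iff_vec_prod_zero_field[OF M] by auto
    have "act M (initial n (\<lambda>i. v $ i)) = 0"
    proof
      fix i
      have "(M *\<^sub>v v) $ i = act M (\<lambda>i. v $ i) i" if "i < n"
        using mult_mat_vec_act[of v M] v M that by simp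
      then have "act M (\<lambda>i. v $ i) i = 0" using v(3) M
        by (cases "i < n") (simp_all, simp add: act_def)
      then show "act M (initial n (\<lambda>i. v $ i)) i = 0 i"
        using M by (simp add: act_initial)
    qed
    from inj[OF _ this] have "initial n (\<lambda>i. v $ i) = 0" by simp
    then have "v $ i = 0" if "i < n" for i
      using that by (auto simp: initial_def fun_eq_iff dest: spec[of _ i])
    with v show False by (auto intro!: eq_vecI)
  qed
  from det_non_zero_imp_unit[OF M this, of "()"] that show ?thesis
    by (auto simp: Units_def ring_mat_def)
qed

section \<open>Compactness of spheres and perturbation of negative semidefinite forms\<close>

lemma compact_box: "compact {f :: nat \<Rightarrow> real. \<forall>i. f i \<in> (if i < n then {-1..1} else {0})}"
proof -
  have "compactin (product_topology (\<lambda>i. euclidean) UNIV)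
      (PiE UNIV (\<lambda>i. if i < n then {-1..1} else {0 :: real}))"
    by (auto simp: compactin_PiE)
  moreover have "PiE UNIV (\<lambda>i. if i < n then {-1..1} else {0 :: real})
      = {f. \<forall>i. f i \<in> (if i < n then {-1..1} else {0})}"
    by (auto simp: PiE_UNIV_domain Pi_def)
  ultimately show ?thesis
    by (simp add: euclidean_product_topology)
qed

lemma continuous_on_dot :
  assumes "continuous_on S f" "continuous_on S g"
  shows "continuous_on S (\<lambda>x. dot n (f x) (g x))"
  unfolding dot_def
  by (intro continuous_on_sum continuous_on_mult
      continuous_on_product_then_coordinatewise[OF assms(1)]
      continuous_on_product_then_coordinatewise[OF assms(2)])

lemma continuous_on_act :
  assumes "continuous_on S f"
  shows "continuous_on S (\<lambda>x. act M (f x))"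
proof (rule continuous_on_coordinatewise_then_product)
  fix i
  show "continuous_on S (\<lambda>x. act M (f x) i)"
    unfolding act_def
    by (cases "i < dim_row M")
      (simp_all, intro continuous_on_sum continuous_on_mult continuous_on_const
        continuous_on_product_then_coordinatewise[OF assms])
qed

text \<open>The function type carries the product topology, so the sphere is compact as a closed
  subset of a product of compact sets, with only \<open>{0}\<close> in the coordinates from
  \<open>n\<close> on.\<close>

lemma compact_sphere: "compact {f \<in> fvecs n. dot n f f = 1}"
proof -
  have "{f \<in> fvecs n. dot n f f = 1} \<subseteq> {f. \<forall>i. f i \<in> (if i < n then {-1..1} else {0})}"
  proof safe
    fix f i assume f: "f \<in> fvecs n" "dot n f f = 1"
    show "f i \<in> (if i < n then {-1..1} else {0})"
    proof (cases "i < n")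
      case True
      then have "f i * f i \<le> dot n f f"
        unfolding dot_def by (intro member_le_sum) auto
      then have "(f i)\<^sup>2 \<le> 1" using f by (simp add: power2_eq_square)
      with True show ?thesis by (auto simp: abs_square_le_1)
    qed (use f in \<open>auto simp: fvecs_def\<close>)
  qed
  then have eq: "{f \<in> fvecs n. dot n f f = 1}
      = {f. \<forall>i. f i \<in> (if i < n then {-1..1} else {0})} \<inter> {f. dot n f f = 1}"
    by (auto simp: fvecs_def split: if_splits)
  have "closed {f. dot n f f = 1}"
    by (intro closed_Collect_eq continuous_on_dot continuous_on_id continuous_on_const)
  with compact_box show ?thesis unfolding eq by (rule compact_Int_closed)
qed

text \<open>The form of \<open>M0\<close> may vanish, but only where that of \<open>M1\<close> is
  negative. The part \<open>K\<close> of the unit sphere where the form of \<open>M1\<close> is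
  nonnegative is compact and contains no zero of the form of \<open>M0\<close>, so \<open>M0\<close>
  dominates there for small \<open>e\<close>; elsewhere both terms have the right sign.\<close>

lemma neg_form_perturb:
  fixes M0 M1 :: "real mat"
  assumes neg: "\<And>f. f \<in> fvecs n \<Longrightarrow> f \<noteq> 0 \<Longrightarrow>
      dot n f (act M0 f) < 0 \<or> dot n f (act M0 f) = 0 \<and> dot n f (act M1 f) < 0"
  obtains e0 where "0 < e0" "\<And>e f. 0 < e \<Longrightarrow> e < e0 \<Longrightarrow> f \<in> fvecs n \<Longrightarrow> f \<noteq> 0 \<Longrightarrow>
      (1 - e) * dot n f (act M0 f) + e * dot n f (act M1 f) < 0"
proof -
  let ?S = "{f \<in> fvecs n. dot n f f = 1}"
  let ?q0 = "\<lambda>f. dot n f (act M0 f)" and ?q1 = "\<lambda>f. dot n f (act M1 f)"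
  define K where "K = ?S \<inter> {f. 0 \<le> ?q1 f}"
  have S0: "f \<noteq> 0" if "f \<in> ?S" for f using that by auto
  have "closed {f. 0 \<le> ?q1 f}" by (intro closed_Collect_le continuous_on_dot continuous_on_act continuous_on_id continuous_on_const)
  then have "compact K" unfolding K_def using compact_sphere by (intro compact_Int_closed)
  have "\<exists>e0>0. \<forall>e. 0 < e \<longrightarrow> e < e0 \<longrightarrow> (\<forall>f\<in>?S. (1 - e) * ?q0 f + e * ?q1 f < 0)"
  proof (cases "K = {}")
    \<comment> \<open>No maximum over \<open>K\<close> exists here, but the form of
      \<open>M1\<close> is then negative on the whole sphere and every \<open>e\<close> below 1
      works.\<close>
    case True
    have "(1 - e) * ?q0 f + e * ?q1 f < 0" if "0 < e" "e < 1" "f \<in> ?S" for e f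
    proof -
      from True that have "?q1 f < 0" by (auto simp: K_def)
      moreover from neg[of f] S0[of f] that have "?q0 f \<le> 0" by force
      ultimately show ?thesis using that
        by (intro add_nonpos_neg mult_nonneg_nonpos mult_pos_neg) auto
    qed
    then show ?thesis by (intro exI[of _ 1]) auto
  next
    case False
    have cont: "continuous_on K (\<lambda>f. dot n f (act M f))" for M
      by (intro continuous_on_dot continuous_on_act continuous_on_id)
    obtain a where a: "a \<in> K" "\<And>f. f \<in> K \<Longrightarrow> ?q0 f \<le> ?q0 a"
      using continuous_attains_sup[OF \<open>compact K\<close> False cont[of M0]] by blast
    obtain b where b: "b \<in> K" "\<And>f. f \<in> K \<Longrightarrow> ?q1 f \<le> ?q1 b"
      using continuous_attains_sup[OF \<open>compact K\<close> False cont[of M1]] by blast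
    define m C where "m = - ?q0 a" and "C = ?q1 b"
    have "m > 0" using neg[of a] a(1) S0[of a] by (auto simp: K_def m_def)
    have "C \<ge> 0" using b(1) by (auto simp: K_def C_def)
    \<comment> \<open>The bound \<open>1/2\<close> keeps \<open>1 - e\<close> at least one half, and
      the second one gives \<open>e * C < m / 2\<close>, which the first term absorbs;
      \<open>C + 1\<close> avoids a division by zero.\<close>
    define e0 where "e0 = min (1/2) (m / (2 * (C + 1)))"
    have "e0 > 0" using \<open>m > 0\<close> \<open>C \<ge> 0\<close> by (auto simp: e0_def)
    moreover have "(1 - e) * ?q0 f + e * ?q1 f < 0" if e: "0 < e" "e < e0" and f: "f \<in> ?S" for e f
    proof (cases "f \<in> K")
      case True
      have "e * (2 * (C + 1)) < m" using e \<open>C \<ge> 0\<close> by (auto simp: e0_def field_simps)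
      then have "e * C < m / 2" using e by (simp add: algebra_simps)
      moreover have "e * ?q1 f \<le> e * C" using b(2)[OF True] e by (simp add: C_def)
      moreover have "(1 - e) * ?q0 f \<le> (1 - e) * (- m)"
        using a(2)[OF True] e by (intro mult_left_mono) (auto simp: m_def e0_def)
      moreover have "(1 - e) * (- m) \<le> (1/2) * (- m)"
        using e \<open>m > 0\<close> by (intro mult_right_mono_neg) (auto simp: e0_def)
      ultimately show ?thesis by linarith
    next
      case False
      with f have "?q1 f < 0" by (auto simp: K_def)
      moreover from neg[of f] S0[of f] f have "?q0 f \<le> 0" by force
      ultimately show ?thesis using e
        by (intro add_nonpos_neg mult_nonneg_nonpos mult_pos_neg) (auto simp: e0_def)
    qed
    ultimately show ?thesis by blast
  qed
  then obtain e0 where e0: "e0 > 0"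
    "\<And>e f. 0 < e \<Longrightarrow> e < e0 \<Longrightarrow> f \<in> ?S \<Longrightarrow> (1 - e) * ?q0 f + e * ?q1 f < 0" by blast
  show ?thesis
  proof (rule that[OF e0(1)])
    fix e f assume e: "0 < e" "e < e0" and f: "f \<in> fvecs n" "f \<noteq> 0"
    define c where "c = 1 / sqrt (dot n f f)"
    have pos: "dot n f f > 0" using dot_self_pos f by blast
    then have c: "c > 0" "c * (c * dot n f f) = 1" by (auto simp: c_def field_simps)
    with f have "scl c f \<in> ?S" by (auto intro: fvecs_scl)
    from e0(2)[OF e this] have "c * c * ((1 - e) * ?q0 f + e * ?q1 f) < 0"
      by (simp add: algebra_simps)
    with c show "(1 - e) * ?q0 f + e * ?q1 f < 0"
      by (simp add: mult_less_0_iff)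
  qed
qed

text \<open>The values of \<open>e\<close> to be avoided when \<open>Q2\<close> is scaled are images
  of such eigenvalues, so arbitrarily small good values of \<open>e\<close> remain.\<close>

lemma finite_eigenvalues_act:
  assumes A: "A \<in> carrier_mat n n"
  shows "finite {c. \<exists>f \<in> fvecs n. f \<noteq> 0 \<and> act A f = scl c f}"
proof (rule finite_subset)
  show "finite (spectrum A)" by (rule card_finite_spectrum(1)[OF A])
  show "{c. \<exists>f \<in> fvecs n. f \<noteq> 0 \<and> act A f = scl c f} \<subseteq> spectrum A"
  proof safe
    fix c f assume f: "f \<in> fvecs n" "f \<noteq> 0" "act A f = scl c f"
    have "A *\<^sub>v vec n f = vec n (act A (\<lambda>i. vec n f $ i))"
      using mult_mat_vec_act[of "vec n f" A] A by simp
    also have "act A (\<lambda>i. vec n f $ i) = act A f"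
      using A by (auto simp: act_def intro!: sum.cong)
    finally have "A *\<^sub>v vec n f = c \<cdot>\<^sub>v vec n f"
      using f by (auto simp: scl_def)
    moreover have "vec n f \<noteq> 0\<^sub>v n"
    proof
      assume "vec n f = 0\<^sub>v n"
      then have "vec n f $ i = 0" if "i < n" for i using that by simp
      then have "f i = 0" for i using f(1) by (cases "i < n") (auto simp: fvecs_def)
      with f(2) show False by (simp add: fun_eq_iff)
    qed
    ultimately show "c \<in> spectrum A"
      using A unfolding spectrum_def eigenvalue_def eigenvector_def
      by (auto intro!: exI[of _ "vec n f"])
  qed
qed

text \<open>Writing \<open>f\<close> as \<open>Z\<close> times \<open>g\<close> turns the form of
  the inverse at \<open>f\<close> into that of \<open>Z\<close> at \<open>g\<close>. Nonnegativity
  allows the term with the inverse to be dropped when positivity of the Lyapunov form is read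
  off.\<close>

lemma the_mat_inverse_pos_def:
  assumes Z: "Z \<in> sym_mats n" "pos_def Z"
  shows "the (mat_inverse Z) \<in> sym_mats n"
    and "f \<in> fvecs n \<Longrightarrow> 0 \<le> dot n f (act (the (mat_inverse Z)) f)"
proof -
  have c: "Z \<in> carrier_mat n n" using Z by (simp add: sym_mats_def)
  have pos: "dot n f (act Z f) > 0" if "f \<in> fvecs n" "f \<noteq> 0" for f
    using Z that by (simp add: pos_def_iff)
  obtain B where "B \<in> carrier_mat n n" "Z * B = 1\<^sub>m n" "B * Z = 1\<^sub>m n"
    by (rule act_inj_imp_inverse[OF c]) (use pos in force)
  then have "Z \<in> Units (ring_mat TYPE(real) n ())"
    using c by (auto simp: Units_def ring_mat_def)
  with mat_inverse(1)[OF c, where b = "()"] obtain Zi where Zi: "mat_inverse Z = Some Zi" by blast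
  from mat_inverse(2)[OF c this] have Zi': "Zi \<in> carrier_mat n n" "Z * Zi = 1\<^sub>m n" by auto
  have inv: "act Z (act Zi f) = f" if "f \<in> fvecs n" for f
    using act_mult_mat[of Z Zi f] c Zi' that by simp
  have "Zi \<in> sym_mats n"
  proof (rule sym_matsI[OF Zi'(1)])
    fix f g assume "f \<in> fvecs n" "g \<in> fvecs n"
    then have "dot n f (act Zi g) = dot n (act Z (act Zi f)) (act Zi g)"
      and "dot n (act Zi f) g = dot n (act Zi f) (act Z (act Zi g))" by (simp_all add: inv)
    then show "dot n f (act Zi g) = dot n (act Zi f) g" by (simp add: sym_matsD(5)[OF Z(1)])
  qed
  then show "the (mat_inverse Z) \<in> sym_mats n" by (simp add: Zi)
  assume f: "f \<in> fvecs n"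
  have "dot n f (act Zi f) = dot n (act Zi f) (act Z (act Zi f))"
    by (simp add: inv f dot_commute)
  also have "\<dots> \<ge> 0" using pos[of "act Zi f"] Zi' by (cases "act Zi f = 0") auto
  finally show "0 \<le> dot n f (act (the (mat_inverse Z)) f)" by (simp add: Zi)
qed


section \<open>Quadratic forms of the linear matrix inequalities\<close>

text \<open>The arguments are the dimensions of state, uncertainty channel, input and output. A
  controller maps measurements to control inputs and is therefore described by
  \<open>lfr_dims nc rc k m\<close>.\<close>

definition lfr_dims :: "nat \<Rightarrow> nat \<Rightarrow> nat \<Rightarrow> nat \<Rightarrow> lfr \<Rightarrow> bool" where
  "lfr_dims n r q p S \<longleftrightarrow>
     (\<forall>i\<in>{1,2}. \<forall>j\<in>{1,2}. lfr_A S i j \<in> carrier_mat (pair n r i) (pair n r j)) \<and>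
     (\<forall>i\<in>{1,2}. lfr_B S i \<in> carrier_mat (pair n r i) q) \<and>
     (\<forall>j\<in>{1,2}. lfr_C S j \<in> carrier_mat p (pair n r j)) \<and>
     lfr_D S \<in> carrier_mat p q"

lemma lfr_dimsD:
  assumes "lfr_dims n r q p S"
  shows "lfr_A S 1 1 \<in> carrier_mat n n" "lfr_A S 1 2 \<in> carrier_mat n r"
    "lfr_A S 2 1 \<in> carrier_mat r n" "lfr_A S 2 2 \<in> carrier_mat r r"
    "lfr_B S 1 \<in> carrier_mat n q" "lfr_B S 2 \<in> carrier_mat r q"
    "lfr_C S 1 \<in> carrier_mat p n" "lfr_C S 2 \<in> carrier_mat p r"
    "lfr_D S \<in> carrier_mat p q"
  using assms by (auto simp: lfr_dims_def)

lemma carrier_diag_block_mat2: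
  "A \<in> carrier_mat n n \<Longrightarrow> B \<in> carrier_mat m m \<Longrightarrow> diag_block_mat [A, B] \<in> carrier_mat (n + m) (n + m)"
  by (auto simp: Let_def)

lemma diag_block_mat_sym2:
  assumes "A \<in> sym_mats n" "B \<in> sym_mats m"
  shows "diag_block_mat [A, B] \<in> sym_mats (n + m)"
proof (rule sym_matsI)
  note [simp] = sym_matsD(1,2)[OF assms(1)] sym_matsD(1,2)[OF assms(2)]
  show "diag_block_mat [A, B] \<in> carrier_mat (n + m) (n + m)"
    using assms by (intro carrier_diag_block_mat2) (auto simp: sym_mats_def)
  fix f g assume "f \<in> fvecs (n + m)" "g \<in> fvecs (n + m)"
  then show "dot (n + m) f (act (diag_block_mat [A, B]) g) = dot (n + m) (act (diag_block_mat [A, B]) f) g"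
    by (elim cat_exhaust) (simp add: act_diag_block_mat2 dot_cat act_cat
      sym_matsD(5)[OF assms(1)] sym_matsD(5)[OF assms(2)] del: diag_block_mat.simps)
qed

lemma diag_block_mat_Cons2: "diag_block_mat [A, B, C] = diag_block_mat [A, diag_block_mat [B, C]]"
  by (simp only: diag_block_mat.simps(2)[of A] diag_block_mat_singleton)

lemma diag_block_mat_sym3:
  assumes "A \<in> sym_mats n" "B \<in> sym_mats m" "C \<in> sym_mats l"
  shows "diag_block_mat [A, B, C] \<in> sym_mats (n + (m + l))"
  unfolding diag_block_mat_Cons2 by (intro diag_block_mat_sym2 assms)

lemma act_offdiag:
  assumes "M \<in> carrier_mat n n"
  shows "act (offdiag M) (cat n f g) = cat n (act M g) (act M f)"
  using assms by (simp add: offdiag_def Let_def act_four_block_mat act_cat)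

lemma offdiag_sym:
  assumes "M \<in> sym_mats n"
  shows "offdiag M \<in> sym_mats (n + n)"
proof (rule sym_matsI)
  have M: "M \<in> carrier_mat n n" using assms by (simp add: sym_mats_def)
  then show "offdiag M \<in> carrier_mat (n + n) (n + n)" by (auto simp: offdiag_def Let_def)
  fix f g assume "f \<in> fvecs (n + n)" "g \<in> fvecs (n + n)"
  then show "dot (n + n) f (act (offdiag M) g) = dot (n + n) (act (offdiag M) f) g"
    by (elim cat_exhaust) (simp add: act_offdiag[OF M] dot_cat sym_matsD(5)[OF assms])
qed

lemma act_neg_corner:
  assumes "M \<in> carrier_mat n n"
  shows "act (neg_corner M) (cat n f g) = cat n (- act M f) 0"
  using assms by (simp add: neg_corner_def Let_def act_four_block_mat act_cat)

lemma neg_corner_sym: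
  assumes "M \<in> sym_mats n"
  shows "neg_corner M \<in> sym_mats (n + n)"
proof (rule sym_matsI)
  have M: "M \<in> carrier_mat n n" using assms by (simp add: sym_mats_def)
  then show "neg_corner M \<in> carrier_mat (n + n) (n + n)" by (auto simp: neg_corner_def Let_def)
  fix f g assume "f \<in> fvecs (n + n)" "g \<in> fvecs (n + n)"
  then show "dot (n + n) f (act (neg_corner M) g) = dot (n + n) (act (neg_corner M) f) g"
    by (elim cat_exhaust) (simp add: act_neg_corner[OF M] dot_cat sym_matsD(5)[OF assms])
qed

lemma zero_sym: "0\<^sub>m n n \<in> sym_mats n" by (simp add: sym_mats_def)

lemma congruence_form:
  assumes "F \<in> carrier_mat l n" "D \<in> sym_mats l"
  shows "dot n f (act (F\<^sup>T * D * F) g) = dot l (act F f) (act D (act F g))"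
    and "F\<^sup>T * D * F \<in> sym_mats n"
proof -
  note [simp] = sym_matsD(1,2)[OF assms(2)]
  show *: "dot n f (act (F\<^sup>T * D * F) g) = dot l (act F f) (act D (act F g))" for f g
    using assms dot_act_left[of F l f "act D (act F g)"] by (simp add: act_mult_mat)
  show "F\<^sup>T * D * F \<in> sym_mats n"
  proof (rule sym_matsI)
    show "F\<^sup>T * D * F \<in> carrier_mat n n" using assms by (auto simp: sym_mats_def)
    show "dot n f (act (F\<^sup>T * D * F) g) = dot n (act (F\<^sup>T * D * F) f) g" for f g
      using *[of f g] *[of g f] sym_matsD(5)[OF assms(2), of "act F f" "act F g"]
      by (simp add: dot_commute)
  qed
qed

lemma P_gamma_sym: "P_gamma q p \<gamma> \<in> sym_mats (q + p)"
  unfolding P_gamma_def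
  by (intro diag_block_mat_sym2 zero_sym) (auto simp: sym_mats_def intro!: eq_matI)

lemma P_Z_sym: "the (mat_inverse Z) \<in> sym_mats p \<Longrightarrow> P_Z q Z \<in> sym_mats (q + p)"
  unfolding P_Z_def by (intro diag_block_mat_sym2 zero_sym)

context
  fixes n r q p S
  assumes S: "lfr_dims n r q p S"
begin

lemmas dims = lfr_dimsD[OF S, THEN carrier_matD(1)] lfr_dimsD[OF S, THEN carrier_matD(2)]

lemma act_outer_factor:
  assumes "x \<in> fvecs n" "w \<in> fvecs r" "d \<in> fvecs q"
  shows "act (outer_factor S) (cat n x (cat r w d))
    = cat (n + n) (cat n x (act (lfr_A S 1 1) x + act (lfr_A S 1 2) w + act (lfr_B S 1) d))
     (cat (r + r) (cat r w (act (lfr_A S 2 1) x + act (lfr_A S 2 2) w + act (lfr_B S 2) d))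
      (cat q d (act (lfr_C S 1) x + act (lfr_C S 2) w + act (lfr_D S) d)))"
  using assms dims
  by (simp add: outer_factor_def Let_def act_append_rows act_append_cols act_cat)
    (simp only: cat_assoc[symmetric] add.assoc)

lemma carrier_outer_factor: "outer_factor S \<in> carrier_mat (n + n + (r + r + (q + p))) (n + (r + q))"
  by (rule carrier_matI) (simp_all add: outer_factor_def Let_def dims)

lemma act_outer_factor_sub:
  assumes "x \<in> fvecs n" "w \<in> fvecs r"
  shows "act (outer_factor_sub S) (cat n x w)
    = cat (n + n) (cat n x (act (lfr_A S 1 1) x + act (lfr_A S 1 2) w))
     (cat (r + r) (cat r w (act (lfr_A S 2 1) x + act (lfr_A S 2 2) w))
      (cat q 0 (act (lfr_C S 1) x + act (lfr_C S 2) w)))"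
  using assms dims
  by (simp add: outer_factor_sub_def Let_def act_append_rows act_append_cols act_cat)
    (simp only: cat_assoc[symmetric])

lemma carrier_outer_factor_sub:
  "outer_factor_sub S \<in> carrier_mat (n + n + (r + r + (q + p))) (n + r)"
  by (rule carrier_matI) (simp_all add: outer_factor_sub_def Let_def dims)

context
  fixes X R Z :: "real mat"
  assumes X: "X \<in> sym_mats n" and R: "R \<in> sym_mats r"
    and Z: "the (mat_inverse Z) \<in> sym_mats p"
begin

text \<open>Each off-diagonal outer matrix counts the pairing of a channel input with its output
  twice, and \<open>P_gamma\<close> sees only the performance input, so \<open>C\<close> and
  \<open>D\<close> of the loop leave the form.\<close>

lemma LL_form:
  assumes "x \<in> fvecs n" "w \<in> fvecs r" "d \<in> fvecs q"
  shows "dot (n + (r + q)) (cat n x (cat r w d))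
     (act (LL (offdiag X) (offdiag R) (P_gamma q p \<gamma>) S) (cat n x (cat r w d)))
    = 2 * dot n (act X x) (act (lfr_A S 1 1) x + act (lfr_A S 1 2) w + act (lfr_B S 1) d)
     + 2 * dot r (act R w) (act (lfr_A S 2 1) x + act (lfr_A S 2 2) w + act (lfr_B S 2) d)
     - \<gamma> * dot q d d"
proof -
  have c: "offdiag X \<in> carrier_mat (n + n) (n + n)" "offdiag R \<in> carrier_mat (r + r) (r + r)"
    using offdiag_sym[OF X] offdiag_sym[OF R] by (auto simp: sym_mats_def)
  define e1 where "e1 = act (lfr_A S 1 1) x + act (lfr_A S 1 2) w + act (lfr_B S 1) d"
  define e2 where "e2 = act (lfr_A S 2 1) x + act (lfr_A S 2 2) w + act (lfr_B S 2) d"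
  have sym: "dot n x (act X e1) = dot n (act X x) e1" "dot n e1 (act X x) = dot n (act X x) e1"
    "dot r w (act R e2) = dot r (act R w) e2" "dot r e2 (act R w) = dot r (act R w) e2"
    by (rule sym_matsD(5)[OF X] sym_matsD(5)[OF R] dot_commute)+
  show ?thesis
    unfolding LL_def
      congruence_form(1)[OF carrier_outer_factor diag_block_mat_sym3[OF offdiag_sym[OF X] offdiag_sym[OF R] P_gamma_sym]]
      act_outer_factor[OF assms]
    unfolding P_gamma_def e1_def[symmetric] e2_def[symmetric]
    using c assms(3)
    by (simp add: diag_block_mat_Cons2[of "offdiag X"] act_diag_block_mat2 act_offdiag[OF sym_matsD(3)[OF X]]
        act_offdiag[OF sym_matsD(3)[OF R]] act_cat dot_cat sym del: diag_block_mat.simps)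
qed

text \<open>\<open>neg_corner\<close> keeps only the state itself and \<open>P_Z\<close> only the
  performance output, so the state derivative disappears and \<open>C\<close> enters
  instead.\<close>

lemma LL_sub_form:
  assumes "x \<in> fvecs n" "w \<in> fvecs r"
  shows "dot (n + r) (cat n x w)
     (act (LL_sub (neg_corner X) (offdiag R) (P_Z q Z) S) (cat n x w))
    = - dot n x (act X x)
     + 2 * dot r (act R w) (act (lfr_A S 2 1) x + act (lfr_A S 2 2) w)
     + dot p (act (lfr_C S 1) x + act (lfr_C S 2) w)
         (act (the (mat_inverse Z)) (act (lfr_C S 1) x + act (lfr_C S 2) w))"
proof -
  have c: "neg_corner X \<in> carrier_mat (n + n) (n + n)" "offdiag R \<in> carrier_mat (r + r) (r + r)"
    using neg_corner_sym[OF X] offdiag_sym[OF R] by (auto simp: sym_mats_def)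
  define e2 where "e2 = act (lfr_A S 2 1) x + act (lfr_A S 2 2) w"
  define y where "y = act (lfr_C S 1) x + act (lfr_C S 2) w"
  have sym: "dot r w (act R e2) = dot r (act R w) e2" "dot r e2 (act R w) = dot r (act R w) e2"
    by (rule sym_matsD(5)[OF R] dot_commute)+
  show ?thesis
    unfolding LL_sub_def
      congruence_form(1)[OF carrier_outer_factor_sub diag_block_mat_sym3[OF neg_corner_sym[OF X] offdiag_sym[OF R] P_Z_sym[OF Z]]]
      act_outer_factor_sub[OF assms]
    unfolding P_Z_def e2_def[symmetric] y_def[symmetric]
    using c
    by (simp add: diag_block_mat_Cons2[of "neg_corner X"] act_diag_block_mat2 act_neg_corner[OF sym_matsD(3)[OF X]]
        act_offdiag[OF sym_matsD(3)[OF R]] act_cat dot_cat sym del: diag_block_mat.simps)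
qed

lemma neg_def_LL_iff:
  "neg_def (LL (offdiag X) (offdiag R) (P_gamma q p \<gamma>) S) \<longleftrightarrow>
    (\<forall>x\<in>fvecs n. \<forall>w\<in>fvecs r. \<forall>d\<in>fvecs q. x \<noteq> 0 \<or> w \<noteq> 0 \<or> d \<noteq> 0 \<longrightarrow>
      2 * dot n (act X x) (act (lfr_A S 1 1) x + act (lfr_A S 1 2) w + act (lfr_B S 1) d)
     + 2 * dot r (act R w) (act (lfr_A S 2 1) x + act (lfr_A S 2 2) w + act (lfr_B S 2) d)
     - \<gamma> * dot q d d < 0)"
proof -
  let ?M = "LL (offdiag X) (offdiag R) (P_gamma q p \<gamma>) S"
  have "?M \<in> sym_mats (n + (r + q))"
    unfolding LL_def
    by (rule congruence_form(2)[OF carrier_outer_factor diag_block_mat_sym3[OF offdiag_sym[OF X] offdiag_sym[OF R] P_gamma_sym]])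
  then have "neg_def ?M \<longleftrightarrow> (\<forall>f \<in> fvecs (n + (r + q)). f \<noteq> 0 \<longrightarrow> dot (n + (r + q)) f (act ?M f) < 0)"
    by (rule neg_def_iff)
  also have "\<dots> \<longleftrightarrow> (\<forall>x\<in>fvecs n. \<forall>w\<in>fvecs r. \<forall>d\<in>fvecs q. cat n x (cat r w d) \<noteq> 0 \<longrightarrow>
      dot (n + (r + q)) (cat n x (cat r w d)) (act ?M (cat n x (cat r w d))) < 0)"
    by (metis cat_exhaust fvecs_cat)
  finally show ?thesis by (simp add: cat_eq_0_iff LL_form del: dot_add_right dot_add_left)
qed

lemma neg_def_LL_sub_iff:
  "neg_def (LL_sub (neg_corner X) (offdiag R) (P_Z q Z) S) \<longleftrightarrow>
    (\<forall>x\<in>fvecs n. \<forall>w\<in>fvecs r. x \<noteq> 0 \<or> w \<noteq> 0 \<longrightarrow>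
     - dot n x (act X x)
     + 2 * dot r (act R w) (act (lfr_A S 2 1) x + act (lfr_A S 2 2) w)
     + dot p (act (lfr_C S 1) x + act (lfr_C S 2) w)
         (act (the (mat_inverse Z)) (act (lfr_C S 1) x + act (lfr_C S 2) w)) < 0)"
proof -
  let ?M = "LL_sub (neg_corner X) (offdiag R) (P_Z q Z) S"
  have "?M \<in> sym_mats (n + r)"
    unfolding LL_sub_def
    by (rule congruence_form(2)[OF carrier_outer_factor_sub diag_block_mat_sym3[OF neg_corner_sym[OF X] offdiag_sym[OF R] P_Z_sym[OF Z]]])
  then have "neg_def ?M \<longleftrightarrow> (\<forall>f \<in> fvecs (n + r). f \<noteq> 0 \<longrightarrow> dot (n + r) f (act ?M f) < 0)"
    by (rule neg_def_iff)
  also have "\<dots> \<longleftrightarrow> (\<forall>x\<in>fvecs n. \<forall>w\<in>fvecs r. cat n x w \<noteq> 0 \<longrightarrow>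
      dot (n + r) (cat n x w) (act ?M (cat n x w)) < 0)"
    by (metis cat_exhaust fvecs_cat)
  finally show ?thesis by (simp add: cat_eq_0_iff LL_sub_form del: dot_add_right dot_add_left act_add)
qed

end

end

section \<open>Closed loop and transformed loop\<close>

lemma initial_cat_cat:
  "g \<in> fvecs m \<Longrightarrow> initial (n + m) (cat n f (cat m g h)) = cat n f g"
  by (auto simp: fvecs_def initial_def cat_def fun_eq_iff)

lemma tail_cat_cat: "tail (n + m) (cat n f (cat m g h)) = h"
  by (simp add: cat_assoc)

text \<open>Blocks are recovered by padding the input with zeros and truncating the output, so later
  computations can stay with the whole matrices \<open>M i j\<close>.\<close>

lemma act_lfr_of:
  assumes "M i j \<in> carrier_mat (s i + p) (s j + q)"
  shows "act (lfr_A (lfr_of s M) i j) f = initial (s i) (act (M i j) (cat (s j) f 0))"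
  using assms
  by (auto simp: lfr_of_def split_block_def Let_def act_def initial_def cat_def sum_lessThan_add fun_eq_iff)

lemma act_lfr_of_B:
  assumes "M i 1 \<in> carrier_mat (s i + p) (s 1 + q)"
  shows "act (lfr_B (lfr_of s M) i) f = initial (s i) (act (M i 1) (cat (s 1) 0 f))"
  using assms
  by (auto simp: lfr_of_def split_block_def Let_def act_def initial_def cat_def sum_lessThan_add fun_eq_iff)

lemma act_lfr_of_C:
  assumes "M 1 j \<in> carrier_mat (s 1 + p) (s j + q)"
  shows "act (lfr_C (lfr_of s M) j) f = tail (s 1) (act (M 1 j) (cat (s j) f 0))"
  using assms
  by (auto simp: lfr_of_def split_block_def Let_def act_def tail_def cat_def sum_lessThan_add fun_eq_iff)

lemma lfr_dims_lfr_of: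
  assumes "\<And>i j. i \<in> {1,2} \<Longrightarrow> j \<in> {1,2} \<Longrightarrow> M i j \<in> carrier_mat (s i + p) (s j + q)"
    and "s 1 = n" "s 2 = r"
  shows "lfr_dims n r q p (lfr_of s M)"
  using assms(1)[of 1 1] assms(1)[of 1 2] assms(1)[of 2 1] assms(1)[of 2 2] assms(2,3)
  by (auto simp: lfr_dims_def lfr_of_def split_block_def Let_def)

section \<open>Dimensions of plants\<close>

definition plant_dims :: "nat \<Rightarrow> nat \<Rightarrow> nat \<Rightarrow> nat \<Rightarrow> nat \<Rightarrow> nat \<Rightarrow> plant \<Rightarrow> bool" where
  "plant_dims n r q p m k G \<longleftrightarrow>
     (\<forall>i\<in>{1,2}. \<forall>j\<in>{1,2}. pl_A G i j \<in> carrier_mat (pair n r i) (pair n r j)) \<and>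
     (\<forall>i\<in>{1,2}. pl_Bp G i \<in> carrier_mat (pair n r i) q \<and> pl_B G i \<in> carrier_mat (pair n r i) m) \<and>
     (\<forall>j\<in>{1,2}. pl_Cp G j \<in> carrier_mat p (pair n r j) \<and> pl_C G j \<in> carrier_mat k (pair n r j)) \<and>
     pl_Dp G \<in> carrier_mat p q \<and> pl_D1 G \<in> carrier_mat p m \<and> pl_D2 G \<in> carrier_mat k q"

lemma plant_dimsD:
  assumes "plant_dims n r q p m k G"
  shows "pl_A G 1 1 \<in> carrier_mat n n" "pl_A G 1 2 \<in> carrier_mat n r"
    "pl_A G 2 1 \<in> carrier_mat r n" "pl_A G 2 2 \<in> carrier_mat r r"
    "pl_Bp G 1 \<in> carrier_mat n q" "pl_Bp G 2 \<in> carrier_mat r q"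
    "pl_B G 1 \<in> carrier_mat n m" "pl_B G 2 \<in> carrier_mat r m"
    "pl_Cp G 1 \<in> carrier_mat p n" "pl_Cp G 2 \<in> carrier_mat p r"
    "pl_C G 1 \<in> carrier_mat k n" "pl_C G 2 \<in> carrier_mat k r"
    "pl_Dp G \<in> carrier_mat p q" "pl_D1 G \<in> carrier_mat p m" "pl_D2 G \<in> carrier_mat k q"
  using assms by (auto simp: plant_dims_def)

lemma plant_dims_lifted_plant:
  assumes "original_plant n a b q p m k G"
  shows "plant_dims n (a + a + (b + b)) q p m k (lifted_plant G)"
proof -
  from assms have c: "pl_A G 1 1 \<in> carrier_mat n n" "pl_A G 1 2 \<in> carrier_mat n (a + a)"
    "pl_A G 2 1 \<in> carrier_mat (b + b) n" "pl_A G 2 2 \<in> carrier_mat (b + b) (a + a)"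
    "pl_Bp G 1 \<in> carrier_mat n q" "pl_Bp G 2 \<in> carrier_mat (b + b) q"
    "pl_B G 1 \<in> carrier_mat n m" "pl_B G 2 \<in> carrier_mat (b + b) m"
    "pl_Cp G 1 \<in> carrier_mat p n" "pl_Cp G 2 \<in> carrier_mat p (a + a)"
    "pl_C G 1 \<in> carrier_mat k n" "pl_C G 2 \<in> carrier_mat k (a + a)"
    "pl_Dp G \<in> carrier_mat p q" "pl_D1 G \<in> carrier_mat p m" "pl_D2 G \<in> carrier_mat k q"
    unfolding original_plant_def by (elim conjE bexE, simp)+
  note [simp] = c[THEN carrier_matD(1)] c[THEN carrier_matD(2)]
  show ?thesis
    unfolding plant_dims_def lifted_plant_def Let_def plant.simps pair2_def carrier_mat_def
    by (simp only: ball_simps ball_empty, simp only: pair_simps pair_def if_True, simp)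
qed

locale lifted_loop =
  fixes n r q p m k :: nat and G :: plant
  assumes plant: "plant_dims n r q p m k G"
begin

lemmas plant_carrier = plant_dimsD[OF plant]
lemmas plant_dim = plant_carrier[THEN carrier_matD(1)] plant_carrier[THEN carrier_matD(2)]

context
  fixes nc rc K
  assumes K: "lfr_dims nc rc k m K"
begin

lemmas K_dim = lfr_dimsD[OF K, THEN carrier_matD(1)] lfr_dimsD[OF K, THEN carrier_matD(2)]

section \<open>The closed loop as signal equations\<close>

lemma carrier_closed_loop_mat:
  assumes "i \<in> {1,2}" "j \<in> {1,2}"
  shows "closed_loop_mat G K i j
    \<in> carrier_mat (pair n r i + pair nc rc i + p) (pair n r j + pair nc rc j + q)"
  using assms
  by (auto simp: closed_loop_mat_def input_factor_def lfr_mat_def Let_def plant_dim K_dim intro!: carrier_matI)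

text \<open>Since \<open>lfr_D K\<close> is zero, the control input is determined by the controller
  signals, and the measurement enters the controller rows only.\<close>

lemma act_closed_loop_mat:
  assumes "i \<in> {1,2}" "j \<in> {1,2}" "xc \<in> fvecs (pair nc rc j)" "lfr_D K = 0\<^sub>m m k"
  shows "act (closed_loop_mat G K i j) (cat (pair n r j) x (cat (pair nc rc j) xc d))
    = cat (pair n r i) (act (pl_A G i j) x + act (pl_Bp G i) d + act (pl_B G i) (act (lfr_C K j) xc))
      (cat (pair nc rc i) (act (lfr_A K i j) xc + act (lfr_B K i) (act (pl_C G j) x + act (pl_D2 G) d))
       (act (pl_Cp G j) x + act (pl_Dp G) d + act (pl_D1 G) (act (lfr_C K j) xc)))"
  using assms
  by (auto simp: closed_loop_mat_def input_factor_def lfr_mat_def Let_def plant_dim K_dim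
      act_plus_mat act_mult_mat act_append_rows act_append_cols act_four_block_mat act_cat cat_add
      fvecs_add add_ac simp del: act_add; simp add: cat_add add_ac fvecs_add)

lemma channel_dim:
  "i \<in> {1,2} \<Longrightarrow> dim_row (pl_A G i i) + dim_row (lfr_A K i i) = pair n r i + pair nc rc i"
  by (auto simp: plant_dim K_dim)

lemma lfr_dims_closed_loop: "lfr_dims (n + nc) (r + rc) q p (closed_loop G K)"
  unfolding closed_loop_def
  by (rule lfr_dims_lfr_of)
    (use carrier_closed_loop_mat channel_dim[of 1] channel_dim[of 2] in \<open>auto simp: channel_dim\<close>)

lemma act_closed_loop_A:
  assumes "i \<in> {1,2}" "j \<in> {1,2}" "xc \<in> fvecs (pair nc rc j)" "lfr_D K = 0\<^sub>m m k"
  shows "act (lfr_A (closed_loop G K) i j) (cat (pair n r j) x xc)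
    = cat (pair n r i) (act (pl_A G i j) x + act (pl_B G i) (act (lfr_C K j) xc))
        (act (lfr_A K i j) xc + act (lfr_B K i) (act (pl_C G j) x))"
  unfolding closed_loop_def
  apply (subst act_lfr_of[where p = p and q = q])
  using carrier_closed_loop_mat[OF assms(1,2)] assms(1,2) apply (simp add: channel_dim)
  apply (simp only: channel_dim[OF assms(1)] channel_dim[OF assms(2)] cat_assoc[symmetric] act_closed_loop_mat[OF assms])
  apply (subst initial_cat_cat)
  using assms(1,2) by (auto intro!: fvecs_add simp: K_dim)

lemma act_closed_loop_B:
  assumes "i \<in> {1,2}" "lfr_D K = 0\<^sub>m m k"
  shows "act (lfr_B (closed_loop G K) i) d
    = cat (pair n r i) (act (pl_Bp G i) d) (act (lfr_B K i) (act (pl_D2 G) d))"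
proof -
  \<comment> \<open>\<open>lfr_of\<close> reads \<open>B\<close> from the matrices with column index
    1, so the performance input is applied together with a zero state.\<close>
  have 0: "cat (pair n r 1 + pair nc rc 1) 0 d = cat (pair n r 1) 0 (cat (pair nc rc 1) 0 d)"
    using cat_assoc[of "pair n r 1" 0 "pair nc rc 1" 0 d] by simp
  show ?thesis
    unfolding closed_loop_def
    apply (subst act_lfr_of_B[where p = p and q = q])
    using carrier_closed_loop_mat[OF assms(1), of 1] channel_dim[of 1] assms(1) apply (simp add: channel_dim)
    apply (simp only: channel_dim[OF assms(1)] channel_dim[OF insertI1] 0)
    apply (subst act_closed_loop_mat)
    using assms apply simp_all[4]
    apply (subst initial_cat_cat)
    using assms(1) by (auto intro!: fvecs_add simp: K_dim)
qed

lemma act_closed_loop_C: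
  assumes "j \<in> {1,2}" "xc \<in> fvecs (pair nc rc j)" "lfr_D K = 0\<^sub>m m k"
  shows "act (lfr_C (closed_loop G K) j) (cat (pair n r j) x xc)
    = act (pl_Cp G j) x + act (pl_D1 G) (act (lfr_C K j) xc)"
  unfolding closed_loop_def
  apply (subst act_lfr_of_C[where p = p and q = q])
  using carrier_closed_loop_mat[of 1, OF _ assms(1)] channel_dim[of 1] assms(1) apply (simp add: channel_dim)
  apply (simp only: channel_dim[OF assms(1)] channel_dim[OF insertI1] cat_assoc[symmetric])
  apply (subst act_closed_loop_mat)
  using assms apply simp_all[4]
  by (simp only: tail_cat_cat) simp

end

section \<open>The transformed loop as signal equations\<close>

context
  fixes nc rc :: nat and K :: lfr and X Y :: "nat \<Rightarrow> real mat"
  assumes K: "lfr_dims nc rc k m K"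
    and X: "\<And>i. i \<in> {1,2} \<Longrightarrow> X i \<in> carrier_mat (pair n r i) (pair nc rc i)"
    and Y: "\<And>i. i \<in> {1,2} \<Longrightarrow> Y i \<in> carrier_mat (pair n r i) (pair nc rc i)"
    and D: "lfr_D K = 0\<^sub>m m k"
begin

lemmas XY_dim = X[THEN carrier_matD(1)] X[THEN carrier_matD(2)] Y[THEN carrier_matD(1)] Y[THEN carrier_matD(2)]

lemma carrier_transformed_loop_mat:
  assumes "i \<in> {1,2}" "j \<in> {1,2}"
  shows "transformed_loop_mat G X Y K i j
    \<in> carrier_mat (pair n r i + pair nc rc i + p) (pair n r j + pair nc rc j + q)"
  using assms XY_dim
  by (auto simp: transformed_loop_mat_def input_factor_def lfr_mat_def Let_def plant_dim K_dim[OF K] intro!: carrier_matI)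

text \<open>The plant rows see only the combination \<open>act (Y j) s + x\<close>, the future
  closed-loop signal, whereas the rows below apply \<open>X i\<close> to the plant terms in
  \<open>x\<close> and \<open>d\<close> alone; the missing part is what the transformed controller
  has to supply.\<close>

lemma act_transformed_loop_mat:
  assumes "i \<in> {1,2}" "j \<in> {1,2}" "s \<in> fvecs (pair nc rc j)" "x \<in> fvecs (pair n r j)"
  shows "act (transformed_loop_mat G X Y K i j) (cat (pair nc rc j) s (cat (pair n r j) x d))
    = cat (pair n r i) (act (pl_A G i j) (act (Y j) s + x) + act (pl_Bp G i) d + act (pl_B G i) (act (lfr_C K j) s))
      (cat (pair nc rc i) (act (X i)\<^sup>T (act (pl_A G i j) x + act (pl_Bp G i) d)
           + act (lfr_A K i j) s + act (lfr_B K i) (act (pl_C G j) x + act (pl_D2 G) d))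
       (act (pl_Cp G j) (act (Y j) s + x) + act (pl_Dp G) d + act (pl_D1 G) (act (lfr_C K j) s)))"
  using assms XY_dim[OF assms(1)] XY_dim[OF assms(2)] D
  by (auto simp: transformed_loop_mat_def input_factor_def lfr_mat_def Let_def plant_dim K_dim[OF K]
      act_plus_mat act_mult_mat act_append_rows act_append_cols act_four_block_mat act_cat cat_add
      fvecs_add add_ac; simp add: cat_add add_ac fvecs_add)

lemma lfr_dims_transformed_loop: "lfr_dims (n + nc) (r + rc) q p (transformed_loop G X Y K)"
  unfolding transformed_loop_def
  by (rule lfr_dims_lfr_of)
    (use carrier_transformed_loop_mat channel_dim[OF K, of 1] channel_dim[OF K, of 2]
      in \<open>auto simp: channel_dim[OF K]\<close>)

lemma act_transformed_loop_A:
  assumes "i \<in> {1,2}" "j \<in> {1,2}" "s \<in> fvecs (pair nc rc j)" "x \<in> fvecs (pair n r j)"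
  shows "act (lfr_A (transformed_loop G X Y K) i j) (cat (pair nc rc j) s x)
    = cat (pair n r i) (act (pl_A G i j) (act (Y j) s + x) + act (pl_B G i) (act (lfr_C K j) s))
      (act (X i)\<^sup>T (act (pl_A G i j) x) + act (lfr_A K i j) s + act (lfr_B K i) (act (pl_C G j) x))"
proof -
  \<comment> \<open>Inputs are stacked with the controller part first, outputs with the plant part
    first. \<open>lfr_of\<close> splits at the sum of both dimensions, which is the same for either
    order.\<close>
  have 0: "cat (pair n r j + pair nc rc j) (cat (pair nc rc j) s x) 0
    = cat (pair nc rc j) s (cat (pair n r j) x 0)"
    by (simp only: cat_assoc add.commute)
  show ?thesis
    unfolding transformed_loop_def
    apply (subst act_lfr_of[where p = p and q = q])
    using carrier_transformed_loop_mat[OF assms(1,2)] assms(1,2) apply (simp add: channel_dim[OF K])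
    apply (simp only: channel_dim[OF K assms(1)] channel_dim[OF K assms(2)] 0 act_transformed_loop_mat[OF assms])
    apply (subst initial_cat_cat)
    using assms(1,2) XY_dim[OF assms(1)] by (auto intro!: fvecs_add simp: K_dim[OF K])
qed

lemma act_transformed_loop_B:
  assumes "i \<in> {1,2}"
  shows "act (lfr_B (transformed_loop G X Y K) i) d
    = cat (pair n r i) (act (pl_Bp G i) d)
        (act (X i)\<^sup>T (act (pl_Bp G i) d) + act (lfr_B K i) (act (pl_D2 G) d))"
proof -
  have 0: "cat (pair n r 1 + pair nc rc 1) 0 d = cat (pair nc rc 1) 0 (cat (pair n r 1) 0 d)"
    using cat_assoc[of "pair nc rc 1" 0 "pair n r 1" 0 d] by (simp add: add.commute)
  show ?thesis
    unfolding transformed_loop_def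
    apply (subst act_lfr_of_B[where p = p and q = q])
    using carrier_transformed_loop_mat[OF assms(1), of 1] channel_dim[OF K, of 1] assms(1)
    apply (simp add: channel_dim[OF K])
    apply (simp only: channel_dim[OF K assms(1)] channel_dim[OF K insertI1] 0)
    apply (subst act_transformed_loop_mat)
    using assms apply simp_all[4]
    apply (subst initial_cat_cat)
    using assms(1) XY_dim[OF assms(1)] by (auto intro!: fvecs_add simp: K_dim[OF K])
qed

lemma act_transformed_loop_C:
  assumes "j \<in> {1,2}" "s \<in> fvecs (pair nc rc j)" "x \<in> fvecs (pair n r j)"
  shows "act (lfr_C (transformed_loop G X Y K) j) (cat (pair nc rc j) s x)
    = act (pl_Cp G j) (act (Y j) s + x) + act (pl_D1 G) (act (lfr_C K j) s)"
proof -
  have 0: "cat (pair n r j + pair nc rc j) (cat (pair nc rc j) s x) 0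
    = cat (pair nc rc j) s (cat (pair n r j) x 0)"
    by (simp only: cat_assoc add.commute)
  show ?thesis
    unfolding transformed_loop_def
    apply (subst act_lfr_of_C[where p = p and q = q])
    using carrier_transformed_loop_mat[of 1, OF _ assms(1)] channel_dim[OF K, of 1] assms(1)
    apply (simp add: channel_dim[OF K])
    apply (simp only: channel_dim[OF K assms(1)] channel_dim[OF K insertI1] 0)
    apply (subst act_transformed_loop_mat)
    using assms apply simp_all[4]
    by (simp only: tail_cat_cat) simp
qed

end

end

text \<open>By symmetry of \<open>P\<close> the form of \<open>He (P * D)\<close> is twice the
  pairing of \<open>act P f\<close> with \<open>act D f\<close>. This shape needs only the image of
  \<open>f\<close> under \<open>P\<close>, which is explicit for substituted vectors.\<close>

lemma pos_def_He_iff: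
  assumes P: "P \<in> sym_mats n" and D: "D \<in> carrier_mat n n"
  shows "pos_def (He (P * D)) \<longleftrightarrow> (\<forall>f \<in> fvecs n. f \<noteq> 0 \<longrightarrow> 0 < dot n (act P f) (act D f))"
proof -
  note [simp] = sym_matsD(1,2)[OF P] carrier_matD[OF D]
  have form: "dot n f (act (He (P * D)) g) = dot n (act P f) (act D g) + dot n (act D f) (act P g)" for f g
    using dot_act_left[of "P * D" n f g]
    by (simp add: He_def act_plus_mat act_mult_mat sym_matsD(5)[OF P])
  have "He (P * D) \<in> sym_mats n"
  proof (rule sym_matsI)
    show "He (P * D) \<in> carrier_mat n n" by (rule carrier_matI) (simp_all add: He_def)
    show "dot n f (act (He (P * D)) g) = dot n (act (He (P * D)) f) g" for f g
      using form[of f g] form[of g f] by (simp add: dot_commute)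
  qed
  then show ?thesis
    by (simp add: pos_def_iff form dot_commute[of n "act D _"])
qed

section \<open>The inequalities in terms of block vectors\<close>

text \<open>
  The nonzero blocks of a structured controller: \<open>F\<close>, \<open>H\<close>, \<open>J\<close> are the blocks of \<open>A\<^sup>c\<close>, \<open>B\<^sup>c\<close>, \<open>C\<^sup>c\<close>, where
  \<open>1\<close> is the state and \<open>2, 3\<close> are the two parts of the scheduling channel (\<open>J\<close> has no part \<open>3\<close>).
\<close>

record ctrl =
  F11 :: "real mat"
  F12 :: "real mat"
  F13 :: "real mat"
  F21 :: "real mat"
  F22 :: "real mat"
  F31 :: "real mat"
  F32 :: "real mat"
  F33 :: "real mat"
  H1 :: "real mat"
  H3 :: "real mat"
  J1 :: "real mat"
  J2 :: "real mat"

definition ctrl_dims :: "nat \<Rightarrow> nat \<Rightarrow> nat \<Rightarrow> nat \<Rightarrow> nat \<Rightarrow> ctrl \<Rightarrow> bool" where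
  "ctrl_dims nc r1 r2 m k C \<longleftrightarrow>
     F11 C \<in> carrier_mat nc nc \<and> F12 C \<in> carrier_mat nc r1 \<and> F13 C \<in> carrier_mat nc r2 \<and>
     F21 C \<in> carrier_mat r1 nc \<and> F22 C \<in> carrier_mat r1 r1 \<and>
     F31 C \<in> carrier_mat r2 nc \<and> F32 C \<in> carrier_mat r2 r1 \<and> F33 C \<in> carrier_mat r2 r2 \<and>
     H1 C \<in> carrier_mat nc k \<and> H3 C \<in> carrier_mat r2 k \<and>
     J1 C \<in> carrier_mat m nc \<and> J2 C \<in> carrier_mat m r1"

definition ctrl_lfr :: "nat \<Rightarrow> nat \<Rightarrow> nat \<Rightarrow> nat \<Rightarrow> ctrl \<Rightarrow> lfr" where
  "ctrl_lfr r1 r2 m k C = \<lparr>lfr_A = pair2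
       (F11 C) (F12 C @\<^sub>c F13 C)
       (F21 C @\<^sub>r F31 C) (four_block_mat (F22 C) (0\<^sub>m r1 r2) (F32 C) (F33 C)),
     lfr_B = pair (H1 C) (0\<^sub>m r1 k @\<^sub>r H3 C),
     lfr_C = pair (J1 C) (J2 C @\<^sub>c 0\<^sub>m m r2),
     lfr_D = 0\<^sub>m m k\<rparr>"

text \<open>Families are compared at the indices 1 and 2 only, since a given controller may differ
  from \<open>ctrl_lfr\<close> elsewhere.\<close>

definition lfr_eq :: "lfr \<Rightarrow> lfr \<Rightarrow> bool" where
  "lfr_eq K K' \<longleftrightarrow> (\<forall>i\<in>{1,2}. \<forall>j\<in>{1,2}. lfr_A K i j = lfr_A K' i j) \<and>
     (\<forall>i\<in>{1,2}. lfr_B K i = lfr_B K' i) \<and> (\<forall>i\<in>{1,2}. lfr_C K i = lfr_C K' i) \<and> lfr_D K = lfr_D K'"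

text \<open>These are the free data of (b). The block
  \<open>Q\<^sub>2\<^sup>T A\<^sub>2\<^sub>2\<close> and the zero blocks are supplied by
  \<open>vars_lfr\<close>, so every modification of the fields keeps the prescribed shape.\<close>

record vars =
  vX :: "real mat"
  vY :: "real mat"
  vQ2 :: "real mat"
  vQ3 :: "real mat"
  vQt :: "real mat"
  K11 :: "real mat"
  K12 :: "real mat"
  K13 :: "real mat"
  K21 :: "real mat"
  K22 :: "real mat"
  K31 :: "real mat"
  K32 :: "real mat"
  K33 :: "real mat"
  L1 :: "real mat"
  L3 :: "real mat"
  M1 :: "real mat"
  M2 :: "real mat"

definition vars_dims :: "nat \<Rightarrow> nat \<Rightarrow> nat \<Rightarrow> nat \<Rightarrow> vars \<Rightarrow> bool" where
  "vars_dims n r m k V \<longleftrightarrow>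
     vX V \<in> sym_mats n \<and> vY V \<in> sym_mats n \<and>
     vQ2 V \<in> sym_mats r \<and> vQ3 V \<in> sym_mats r \<and> vQt V \<in> sym_mats r \<and>
     K11 V \<in> carrier_mat n n \<and> K12 V \<in> carrier_mat n r \<and> K13 V \<in> carrier_mat n r \<and>
     K21 V \<in> carrier_mat r n \<and> K22 V \<in> carrier_mat r r \<and>
     K31 V \<in> carrier_mat r n \<and> K32 V \<in> carrier_mat r r \<and> K33 V \<in> carrier_mat r r \<and>
     L1 V \<in> carrier_mat n k \<and> L3 V \<in> carrier_mat r k \<and>
     M1 V \<in> carrier_mat m n \<and> M2 V \<in> carrier_mat m r"

definition vars_lfr :: "nat \<Rightarrow> nat \<Rightarrow> nat \<Rightarrow> real mat \<Rightarrow> vars \<Rightarrow> lfr" where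
  "vars_lfr r m k A22 V = \<lparr>lfr_A = pair2
       (K11 V) (K12 V @\<^sub>c K13 V)
       (K21 V @\<^sub>r K31 V) (four_block_mat (K22 V) ((vQ2 V)\<^sup>T * A22) (K32 V) (K33 V)),
     lfr_B = pair (L1 V) (0\<^sub>m r k @\<^sub>r L3 V),
     lfr_C = pair (M1 V) (M2 V @\<^sub>c 0\<^sub>m m r),
     lfr_D = 0\<^sub>m m k\<rparr>"

lemma pair2_simps [simp]:
  "pair2 x11 x12 x21 x22 1 1 = x11" "pair2 x11 x12 x21 x22 1 2 = x12"
  "pair2 x11 x12 x21 x22 2 1 = x21" "pair2 x11 x12 x21 x22 2 2 = x22"
  by (simp_all add: pair2_def)

lemma lfr_dims_cong: "lfr_eq K K' \<Longrightarrow> lfr_dims n r q p K' \<Longrightarrow> lfr_dims n r q p K"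
  by (simp add: lfr_eq_def lfr_dims_def)

lemma lfr_dimsI:
  assumes "lfr_A S 1 1 \<in> carrier_mat n n" "lfr_A S 1 2 \<in> carrier_mat n r"
    "lfr_A S 2 1 \<in> carrier_mat r n" "lfr_A S 2 2 \<in> carrier_mat r r"
    "lfr_B S 1 \<in> carrier_mat n q" "lfr_B S 2 \<in> carrier_mat r q"
    "lfr_C S 1 \<in> carrier_mat p n" "lfr_C S 2 \<in> carrier_mat p r"
    "lfr_D S \<in> carrier_mat p q"
  shows "lfr_dims n r q p S"
  using assms unfolding lfr_dims_def by (simp only: ball_simps ball_empty pair_simps simp_thms)

lemma lfr_dims_ctrl_lfr:
  assumes "ctrl_dims nc r1 r2 m k C"
  shows "lfr_dims nc (r1 + r2) k m (ctrl_lfr r1 r2 m k C)"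
  using assms unfolding ctrl_dims_def
  by (intro lfr_dimsI; elim conjE; simp only: ctrl_lfr_def lfr.simps pair_simps pair2_simps; auto)

lemma lfr_dims_vars_lfr:
  assumes "vars_dims n r m k V" "A22 \<in> carrier_mat r r"
  shows "lfr_dims n (r + r) k m (vars_lfr r m k A22 V)"
proof -
  have "(vQ2 V)\<^sup>T * A22 \<in> carrier_mat r r" using assms by (auto simp: vars_dims_def sym_mats_def)
  then show ?thesis
    using assms(1) unfolding vars_dims_def
    by (intro lfr_dimsI; elim conjE; simp only: vars_lfr_def lfr.simps pair_simps pair2_simps; auto)
qed

context lifted_loop
begin

section \<open>Signals of plant and controller\<close>

definition sig_x where
  "sig_x x w d u = act (pl_A G 1 1) x + act (pl_A G 1 2) w + act (pl_Bp G 1) d + act (pl_B G 1) u"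

definition sig_z where
  "sig_z x w d u = act (pl_A G 2 1) x + act (pl_A G 2 2) w + act (pl_Bp G 2) d + act (pl_B G 2) u"

definition sig_y where
  "sig_y x w d = act (pl_C G 1) x + act (pl_C G 2) w + act (pl_D2 G) d"

text \<open>No performance input occurs, since this output enters the inequality for
  \<open>LL_sub\<close>, whose factor has no column for that input.\<close>

definition sig_p where
  "sig_p x w u = act (pl_Cp G 1) x + act (pl_Cp G 2) w + act (pl_D1 G) u"

definition ctl_x where
  "ctl_x C x xc w wa wb d = act (F11 C) xc + act (F12 C) wa + act (F13 C) wb + act (H1 C) (sig_y x w d)"

text \<open>The controller structure shows as missing arguments: neither \<open>wb\<close> nor the
  measurement reaches this signal, and \<open>ctl_u\<close> is likewise free of
  \<open>wb\<close>.\<close>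

definition ctl_a where
  "ctl_a C xc wa = act (F21 C) xc + act (F22 C) wa"

definition ctl_b where
  "ctl_b C x xc w wa wb d = act (F31 C) xc + act (F32 C) wa + act (F33 C) wb + act (H3 C) (sig_y x w d)"

definition ctl_u where
  "ctl_u C xc wa = act (J1 C) xc + act (J2 C) wa"

context
  fixes nc r1 r2 :: nat and C :: ctrl and K :: lfr and \<X> \<P> Z :: "real mat" and \<gamma> :: real
  assumes C: "ctrl_dims nc r1 r2 m k C" and K: "lfr_eq K (ctrl_lfr r1 r2 m k C)"
    and X: "\<X> \<in> sym_mats (n + nc)" and P: "\<P> \<in> sym_mats (r + (r1 + r2))"
    and Z: "the (mat_inverse Z) \<in> sym_mats p"
begin

lemma K_dims: "lfr_dims nc (r1 + r2) k m K"
  by (rule lfr_dims_cong[OF K lfr_dims_ctrl_lfr[OF C]])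

lemma C_dim:
  "F11 C \<in> carrier_mat nc nc" "F12 C \<in> carrier_mat nc r1" "F13 C \<in> carrier_mat nc r2"
  "F21 C \<in> carrier_mat r1 nc" "F22 C \<in> carrier_mat r1 r1"
  "F31 C \<in> carrier_mat r2 nc" "F32 C \<in> carrier_mat r2 r1" "F33 C \<in> carrier_mat r2 r2"
  "H1 C \<in> carrier_mat nc k" "H3 C \<in> carrier_mat r2 k"
  "J1 C \<in> carrier_mat m nc" "J2 C \<in> carrier_mat m r1"
  using C by (auto simp: ctrl_dims_def)

lemmas C_dims = C_dim[THEN carrier_matD(1)] C_dim[THEN carrier_matD(2)]

lemma K_blocks:
  "lfr_A K 1 1 = F11 C" "lfr_A K 1 2 = F12 C @\<^sub>c F13 C"
  "lfr_A K 2 1 = F21 C @\<^sub>r F31 C" "lfr_A K 2 2 = four_block_mat (F22 C) (0\<^sub>m r1 r2) (F32 C) (F33 C)"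
  "lfr_B K 1 = H1 C" "lfr_B K 2 = 0\<^sub>m r1 k @\<^sub>r H3 C"
  "lfr_C K 1 = J1 C" "lfr_C K 2 = J2 C @\<^sub>c 0\<^sub>m m r2" "lfr_D K = 0\<^sub>m m k"
  using K by (auto simp: lfr_eq_def ctrl_lfr_def)

lemma closed_loop_signals:
  assumes "xc \<in> fvecs nc" "wa \<in> fvecs r1" "wb \<in> fvecs r2"
  shows "act (lfr_A (closed_loop G K) 1 1) (cat n x xc)
      + act (lfr_A (closed_loop G K) 1 2) (cat r w (cat r1 wa wb)) + act (lfr_B (closed_loop G K) 1) d
    = cat n (sig_x x w d (ctl_u C xc wa)) (ctl_x C x xc w wa wb d)"
    and "act (lfr_A (closed_loop G K) 2 1) (cat n x xc)
      + act (lfr_A (closed_loop G K) 2 2) (cat r w (cat r1 wa wb)) + act (lfr_B (closed_loop G K) 2) d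
    = cat r (sig_z x w d (ctl_u C xc wa)) (cat r1 (ctl_a C xc wa) (ctl_b C x xc w wa wb d))"
    and "act (lfr_C (closed_loop G K) 1) (cat n x xc)
      + act (lfr_C (closed_loop G K) 2) (cat r w (cat r1 wa wb))
    = sig_p x w (ctl_u C xc wa)"
  using assms act_closed_loop_A[OF K_dims, of 1 1 xc x] act_closed_loop_A[OF K_dims, of 1 2 "cat r1 wa wb" w]
    act_closed_loop_A[OF K_dims, of 2 1 xc x] act_closed_loop_A[OF K_dims, of 2 2 "cat r1 wa wb" w]
    act_closed_loop_B[OF K_dims, of 1 d] act_closed_loop_B[OF K_dims, of 2 d]
    act_closed_loop_C[OF K_dims, of 1 xc x] act_closed_loop_C[OF K_dims, of 2 "cat r1 wa wb" w]
  by (simp_all add: K_blocks C_dims fvecs_cat act_append_cols act_append_rows act_four_block_mat act_cat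
      sig_x_def sig_y_def sig_z_def sig_p_def ctl_x_def ctl_a_def ctl_b_def ctl_u_def cat_add add_ac)

text \<open>The images under \<open>\<X>\<close> and \<open>\<P>\<close> are kept unexpanded, to be
  replaced later by the columns that the substitution makes explicit.\<close>

lemma neg_def_closed_loop_iff:
  "neg_def (LL (offdiag \<X>) (offdiag \<P>) (P_gamma q p \<gamma>) (closed_loop G K)) \<longleftrightarrow>
   (\<forall>x\<in>fvecs n. \<forall>xc\<in>fvecs nc. \<forall>w\<in>fvecs r. \<forall>wa\<in>fvecs r1. \<forall>wb\<in>fvecs r2. \<forall>d\<in>fvecs q.
      x \<noteq> 0 \<or> xc \<noteq> 0 \<or> w \<noteq> 0 \<or> wa \<noteq> 0 \<or> wb \<noteq> 0 \<or> d \<noteq> 0 \<longrightarrow>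
      2 * dot (n + nc) (act \<X> (cat n x xc)) (cat n (sig_x x w d (ctl_u C xc wa)) (ctl_x C x xc w wa wb d))
      + 2 * dot (r + (r1 + r2)) (act \<P> (cat r w (cat r1 wa wb)))
          (cat r (sig_z x w d (ctl_u C xc wa)) (cat r1 (ctl_a C xc wa) (ctl_b C x xc w wa wb d)))
      - \<gamma> * dot q d d < 0)" (is "_ \<longleftrightarrow> (\<forall>x\<in>_. \<forall>xc\<in>_. \<forall>w\<in>_. \<forall>wa\<in>_. \<forall>wb\<in>_. \<forall>d\<in>_. ?nz x xc w wa wb d \<longrightarrow> ?F x xc w wa wb d < 0)")
proof -
  let ?S = "closed_loop G K"
  let ?f = "\<lambda>x w d. 2 * dot (n + nc) (act \<X> x) (act (lfr_A ?S 1 1) x + act (lfr_A ?S 1 2) w + act (lfr_B ?S 1) d)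
     + 2 * dot (r + (r1 + r2)) (act \<P> w) (act (lfr_A ?S 2 1) x + act (lfr_A ?S 2 2) w + act (lfr_B ?S 2) d)
     - \<gamma> * dot q d d"
  have "neg_def (LL (offdiag \<X>) (offdiag \<P>) (P_gamma q p \<gamma>) ?S) \<longleftrightarrow>
    (\<forall>x\<in>fvecs (n + nc). \<forall>w\<in>fvecs (r + (r1 + r2)). \<forall>d\<in>fvecs q. x \<noteq> 0 \<or> w \<noteq> 0 \<or> d \<noteq> 0 \<longrightarrow> ?f x w d < 0)"
    by (rule neg_def_LL_iff[OF lfr_dims_closed_loop[OF K_dims] X P Z])
  also have "\<dots> \<longleftrightarrow> (\<forall>x\<in>fvecs n. \<forall>xc\<in>fvecs nc. \<forall>w\<in>fvecs r. \<forall>wa\<in>fvecs r1. \<forall>wb\<in>fvecs r2. \<forall>d\<in>fvecs q.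
      cat n x xc \<noteq> 0 \<or> cat r w (cat r1 wa wb) \<noteq> 0 \<or> d \<noteq> 0 \<longrightarrow> ?f (cat n x xc) (cat r w (cat r1 wa wb)) d < 0)"
    by (intro iffI ballI impI; (elim cat_exhaust)?) (blast intro: fvecs_cat, auto)
  also have "\<dots> \<longleftrightarrow> (\<forall>x\<in>fvecs n. \<forall>xc\<in>fvecs nc. \<forall>w\<in>fvecs r. \<forall>wa\<in>fvecs r1. \<forall>wb\<in>fvecs r2. \<forall>d\<in>fvecs q.
      ?nz x xc w wa wb d \<longrightarrow> ?F x xc w wa wb d < 0)"
    by (intro ball_cong refl) (simp add: closed_loop_signals cat_eq_0_iff del: dot_add_left dot_add_right, blast)
  finally show ?thesis .
qed

lemma neg_def_closed_loop_sub_iff: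
  "neg_def (LL_sub (neg_corner \<X>) (offdiag \<P>) (P_Z q Z) (closed_loop G K)) \<longleftrightarrow>
   (\<forall>x\<in>fvecs n. \<forall>xc\<in>fvecs nc. \<forall>w\<in>fvecs r. \<forall>wa\<in>fvecs r1. \<forall>wb\<in>fvecs r2.
      x \<noteq> 0 \<or> xc \<noteq> 0 \<or> w \<noteq> 0 \<or> wa \<noteq> 0 \<or> wb \<noteq> 0 \<longrightarrow>
      - dot (n + nc) (cat n x xc) (act \<X> (cat n x xc))
      + 2 * dot (r + (r1 + r2)) (act \<P> (cat r w (cat r1 wa wb)))
          (cat r (sig_z x w 0 (ctl_u C xc wa)) (cat r1 (ctl_a C xc wa) (ctl_b C x xc w wa wb 0)))
      + dot p (sig_p x w (ctl_u C xc wa)) (act (the (mat_inverse Z)) (sig_p x w (ctl_u C xc wa))) < 0)"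
  (is "_ \<longleftrightarrow> (\<forall>x\<in>_. \<forall>xc\<in>_. \<forall>w\<in>_. \<forall>wa\<in>_. \<forall>wb\<in>_. ?nz x xc w wa wb \<longrightarrow> ?F x xc w wa wb < 0)")
proof -
  let ?S = "closed_loop G K"
  let ?f = "\<lambda>x w. - dot (n + nc) x (act \<X> x)
     + 2 * dot (r + (r1 + r2)) (act \<P> w) (act (lfr_A ?S 2 1) x + act (lfr_A ?S 2 2) w)
     + dot p (act (lfr_C ?S 1) x + act (lfr_C ?S 2) w)
         (act (the (mat_inverse Z)) (act (lfr_C ?S 1) x + act (lfr_C ?S 2) w))"
  have "neg_def (LL_sub (neg_corner \<X>) (offdiag \<P>) (P_Z q Z) ?S) \<longleftrightarrow>
    (\<forall>x\<in>fvecs (n + nc). \<forall>w\<in>fvecs (r + (r1 + r2)). x \<noteq> 0 \<or> w \<noteq> 0 \<longrightarrow> ?f x w < 0)"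
    by (rule neg_def_LL_sub_iff[OF lfr_dims_closed_loop[OF K_dims] X P Z])
  also have "\<dots> \<longleftrightarrow> (\<forall>x\<in>fvecs n. \<forall>xc\<in>fvecs nc. \<forall>w\<in>fvecs r. \<forall>wa\<in>fvecs r1. \<forall>wb\<in>fvecs r2.
      cat n x xc \<noteq> 0 \<or> cat r w (cat r1 wa wb) \<noteq> 0 \<longrightarrow> ?f (cat n x xc) (cat r w (cat r1 wa wb)) < 0)"
    by (intro iffI ballI impI; (elim cat_exhaust)?) (blast intro: fvecs_cat, auto)
  also have "\<dots> \<longleftrightarrow> (\<forall>x\<in>fvecs n. \<forall>xc\<in>fvecs nc. \<forall>w\<in>fvecs r. \<forall>wa\<in>fvecs r1. \<forall>wb\<in>fvecs r2.
      ?nz x xc w wa wb \<longrightarrow> ?F x xc w wa wb < 0)"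
  proof (intro ball_cong refl)
    fix x xc w wa wb
    assume *: "x \<in> fvecs n" "xc \<in> fvecs nc" "w \<in> fvecs r" "wa \<in> fvecs r1" "wb \<in> fvecs r2"
    show "(cat n x xc \<noteq> 0 \<or> cat r w (cat r1 wa wb) \<noteq> 0 \<longrightarrow> ?f (cat n x xc) (cat r w (cat r1 wa wb)) < 0)
      \<longleftrightarrow> (?nz x xc w wa wb \<longrightarrow> ?F x xc w wa wb < 0)"
      using closed_loop_signals(2)[OF *(2,4,5), where x = x and w = w and d = 0]
        closed_loop_signals(3)[OF *(2,4,5), where x = x and w = w] *
      by (simp add: cat_eq_0_iff del: dot_add_left dot_add_right act_add) blast
  qed
  finally show ?thesis .
qed

end

text \<open>
  The state of the transformed loop is stacked as \<open>(s, x)\<close> and its uncertainty channel as \<open>(p1, p2, p3)\<close>.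
  In the latter, inputs are grouped as \<open>(r + r) + r\<close>, but outputs as \<open>r + (r + r)\<close>.
\<close>

definition low_x where
  "low_x V s x p1 p2 p3 d = act (vX V) (sig_x x p3 d 0) + act (K11 V) s + act (K12 V) p1 + act (K13 V) p2
     + act (L1 V) (sig_y x p3 d)"

definition low_a where
  "low_a V s x p1 p2 p3 d = act (vQ2 V) (sig_z x p3 d 0) + act (K21 V) s + act (K22 V) p1
     + act (vQ2 V) (act (pl_A G 2 2) p2)"

definition low_b where
  "low_b V s x p1 p2 p3 d = act (vQ3 V) (sig_z x p3 d 0) + act (K31 V) s + act (K32 V) p1
     + act (K33 V) p2 + act (L3 V) (sig_y x p3 d)"

definition top_u where "top_u V s p1 = act (M1 V) s + act (M2 V) p1"
text \<open>The first block row of \<open>yt_1\<close> applied to \<open>(s, x)\<close>;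
  \<open>top_w\<close> is that of \<open>yt_2\<close> applied to \<open>(p1, p2, p3)\<close>. Both
  are plant signals after substitution.\<close>

definition top_x where "top_x V s x = act (vY V) s + x"
definition top_w where "top_w V p1 p2 p3 = act (vQt V) p1 + p2 + p3"

definition form where
  "form \<gamma> V s x p1 p2 p3 d =
     2 * (dot n s (sig_x (top_x V s x) (top_w V p1 p2 p3) d (top_u V s p1)) + dot n x (low_x V s x p1 p2 p3 d))
     + 2 * (dot r p1 (sig_z (top_x V s x) (top_w V p1 p2 p3) d (top_u V s p1))
         + dot r p2 (low_a V s x p1 p2 p3 d) + dot r p3 (low_b V s x p1 p2 p3 d))
     - \<gamma> * dot q d d"

definition form_sub where
  "form_sub Z V s x p1 p2 p3 =
     - (dot n s (top_x V s x) + dot n x (s + act (vX V) x))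
     + 2 * (dot r p1 (sig_z (top_x V s x) (top_w V p1 p2 p3) 0 (top_u V s p1))
         + dot r p2 (low_a V s x p1 p2 p3 0) + dot r p3 (low_b V s x p1 p2 p3 0))
     + dot p (sig_p (top_x V s x) (top_w V p1 p2 p3) (top_u V s p1))
         (act (the (mat_inverse Z)) (sig_p (top_x V s x) (top_w V p1 p2 p3) (top_u V s p1)))"

definition loop where
  "loop V = transformed_loop G (pair (vX V) (vQ2 V @\<^sub>c vQ3 V)) (pair (vY V) (vQt V @\<^sub>c 1\<^sub>m r))
     (vars_lfr r m k (pl_A G 2 2) V)"

definition Xmat where
  "Xmat V = four_block_mat (vY V) (1\<^sub>m n) (1\<^sub>m n) (vX V)"

context
  fixes V :: vars
  assumes V: "vars_dims n r m k V"
begin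

lemma V_dim:
  "vX V \<in> sym_mats n" "vY V \<in> sym_mats n" "vQ2 V \<in> sym_mats r" "vQ3 V \<in> sym_mats r" "vQt V \<in> sym_mats r"
  "K11 V \<in> carrier_mat n n" "K12 V \<in> carrier_mat n r" "K13 V \<in> carrier_mat n r"
  "K21 V \<in> carrier_mat r n" "K22 V \<in> carrier_mat r r" "K31 V \<in> carrier_mat r n"
  "K32 V \<in> carrier_mat r r" "K33 V \<in> carrier_mat r r" "L1 V \<in> carrier_mat n k" "L3 V \<in> carrier_mat r k"
  "M1 V \<in> carrier_mat m n" "M2 V \<in> carrier_mat m r"
  using V by (auto simp: vars_dims_def)

lemmas V_dims = V_dim(1-5)[THEN sym_matsD(1)] V_dim(1-5)[THEN sym_matsD(2)]
  V_dim(6-)[THEN carrier_matD(1)] V_dim(6-)[THEN carrier_matD(2)]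
lemmas V_sym = V_dim(1-5)[THEN sym_matsD(4)]

lemma XY_dims:
  assumes "i \<in> {1,2}"
  shows "pair (vX V) (vQ2 V @\<^sub>c vQ3 V) i \<in> carrier_mat (pair n r i) (pair n (r + r) i)"
    "pair (vY V) (vQt V @\<^sub>c 1\<^sub>m r) i \<in> carrier_mat (pair n r i) (pair n (r + r) i)"
  using assms by (auto simp: V_dims intro!: carrier_matI)

lemma lfr_D_vars_lfr: "lfr_D (vars_lfr r m k A V) = 0\<^sub>m m k"
  by (simp add: vars_lfr_def)

lemma lfr_dims_loop: "lfr_dims (n + n) (r + (r + r)) q p (loop V)"
  unfolding loop_def
  by (intro lfr_dims_transformed_loop lfr_dims_vars_lfr V XY_dims lfr_D_vars_lfr plant_carrier)

lemma loop_signals: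
  assumes "s \<in> fvecs n" "x \<in> fvecs n" "p1 \<in> fvecs r" "p2 \<in> fvecs r" "p3 \<in> fvecs r"
  shows "act (lfr_A (loop V) 1 1) (cat n s x)
      + act (lfr_A (loop V) 1 2) (cat (r + r) (cat r p1 p2) p3) + act (lfr_B (loop V) 1) d
    = cat n (sig_x (top_x V s x) (top_w V p1 p2 p3) d (top_u V s p1)) (low_x V s x p1 p2 p3 d)"
    and "act (lfr_A (loop V) 2 1) (cat n s x)
      + act (lfr_A (loop V) 2 2) (cat (r + r) (cat r p1 p2) p3) + act (lfr_B (loop V) 2) d
    = cat r (sig_z (top_x V s x) (top_w V p1 p2 p3) d (top_u V s p1))
        (cat r (low_a V s x p1 p2 p3 d) (low_b V s x p1 p2 p3 d))"
    and "act (lfr_C (loop V) 1) (cat n s x)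
      + act (lfr_C (loop V) 2) (cat (r + r) (cat r p1 p2) p3)
    = sig_p (top_x V s x) (top_w V p1 p2 p3) (top_u V s p1)"
proof -
  note KD = lfr_dims_vars_lfr[OF V plant_carrier(4)]
  note A = act_transformed_loop_A[OF KD XY_dims lfr_D_vars_lfr, folded loop_def]
  note B = act_transformed_loop_B[OF KD XY_dims lfr_D_vars_lfr, folded loop_def]
  note Cc = act_transformed_loop_C[OF KD XY_dims lfr_D_vars_lfr, folded loop_def]
  note all = A[of 1 1 s x] A[of 1 2 "cat r p1 p2" p3] A[of 2 1 s x] A[of 2 2 "cat r p1 p2" p3]
    B[of 1 d] B[of 2 d] Cc[of 1 s x] Cc[of 2 "cat r p1 p2" p3]
  note defs = vars_lfr_def V_dims V_sym fvecs_cat act_append_cols act_append_rows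
      act_transpose_append_cols act_four_block_mat act_cat act_mult_mat
      sig_x_def sig_y_def sig_z_def sig_p_def top_u_def top_x_def top_w_def low_x_def low_a_def low_b_def
      cat_add plant_dim
  show "act (lfr_A (loop V) 1 1) (cat n s x)
      + act (lfr_A (loop V) 1 2) (cat (r + r) (cat r p1 p2) p3) + act (lfr_B (loop V) 1) d
    = cat n (sig_x (top_x V s x) (top_w V p1 p2 p3) d (top_u V s p1)) (low_x V s x p1 p2 p3 d)"
    using assms all by (simp add: defs add_ac)
  show "act (lfr_A (loop V) 2 1) (cat n s x)
      + act (lfr_A (loop V) 2 2) (cat (r + r) (cat r p1 p2) p3) + act (lfr_B (loop V) 2) d
    = cat r (sig_z (top_x V s x) (top_w V p1 p2 p3) d (top_u V s p1))
        (cat r (low_a V s x p1 p2 p3 d) (low_b V s x p1 p2 p3 d))"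
    using assms all by (simp add: defs add_ac)
  show "act (lfr_C (loop V) 1) (cat n s x)
      + act (lfr_C (loop V) 2) (cat (r + r) (cat r p1 p2) p3)
    = sig_p (top_x V s x) (top_w V p1 p2 p3) (top_u V s p1)"
    using assms all by (simp add: defs add_ac)
qed

lemma Xmat_sym: "Xmat V \<in> sym_mats (n + n)"
  using V_dim(1,2) V_dims V_sym
  by (auto simp: Xmat_def sym_mats_def transpose_four_block_mat[of _ n n _ n _ n])

lemma act_Xmat:
  "s \<in> fvecs n \<Longrightarrow> x \<in> fvecs n \<Longrightarrow> act (Xmat V) (cat n s x) = cat n (top_x V s x) (s + act (vX V) x)"
  by (simp add: Xmat_def act_four_block_mat V_dims act_cat top_x_def)

lemma one_sym: "1\<^sub>m l \<in> sym_mats l"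
  by (simp add: sym_mats_def)

context
  fixes Z :: "real mat"
  assumes Z: "the (mat_inverse Z) \<in> sym_mats p"
begin

text \<open>Stated for the matrix itself and not only for its definiteness, because a perturbation
  compares the matrices of two variable tuples on the same stacked vector.\<close>

lemma LL_form_eq:
  assumes "s \<in> fvecs n" "x \<in> fvecs n" "p1 \<in> fvecs r" "p2 \<in> fvecs r" "p3 \<in> fvecs r" "d \<in> fvecs q"
  defines "\<xi> \<equiv> cat (n + n) (cat n s x) (cat (r + (r + r)) (cat (r + r) (cat r p1 p2) p3) d)"
  shows "dot (n + n + (r + (r + r) + q)) \<xi>
      (act (LL (offdiag (1\<^sub>m (n + n))) (offdiag (1\<^sub>m (r + (r + r)))) (P_gamma q p \<gamma>) (loop V)) \<xi>)
    = form \<gamma> V s x p1 p2 p3 d"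
proof -
  have a: "cat n s x \<in> fvecs (n + n)" "cat (r + r) (cat r p1 p2) p3 \<in> fvecs (r + (r + r))"
    using assms by (auto intro: fvecs_cat simp: add.assoc[symmetric])
  show ?thesis
    unfolding \<xi>_def
      LL_form[OF lfr_dims_loop one_sym one_sym Z a assms(6)] loop_signals[OF assms(1-5)]
    unfolding act_one_mat_id[OF a(1)] act_one_mat_id[OF a(2)] form_def
    by (simp only: cat_assoc[symmetric] dot_cat add.assoc)
qed

lemma LL_sub_form_eq:
  assumes "s \<in> fvecs n" "x \<in> fvecs n" "p1 \<in> fvecs r" "p2 \<in> fvecs r" "p3 \<in> fvecs r"
  defines "\<xi> \<equiv> cat (n + n) (cat n s x) (cat (r + r) (cat r p1 p2) p3)"
  shows "dot (n + n + (r + (r + r))) \<xi>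
      (act (LL_sub (neg_corner (Xmat V)) (offdiag (1\<^sub>m (r + (r + r)))) (P_Z q Z) (loop V)) \<xi>)
    = form_sub Z V s x p1 p2 p3"
proof -
  have a: "cat n s x \<in> fvecs (n + n)" "cat (r + r) (cat r p1 p2) p3 \<in> fvecs (r + (r + r))"
    using assms by (auto intro: fvecs_cat simp: add.assoc[symmetric])
  note signals = loop_signals(2)[OF assms(1-5), where d = 0, unfolded act_0 add_0_right]
  show ?thesis
    unfolding \<xi>_def
      LL_sub_form[OF lfr_dims_loop Xmat_sym one_sym Z a] signals loop_signals(3)[OF assms(1-5)]
    unfolding act_one_mat_id[OF a(2)] form_sub_def act_Xmat[OF assms(1,2)]
    by (simp only: cat_assoc[symmetric] dot_cat add.assoc)
qed

lemma LL_loop_sym: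
  "LL (offdiag (1\<^sub>m (n + n))) (offdiag (1\<^sub>m (r + (r + r)))) (P_gamma q p \<gamma>) (loop V)
    \<in> sym_mats (n + n + (r + (r + r) + q))"
  unfolding LL_def
  by (rule congruence_form(2)[OF carrier_outer_factor[OF lfr_dims_loop]
        diag_block_mat_sym3[OF offdiag_sym[OF one_sym] offdiag_sym[OF one_sym] P_gamma_sym]])

lemma LL_sub_loop_sym:
  "LL_sub (neg_corner (Xmat V)) (offdiag (1\<^sub>m (r + (r + r)))) (P_Z q Z) (loop V)
    \<in> sym_mats (n + n + (r + (r + r)))"
  unfolding LL_sub_def
  by (rule congruence_form(2)[OF carrier_outer_factor_sub[OF lfr_dims_loop]
        diag_block_mat_sym3[OF neg_corner_sym[OF Xmat_sym] offdiag_sym[OF one_sym] P_Z_sym[OF Z]]])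

end

end

section \<open>Definiteness of the transformed inequalities\<close>

lemma fvecs_stack_exhaust:
  assumes "f \<in> fvecs (n + n + (r + (r + r) + q))"
  obtains s x p1 p2 p3 d where "s \<in> fvecs n" "x \<in> fvecs n" "p1 \<in> fvecs r" "p2 \<in> fvecs r" "p3 \<in> fvecs r"
    "d \<in> fvecs q" "f = cat (n + n) (cat n s x) (cat (r + (r + r)) (cat (r + r) (cat r p1 p2) p3) d)"
    "f \<noteq> 0 \<longleftrightarrow> s \<noteq> 0 \<or> x \<noteq> 0 \<or> p1 \<noteq> 0 \<or> p2 \<noteq> 0 \<or> p3 \<noteq> 0 \<or> d \<noteq> 0"
proof -
  obtain g h where 1: "g \<in> fvecs (n + n)" "h \<in> fvecs (r + (r + r) + q)" "f = cat (n + n) g h"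
    using assms by (rule cat_exhaust)
  obtain s x where 2: "s \<in> fvecs n" "x \<in> fvecs n" "g = cat n s x" using 1(1) by (rule cat_exhaust)
  obtain w d where 3: "w \<in> fvecs (r + (r + r))" "d \<in> fvecs q" "h = cat (r + (r + r)) w d"
    using 1(2) by (rule cat_exhaust)
  from 3(1) have "w \<in> fvecs (r + r + r)" by (simp add: add.assoc)
  then obtain p12 p3 where 4: "p12 \<in> fvecs (r + r)" "p3 \<in> fvecs r" "w = cat (r + r) p12 p3"
    by (rule cat_exhaust)
  obtain p1 p2 where 5: "p1 \<in> fvecs r" "p2 \<in> fvecs r" "p12 = cat r p1 p2"
    using 4(1) by (rule cat_exhaust)
  have "f = 0 \<longleftrightarrow> s = 0 \<and> x = 0 \<and> p1 = 0 \<and> p2 = 0 \<and> p3 = 0 \<and> d = 0"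
    using 1(1) 2(1) 3(1) 4(1) 5(1) unfolding 1(3) cat_eq_0_iff[OF 1(1)] 3(3) cat_eq_0_iff[OF 3(1)]
    unfolding 2(3) cat_eq_0_iff[OF 2(1)] 4(3) cat_eq_0_iff[OF 4(1)] unfolding 5(3) cat_eq_0_iff[OF 5(1)]
    by blast
  with that[OF 2(1,2) 5(1,2) 4(2) 3(2)] show ?thesis
    unfolding 1(3) 2(3) 3(3) 4(3) 5(3) by blast
qed

lemma ball_stack:
  "(\<forall>f\<in>fvecs (n + n + (r + (r + r) + q)). f \<noteq> 0 \<longrightarrow> Q f) \<longleftrightarrow>
   (\<forall>s\<in>fvecs n. \<forall>x\<in>fvecs n. \<forall>p1\<in>fvecs r. \<forall>p2\<in>fvecs r. \<forall>p3\<in>fvecs r. \<forall>d\<in>fvecs q.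
      s \<noteq> 0 \<or> x \<noteq> 0 \<or> p1 \<noteq> 0 \<or> p2 \<noteq> 0 \<or> p3 \<noteq> 0 \<or> d \<noteq> 0 \<longrightarrow>
      Q (cat (n + n) (cat n s x) (cat (r + (r + r)) (cat (r + r) (cat r p1 p2) p3) d)))"
  (is "?L \<longleftrightarrow> ?R")
proof
  assume ?L
  show ?R
  proof (intro ballI impI)
    fix s x p1 p2 p3 d
    assume v: "s \<in> fvecs n" "x \<in> fvecs n" "p1 \<in> fvecs r" "p2 \<in> fvecs r" "p3 \<in> fvecs r" "d \<in> fvecs q"
      and nz: "s \<noteq> 0 \<or> x \<noteq> 0 \<or> p1 \<noteq> 0 \<or> p2 \<noteq> 0 \<or> p3 \<noteq> 0 \<or> d \<noteq> 0"
    have a: "cat n s x \<in> fvecs (n + n)" "cat r p1 p2 \<in> fvecs (r + r)"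
      "cat (r + r) (cat r p1 p2) p3 \<in> fvecs (r + (r + r))"
      using v by (auto intro: fvecs_cat simp: add.assoc[symmetric])
    have "cat (n + n) (cat n s x) (cat (r + (r + r)) (cat (r + r) (cat r p1 p2) p3) d) \<noteq> 0"
      using nz v by (auto simp: cat_eq_0_iff a)
    then show "Q (cat (n + n) (cat n s x) (cat (r + (r + r)) (cat (r + r) (cat r p1 p2) p3) d))"
      using \<open>?L\<close> v by (auto intro!: fvecs_cat)
  qed
next
  assume ?R
  show ?L
  proof (intro ballI impI)
    fix f assume f: "f \<in> fvecs (n + n + (r + (r + r) + q))" "f \<noteq> 0"
    from f(1) obtain s x p1 p2 p3 d where "s \<in> fvecs n" "x \<in> fvecs n" "p1 \<in> fvecs r" "p2 \<in> fvecs r"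
      "p3 \<in> fvecs r" "d \<in> fvecs q"
      "f = cat (n + n) (cat n s x) (cat (r + (r + r)) (cat (r + r) (cat r p1 p2) p3) d)"
      "s \<noteq> 0 \<or> x \<noteq> 0 \<or> p1 \<noteq> 0 \<or> p2 \<noteq> 0 \<or> p3 \<noteq> 0 \<or> d \<noteq> 0"
      by (rule fvecs_stack_exhaust) (use f(2) in blast)
    with \<open>?R\<close> show "Q f" by simp
  qed
qed

lemma ball_stack_sub:
  "(\<forall>f\<in>fvecs (n + n + (r + (r + r))). f \<noteq> 0 \<longrightarrow> Q f) \<longleftrightarrow>
   (\<forall>s\<in>fvecs n. \<forall>x\<in>fvecs n. \<forall>p1\<in>fvecs r. \<forall>p2\<in>fvecs r. \<forall>p3\<in>fvecs r.
      s \<noteq> 0 \<or> x \<noteq> 0 \<or> p1 \<noteq> 0 \<or> p2 \<noteq> 0 \<or> p3 \<noteq> 0 \<longrightarrow>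
      Q (cat (n + n) (cat n s x) (cat (r + r) (cat r p1 p2) p3)))"
  (is "?L \<longleftrightarrow> ?R")
proof
  assume ?L
  show ?R
  proof (intro ballI impI)
    fix s x p1 p2 p3
    assume v: "s \<in> fvecs n" "x \<in> fvecs n" "p1 \<in> fvecs r" "p2 \<in> fvecs r" "p3 \<in> fvecs r"
      and nz: "s \<noteq> 0 \<or> x \<noteq> 0 \<or> p1 \<noteq> 0 \<or> p2 \<noteq> 0 \<or> p3 \<noteq> 0"
    have a: "cat n s x \<in> fvecs (n + n)" "cat r p1 p2 \<in> fvecs (r + r)"
      "cat (r + r) (cat r p1 p2) p3 \<in> fvecs (r + (r + r))"
      using v by (auto intro: fvecs_cat simp: add.assoc[symmetric])
    have "cat (n + n) (cat n s x) (cat (r + r) (cat r p1 p2) p3) \<noteq> 0"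
      using nz v by (auto simp: cat_eq_0_iff a)
    then show "Q (cat (n + n) (cat n s x) (cat (r + r) (cat r p1 p2) p3))"
      using \<open>?L\<close> a by (auto intro!: fvecs_cat)
  qed
next
  assume ?R
  show ?L
  proof (intro ballI impI)
    fix f assume "f \<in> fvecs (n + n + (r + (r + r)))" "f \<noteq> 0"
    then obtain g w where 1: "g \<in> fvecs (n + n)" "w \<in> fvecs (r + r + r)" "f = cat (n + n) g w"
      by (metis add.assoc cat_exhaust)
    obtain s x where 2: "s \<in> fvecs n" "x \<in> fvecs n" "g = cat n s x" using 1(1) by (rule cat_exhaust)
    obtain p12 p3 where 4: "p12 \<in> fvecs (r + r)" "p3 \<in> fvecs r" "w = cat (r + r) p12 p3"
      using 1(2) by (rule cat_exhaust)
    obtain p1 p2 where 5: "p1 \<in> fvecs r" "p2 \<in> fvecs r" "p12 = cat r p1 p2"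
      using 4(1) by (rule cat_exhaust)
    have "s \<noteq> 0 \<or> x \<noteq> 0 \<or> p1 \<noteq> 0 \<or> p2 \<noteq> 0 \<or> p3 \<noteq> 0"
      using \<open>f \<noteq> 0\<close> 1(3) 2(3) 4(3) 5(3) by force
    then show "Q f" using \<open>?R\<close> 1(3) 2 4(2,3) 5 by simp
  qed
qed

lemma neg_def_loop_iff:
  assumes V: "vars_dims n r m k V" and Z: "the (mat_inverse Z) \<in> sym_mats p"
  shows "neg_def (LL (offdiag (1\<^sub>m (n + n))) (offdiag (1\<^sub>m (r + (r + r)))) (P_gamma q p \<gamma>) (loop V)) \<longleftrightarrow>
   (\<forall>s\<in>fvecs n. \<forall>x\<in>fvecs n. \<forall>p1\<in>fvecs r. \<forall>p2\<in>fvecs r. \<forall>p3\<in>fvecs r. \<forall>d\<in>fvecs q.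
      s \<noteq> 0 \<or> x \<noteq> 0 \<or> p1 \<noteq> 0 \<or> p2 \<noteq> 0 \<or> p3 \<noteq> 0 \<or> d \<noteq> 0 \<longrightarrow> form \<gamma> V s x p1 p2 p3 d < 0)"
    and "neg_def (LL_sub (neg_corner (Xmat V)) (offdiag (1\<^sub>m (r + (r + r)))) (P_Z q Z) (loop V)) \<longleftrightarrow>
   (\<forall>s\<in>fvecs n. \<forall>x\<in>fvecs n. \<forall>p1\<in>fvecs r. \<forall>p2\<in>fvecs r. \<forall>p3\<in>fvecs r.
      s \<noteq> 0 \<or> x \<noteq> 0 \<or> p1 \<noteq> 0 \<or> p2 \<noteq> 0 \<or> p3 \<noteq> 0 \<longrightarrow> form_sub Z V s x p1 p2 p3 < 0)"
  unfolding neg_def_iff[OF LL_loop_sym[OF V Z]] neg_def_iff[OF LL_sub_loop_sym[OF V Z]] ball_stack ball_stack_sub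
  by (intro ball_cong refl imp_cong; simp only: LL_form_eq[OF V Z] LL_sub_form_eq[OF V Z])+

text \<open>Applies the first-order argument to both inequalities and takes the smaller threshold.
  \<open>V\<close> is any tuple whose forms interpolate affinely between those of \<open>V0\<close>
  and \<open>V1\<close>, which covers the modifications made in both directions of the
  equivalence.\<close>

lemma form_perturb:
  assumes V: "vars_dims n r m k V0" "vars_dims n r m k V1" and Z: "the (mat_inverse Z) \<in> sym_mats p"
    and neg: "\<And>s x p1 p2 p3 d. s \<in> fvecs n \<Longrightarrow> x \<in> fvecs n \<Longrightarrow> p1 \<in> fvecs r \<Longrightarrow> p2 \<in> fvecs r \<Longrightarrow>
      p3 \<in> fvecs r \<Longrightarrow> d \<in> fvecs q \<Longrightarrow> s \<noteq> 0 \<or> x \<noteq> 0 \<or> p1 \<noteq> 0 \<or> p2 \<noteq> 0 \<or> p3 \<noteq> 0 \<or> d \<noteq> 0 \<Longrightarrow>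
      form \<gamma> V0 s x p1 p2 p3 d < 0 \<or> form \<gamma> V0 s x p1 p2 p3 d = 0 \<and> form \<gamma> V1 s x p1 p2 p3 d < 0"
    and neg_sub: "\<And>s x p1 p2 p3. s \<in> fvecs n \<Longrightarrow> x \<in> fvecs n \<Longrightarrow> p1 \<in> fvecs r \<Longrightarrow> p2 \<in> fvecs r \<Longrightarrow>
      p3 \<in> fvecs r \<Longrightarrow> s \<noteq> 0 \<or> x \<noteq> 0 \<or> p1 \<noteq> 0 \<or> p2 \<noteq> 0 \<or> p3 \<noteq> 0 \<Longrightarrow>
      form_sub Z V0 s x p1 p2 p3 < 0 \<or> form_sub Z V0 s x p1 p2 p3 = 0 \<and> form_sub Z V1 s x p1 p2 p3 < 0"
  obtains e0 where "0 < e0"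
    "\<And>e V. 0 < e \<Longrightarrow> e < e0 \<Longrightarrow> vars_dims n r m k V \<Longrightarrow>
      (\<And>s x p1 p2 p3 d. form \<gamma> V s x p1 p2 p3 d
          = (1 - e) * form \<gamma> V0 s x p1 p2 p3 d + e * form \<gamma> V1 s x p1 p2 p3 d) \<Longrightarrow>
      (\<And>s x p1 p2 p3. form_sub Z V s x p1 p2 p3
          = (1 - e) * form_sub Z V0 s x p1 p2 p3 + e * form_sub Z V1 s x p1 p2 p3) \<Longrightarrow>
      neg_def (LL (offdiag (1\<^sub>m (n + n))) (offdiag (1\<^sub>m (r + (r + r)))) (P_gamma q p \<gamma>) (loop V)) \<and>
      neg_def (LL_sub (neg_corner (Xmat V)) (offdiag (1\<^sub>m (r + (r + r)))) (P_Z q Z) (loop V))"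
proof -
  let ?N = "n + n + (r + (r + r) + q)" and ?N' = "n + n + (r + (r + r))"
  let ?M = "\<lambda>V. LL (offdiag (1\<^sub>m (n + n))) (offdiag (1\<^sub>m (r + (r + r)))) (P_gamma q p \<gamma>) (loop V)"
  let ?M' = "\<lambda>V. LL_sub (neg_corner (Xmat V)) (offdiag (1\<^sub>m (r + (r + r)))) (P_Z q Z) (loop V)"
  have "\<forall>f\<in>fvecs ?N. f \<noteq> 0 \<longrightarrow> dot ?N f (act (?M V0) f) < 0
      \<or> dot ?N f (act (?M V0) f) = 0 \<and> dot ?N f (act (?M V1) f) < 0"
    unfolding ball_stack
    by (intro ballI impI, simp only: LL_form_eq[OF V(1) Z] LL_form_eq[OF V(2) Z], rule neg, assumption+)
  then obtain e1 where e1: "e1 > 0" "\<And>e f. 0 < e \<Longrightarrow> e < e1 \<Longrightarrow> f \<in> fvecs ?N \<Longrightarrow> f \<noteq> 0 \<Longrightarrow>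
      (1 - e) * dot ?N f (act (?M V0) f) + e * dot ?N f (act (?M V1) f) < 0"
    using neg_form_perturb[of ?N "?M V0" "?M V1"] by blast
  have "\<forall>f\<in>fvecs ?N'. f \<noteq> 0 \<longrightarrow> dot ?N' f (act (?M' V0) f) < 0
      \<or> dot ?N' f (act (?M' V0) f) = 0 \<and> dot ?N' f (act (?M' V1) f) < 0"
    unfolding ball_stack_sub
    by (intro ballI impI, simp only: LL_sub_form_eq[OF V(1) Z] LL_sub_form_eq[OF V(2) Z], rule neg_sub, assumption+)
  then obtain e2 where e2: "e2 > 0" "\<And>e f. 0 < e \<Longrightarrow> e < e2 \<Longrightarrow> f \<in> fvecs ?N' \<Longrightarrow> f \<noteq> 0 \<Longrightarrow>
      (1 - e) * dot ?N' f (act (?M' V0) f) + e * dot ?N' f (act (?M' V1) f) < 0"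
    using neg_form_perturb[of ?N' "?M' V0" "?M' V1"] by blast
  show ?thesis
  proof (rule that[of "min e1 e2"])
    show "0 < min e1 e2" using e1 e2 by simp
    fix e V'
    assume e: "0 < e" "e < min e1 e2" and V': "vars_dims n r m k V'"
      and eq: "\<And>s x p1 p2 p3 d. form \<gamma> V' s x p1 p2 p3 d
          = (1 - e) * form \<gamma> V0 s x p1 p2 p3 d + e * form \<gamma> V1 s x p1 p2 p3 d"
      and eq': "\<And>s x p1 p2 p3. form_sub Z V' s x p1 p2 p3
          = (1 - e) * form_sub Z V0 s x p1 p2 p3 + e * form_sub Z V1 s x p1 p2 p3"
    have "\<forall>f\<in>fvecs ?N. f \<noteq> 0 \<longrightarrow> (1 - e) * dot ?N f (act (?M V0) f) + e * dot ?N f (act (?M V1) f) < 0"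
      using e1(2) e by simp
    note * = this[unfolded ball_stack, rule_format]
    have 1: "neg_def (?M V')"
      unfolding neg_def_loop_iff(1)[OF V' Z] eq
    proof (intro ballI impI)
      fix s x p1 p2 p3 d
      assume v: "s \<in> fvecs n" "x \<in> fvecs n" "p1 \<in> fvecs r" "p2 \<in> fvecs r" "p3 \<in> fvecs r" "d \<in> fvecs q"
        and nz: "s \<noteq> 0 \<or> x \<noteq> 0 \<or> p1 \<noteq> 0 \<or> p2 \<noteq> 0 \<or> p3 \<noteq> 0 \<or> d \<noteq> 0"
      show "(1 - e) * form \<gamma> V0 s x p1 p2 p3 d + e * form \<gamma> V1 s x p1 p2 p3 d < 0"
        using *[OF v nz] unfolding LL_form_eq[OF V(1) Z v] LL_form_eq[OF V(2) Z v] .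
    qed
    have "\<forall>f\<in>fvecs ?N'. f \<noteq> 0 \<longrightarrow> (1 - e) * dot ?N' f (act (?M' V0) f) + e * dot ?N' f (act (?M' V1) f) < 0"
      using e2(2) e by simp
    note * = this[unfolded ball_stack_sub, rule_format]
    have 2: "neg_def (?M' V')"
      unfolding neg_def_loop_iff(2)[OF V' Z] eq'
    proof (intro ballI impI)
      fix s x p1 p2 p3
      assume v: "s \<in> fvecs n" "x \<in> fvecs n" "p1 \<in> fvecs r" "p2 \<in> fvecs r" "p3 \<in> fvecs r"
        and nz: "s \<noteq> 0 \<or> x \<noteq> 0 \<or> p1 \<noteq> 0 \<or> p2 \<noteq> 0 \<or> p3 \<noteq> 0"
      show "(1 - e) * form_sub Z V0 s x p1 p2 p3 + e * form_sub Z V1 s x p1 p2 p3 < 0"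
        using *[OF v nz] unfolding LL_sub_form_eq[OF V(1) Z v] LL_sub_form_eq[OF V(2) Z v] .
    qed
    from 1 2 show "neg_def (?M V') \<and> neg_def (?M' V')" by simp
  qed
qed

end

section \<open>The change of variables\<close>

context lifted_loop
begin

text \<open>
  This is \<open>K\<^sub>i\<^sub>j = X\<^sub>i\<^sup>T (A\<^sub>i\<^sub>j Y\<^sub>j + B\<^sub>i M\<^sub>j) + U\<^sub>i\<^sup>T (A\<^sup>c\<^sub>i\<^sub>j V\<^sub>j + B\<^sup>c\<^sub>i C\<^sub>j Y\<^sub>j)\<close>, \<open>M\<^sub>j = C\<^sup>c\<^sub>j V\<^sub>j\<close>, \<open>L\<^sub>i = U\<^sub>i\<^sup>T B\<^sup>c\<^sub>i\<close>, written out for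
  \<open>U\<^sub>1 = U\<close>, \<open>V\<^sub>1 = T\<close>, \<open>U\<^sub>2 = [S Ua; 0 Ub]\<close> and \<open>V\<^sub>2 = [Va 0; Vb W]\<close>.
\<close>

definition linked :: "ctrl \<Rightarrow> vars \<Rightarrow> real mat \<Rightarrow> real mat \<Rightarrow> real mat \<Rightarrow> real mat \<Rightarrow> real mat \<Rightarrow> real mat
    \<Rightarrow> real mat \<Rightarrow> real mat \<Rightarrow> bool" where
  "linked C V T U Va Vb W S Ua Ub \<longleftrightarrow>
    (\<forall>f. act (M1 V) f = act (J1 C) (act T f)) \<and>
    (\<forall>f. act (M2 V) f = act (J2 C) (act Va f)) \<and>
    (\<forall>f. act (L1 V) f = act U\<^sup>T (act (H1 C) f)) \<and>
    (\<forall>f. act (L3 V) f = act Ub\<^sup>T (act (H3 C) f)) \<and>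
    (\<forall>f. act (K11 V) f = act (vX V) (act (pl_A G 1 1) (act (vY V) f) + act (pl_B G 1) (act (J1 C) (act T f)))
       + act U\<^sup>T (act (F11 C) (act T f) + act (H1 C) (act (pl_C G 1) (act (vY V) f)))) \<and>
    (\<forall>f. act (K12 V) f = act (vX V) (act (pl_A G 1 2) (act (vQt V) f) + act (pl_B G 1) (act (J2 C) (act Va f)))
       + act U\<^sup>T (act (F12 C) (act Va f) + act (F13 C) (act Vb f) + act (H1 C) (act (pl_C G 2) (act (vQt V) f)))) \<and>
    (\<forall>f. act (K13 V) f = act (vX V) (act (pl_A G 1 2) f)
       + act U\<^sup>T (act (F13 C) (act W f) + act (H1 C) (act (pl_C G 2) f))) \<and>
    (\<forall>f. act (K21 V) f = act (vQ2 V) (act (pl_A G 2 1) (act (vY V) f) + act (pl_B G 2) (act (J1 C) (act T f)))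
       + act S\<^sup>T (act (F21 C) (act T f))) \<and>
    (\<forall>f. act (K22 V) f = act (vQ2 V) (act (pl_A G 2 2) (act (vQt V) f) + act (pl_B G 2) (act (J2 C) (act Va f)))
       + act S\<^sup>T (act (F22 C) (act Va f))) \<and>
    (\<forall>f. act (K31 V) f = act (vQ3 V) (act (pl_A G 2 1) (act (vY V) f) + act (pl_B G 2) (act (J1 C) (act T f)))
       + act Ua\<^sup>T (act (F21 C) (act T f))
       + act Ub\<^sup>T (act (F31 C) (act T f) + act (H3 C) (act (pl_C G 1) (act (vY V) f)))) \<and>
    (\<forall>f. act (K32 V) f = act (vQ3 V) (act (pl_A G 2 2) (act (vQt V) f) + act (pl_B G 2) (act (J2 C) (act Va f)))
       + act Ua\<^sup>T (act (F22 C) (act Va f))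
       + act Ub\<^sup>T (act (F32 C) (act Va f) + act (F33 C) (act Vb f) + act (H3 C) (act (pl_C G 2) (act (vQt V) f)))) \<and>
    (\<forall>f. act (K33 V) f = act (vQ3 V) (act (pl_A G 2 2) f)
       + act Ub\<^sup>T (act (F33 C) (act W f) + act (H3 C) (act (pl_C G 2) f)))"

context
  fixes C :: ctrl and V :: vars and T U Va Vb W S Ua Ub :: "real mat"
  assumes linked: "linked C V T U Va Vb W S Ua Ub"
begin

lemma linked_top_u: "top_u V s p1 = ctl_u C (act T s) (act Va p1)"
  using linked by (simp add: linked_def top_u_def ctl_u_def)

text \<open>The products with \<open>vX V\<close> inside \<open>K11\<close>, \<open>K12\<close>,
  \<open>K13\<close> complete the arguments of \<open>sig_x\<close> to the substituted plant
  signals; what remains is \<open>U\<^sup>T\<close> times the state derivative of the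
  controller.\<close>

lemma linked_low_x:
  "low_x V s x p1 p2 p3 d
    = act (vX V) (sig_x (top_x V s x) (top_w V p1 p2 p3) d (top_u V s p1))
     + act U\<^sup>T (ctl_x C (top_x V s x) (act T s) (top_w V p1 p2 p3) (act Va p1) (act Vb p1 + act W p2) d)"
  using linked unfolding linked_def
  by (simp add: low_x_def sig_x_def top_x_def top_w_def top_u_def ctl_x_def sig_y_def add_ac)

text \<open>The input \<open>p2\<close> reaches the controller only through \<open>wb\<close> and
  the measurement, neither of which \<open>ctl_a\<close> sees. Its whole contribution is therefore
  \<open>vQ2 V\<close> times the plant term, which is the prescribed block of the transformed
  controller.\<close>

lemma linked_low_a:
  "low_a V s x p1 p2 p3 d
    = act (vQ2 V) (sig_z (top_x V s x) (top_w V p1 p2 p3) d (top_u V s p1))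
     + act S\<^sup>T (ctl_a C (act T s) (act Va p1))"
  using linked unfolding linked_def
  by (simp add: low_a_def sig_z_def top_x_def top_w_def top_u_def ctl_a_def add_ac)

lemma linked_low_b:
  "low_b V s x p1 p2 p3 d
    = act (vQ3 V) (sig_z (top_x V s x) (top_w V p1 p2 p3) d (top_u V s p1))
     + act Ua\<^sup>T (ctl_a C (act T s) (act Va p1))
     + act Ub\<^sup>T (ctl_b C (top_x V s x) (act T s) (top_w V p1 p2 p3) (act Va p1) (act Vb p1 + act W p2) d)"
  using linked unfolding linked_def
  by (simp add: low_b_def sig_z_def top_x_def top_w_def top_u_def ctl_a_def ctl_b_def sig_y_def add_ac)

context
  fixes nc r1 r2 :: nat and \<X> \<P> :: "real mat"
  assumes V: "vars_dims n r m k V"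
    and U: "U \<in> carrier_mat nc n" and S: "S \<in> carrier_mat r1 r"
    and Ua: "Ua \<in> carrier_mat r1 r" and Ub: "Ub \<in> carrier_mat r2 r"
    and X: "\<forall>s\<in>fvecs n. \<forall>x\<in>fvecs n.
      act \<X> (cat n (top_x V s x) (act T s)) = cat n (s + act (vX V) x) (act U x)"
    and P: "\<forall>p1\<in>fvecs r. \<forall>p2\<in>fvecs r. \<forall>p3\<in>fvecs r.
      act \<P> (cat r (top_w V p1 p2 p3) (cat r1 (act Va p1) (act Vb p1 + act W p2)))
      = cat r (p1 + act (vQ2 V) p2 + act (vQ3 V) p3) (cat r1 (act S p2 + act Ua p3) (act Ub p3))"
begin

text \<open>The multipliers in \<open>low_x\<close>, \<open>low_a\<close>, \<open>low_b\<close> are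
  moved onto \<open>x\<close>, \<open>p2\<close>, \<open>p3\<close> and there form exactly the
  columns that \<open>\<X>\<close> and \<open>\<P>\<close> produce from the substituted
  vectors.\<close>

lemma linked_channels:
  assumes "s \<in> fvecs n" "x \<in> fvecs n" "p1 \<in> fvecs r" "p2 \<in> fvecs r" "p3 \<in> fvecs r"
  defines "xh \<equiv> top_x V s x" and "w \<equiv> top_w V p1 p2 p3" and "u \<equiv> top_u V s p1"
  shows "dot n s (sig_x xh w d u) + dot n x (low_x V s x p1 p2 p3 d)
    = dot (n + nc) (act \<X> (cat n xh (act T s)))
        (cat n (sig_x xh w d u) (ctl_x C xh (act T s) w (act Va p1) (act Vb p1 + act W p2) d))"
    and "dot r p1 (sig_z xh w d u) + dot r p2 (low_a V s x p1 p2 p3 d) + dot r p3 (low_b V s x p1 p2 p3 d)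
    = dot (r + (r1 + r2)) (act \<P> (cat r w (cat r1 (act Va p1) (act Vb p1 + act W p2))))
        (cat r (sig_z xh w d u) (cat r1 (ctl_a C (act T s) (act Va p1))
          (ctl_b C xh (act T s) w (act Va p1) (act Vb p1 + act W p2) d)))"
proof -
  note sy = V_dim(1-5)[OF V, THEN sym_matsD(5)]
  have tr: "dot n f (act U\<^sup>T g) = dot nc (act U f) g"
    "dot r f (act S\<^sup>T h) = dot r1 (act S f) h" "dot r f (act Ua\<^sup>T h) = dot r1 (act Ua f) h"
    "dot r f (act Ub\<^sup>T i) = dot r2 (act Ub f) i" for f g h i
    using dot_act_left[of U nc f g] dot_act_left[of S r1 f h] dot_act_left[of Ua r1 f h]
      dot_act_left[of Ub r2 f i] U S Ua Ub by auto
  show "dot n s (sig_x xh w d u) + dot n x (low_x V s x p1 p2 p3 d)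
    = dot (n + nc) (act \<X> (cat n xh (act T s)))
        (cat n (sig_x xh w d u) (ctl_x C xh (act T s) w (act Va p1) (act Vb p1 + act W p2) d))"
    unfolding xh_def w_def u_def X[rule_format, OF assms(1,2)] dot_cat linked_low_x
    by (simp add: sy tr)
  show "dot r p1 (sig_z xh w d u) + dot r p2 (low_a V s x p1 p2 p3 d) + dot r p3 (low_b V s x p1 p2 p3 d)
    = dot (r + (r1 + r2)) (act \<P> (cat r w (cat r1 (act Va p1) (act Vb p1 + act W p2))))
        (cat r (sig_z xh w d u) (cat r1 (ctl_a C (act T s) (act Va p1))
          (ctl_b C xh (act T s) w (act Va p1) (act Vb p1 + act W p2) d)))"
    unfolding xh_def w_def u_def P[rule_format, OF assms(3-5)] dot_cat linked_low_a linked_low_b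
    by (simp add: sy tr)
qed

lemma form_linked:
  assumes "s \<in> fvecs n" "x \<in> fvecs n" "p1 \<in> fvecs r" "p2 \<in> fvecs r" "p3 \<in> fvecs r"
  defines "xh \<equiv> top_x V s x" and "w \<equiv> top_w V p1 p2 p3" and "xc \<equiv> act T s"
    and "wa \<equiv> act Va p1" and "wb \<equiv> act Vb p1 + act W p2"
  shows "form \<gamma> V s x p1 p2 p3 d
    = 2 * dot (n + nc) (act \<X> (cat n xh xc)) (cat n (sig_x xh w d (ctl_u C xc wa)) (ctl_x C xh xc w wa wb d))
      + 2 * dot (r + (r1 + r2)) (act \<P> (cat r w (cat r1 wa wb)))
          (cat r (sig_z xh w d (ctl_u C xc wa)) (cat r1 (ctl_a C xc wa) (ctl_b C xh xc w wa wb d)))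
      - \<gamma> * dot q d d"
  unfolding form_def linked_channels[OF assms(1-5)]
  unfolding linked_top_u xh_def w_def xc_def wa_def wb_def ..

text \<open>\<open>TU\<close> is the leading block of the identity for the inverse of
  \<open>\<X>\<close> times \<open>\<X>\<close>. It turns the Lyapunov form of the substituted state
  into that of \<open>Xmat V\<close>.\<close>

lemma form_sub_linked:
  assumes "s \<in> fvecs n" "x \<in> fvecs n" "p1 \<in> fvecs r" "p2 \<in> fvecs r" "p3 \<in> fvecs r"
    and TU: "dot n (act (vY V) s) (act (vX V) x) + dot nc (act T s) (act U x) = dot n s x"
  defines "xh \<equiv> top_x V s x" and "w \<equiv> top_w V p1 p2 p3" and "xc \<equiv> act T s"
    and "wa \<equiv> act Va p1" and "wb \<equiv> act Vb p1 + act W p2"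
  shows "form_sub Z V s x p1 p2 p3
    = - dot (n + nc) (cat n xh xc) (act \<X> (cat n xh xc))
      + 2 * dot (r + (r1 + r2)) (act \<P> (cat r w (cat r1 wa wb)))
          (cat r (sig_z xh w 0 (ctl_u C xc wa)) (cat r1 (ctl_a C xc wa) (ctl_b C xh xc w wa wb 0)))
      + dot p (sig_p xh w (ctl_u C xc wa)) (act (the (mat_inverse Z)) (sig_p xh w (ctl_u C xc wa)))"
proof -
  have "dot n s (top_x V s x) + dot n x (s + act (vX V) x)
    = dot (n + nc) (cat n xh xc) (act \<X> (cat n xh xc))"
    using TU unfolding xh_def xc_def X[rule_format, OF assms(1,2)] dot_cat
    by (simp add: top_x_def dot_commute[of n s] dot_commute[of n "act (vX V) x"])
  then show ?thesis
    unfolding form_sub_def linked_channels[OF assms(1-5)]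
    unfolding linked_top_u xh_def w_def xc_def wa_def wb_def by simp
qed

end

end

end

section \<open>From transformed variables to a controller\<close>

lemma structured_controller_ctrl_lfr:
  "ctrl_dims nc r1 r2 m k C \<Longrightarrow> structured_controller nc r1 r2 m k (ctrl_lfr r1 r2 m k C)"
  unfolding ctrl_dims_def structured_controller_def ctrl_lfr_def lfr.simps pair_simps pair2_simps
  by (elim conjE, intro conjI) (assumption | rule refl carrier_append_cols carrier_append_rows bexI)+

lemma split_colsE:
  assumes "A \<in> carrier_mat l (n1 + n2)"
  obtains A1 A2 where "A1 \<in> carrier_mat l n1" "A2 \<in> carrier_mat l n2" "A = A1 @\<^sub>c A2"
proof
  show "mat l n1 (\<lambda>(i, j). A $$ (i, j)) \<in> carrier_mat l n1" by simp
  show "mat l n2 (\<lambda>(i, j). A $$ (i, j + n1)) \<in> carrier_mat l n2" by simp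
  show "A = mat l n1 (\<lambda>(i, j). A $$ (i, j)) @\<^sub>c mat l n2 (\<lambda>(i, j). A $$ (i, j + n1))"
    using assms by (intro eq_matI) (auto simp: append_cols_def)
qed

lemma split_rowsE:
  assumes "A \<in> carrier_mat (n1 + n2) l"
  obtains A1 A2 where "A1 \<in> carrier_mat n1 l" "A2 \<in> carrier_mat n2 l" "A = A1 @\<^sub>r A2"
proof
  show "mat n1 l (\<lambda>(i, j). A $$ (i, j)) \<in> carrier_mat n1 l" by simp
  show "mat n2 l (\<lambda>(i, j). A $$ (i + n1, j)) \<in> carrier_mat n2 l" by simp
  show "A = mat n1 l (\<lambda>(i, j). A $$ (i, j)) @\<^sub>r mat n2 l (\<lambda>(i, j). A $$ (i + n1, j))"
    using assms by (intro eq_matI) (auto simp: append_rows_def)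
qed

lemma structured_controllerE:
  assumes "structured_controller nc r1 r2 m k K"
  obtains C where "ctrl_dims nc r1 r2 m k C" "lfr_eq K (ctrl_lfr r1 r2 m k C)"
proof -
  from assms obtain A22 A32 A33 B3 C2 where 1:
    "lfr_A K 1 1 \<in> carrier_mat nc nc" "lfr_A K 1 2 \<in> carrier_mat nc (r1 + r2)"
    "lfr_A K 2 1 \<in> carrier_mat (r1 + r2) nc"
    "A22 \<in> carrier_mat r1 r1" "A32 \<in> carrier_mat r2 r1" "A33 \<in> carrier_mat r2 r2"
    "lfr_A K 2 2 = four_block_mat A22 (0\<^sub>m r1 r2) A32 A33"
    "lfr_B K 1 \<in> carrier_mat nc k" "B3 \<in> carrier_mat r2 k" "lfr_B K 2 = 0\<^sub>m r1 k @\<^sub>r B3"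
    "lfr_C K 1 \<in> carrier_mat m nc" "C2 \<in> carrier_mat m r1" "lfr_C K 2 = C2 @\<^sub>c 0\<^sub>m m r2" "lfr_D K = 0\<^sub>m m k"
    unfolding structured_controller_def by (elim conjE bexE)
  from 1(2) obtain A12 A13 where 2: "A12 \<in> carrier_mat nc r1" "A13 \<in> carrier_mat nc r2" "lfr_A K 1 2 = A12 @\<^sub>c A13"
    by (rule split_colsE)
  from 1(3) obtain A21 A31 where 3: "A21 \<in> carrier_mat r1 nc" "A31 \<in> carrier_mat r2 nc" "lfr_A K 2 1 = A21 @\<^sub>r A31"
    by (rule split_rowsE)
  let ?C = "\<lparr>F11 = lfr_A K 1 1, F12 = A12, F13 = A13, F21 = A21, F22 = A22, F31 = A31, F32 = A32, F33 = A33,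
      H1 = lfr_B K 1, H3 = B3, J1 = lfr_C K 1, J2 = C2\<rparr>"
  show ?thesis
  proof (rule that[of ?C])
    show "ctrl_dims nc r1 r2 m k ?C" using 1 2 3 by (simp add: ctrl_dims_def)
    show "lfr_eq K (ctrl_lfr r1 r2 m k ?C)"
      unfolding lfr_eq_def ctrl_lfr_def lfr.simps ctrl.simps
      by (simp only: ball_simps ball_empty pair_simps pair2_simps 1(7,10,13,14) 2(3) 3(3) simp_thms)
  qed
qed

lemma scalings_iff:
  assumes "\<forall>V\<in>VV. D V \<in> carrier_mat n n"
  shows "P \<in> scalings VV n D \<longleftrightarrow>
    P \<in> sym_mats n \<and> (\<forall>V\<in>VV. \<forall>f\<in>fvecs n. f \<noteq> 0 \<longrightarrow> 0 < dot n (act P f) (act (D V) f))"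
  using assms pos_def_He_iff by (auto simp: scalings_def)

text \<open>The pairing is written with \<open>act (D V)\<close> applied to \<open>act P f\<close>,
  because the first column of \<open>yt_2\<close> sends \<open>p1\<close> to
  \<open>act Qt p1\<close>, on which the uncertainty acts.\<close>

lemma dual_scalings_iff:
  assumes D: "\<forall>V\<in>VV. D V \<in> carrier_mat n n"
  shows "P \<in> scalings VV n (\<lambda>V. (D V)\<^sup>T) \<longleftrightarrow>
    P \<in> sym_mats n \<and> (\<forall>V\<in>VV. \<forall>f\<in>fvecs n. f \<noteq> 0 \<longrightarrow> 0 < dot n f (act (D V) (act P f)))"
proof -
  have "dot n f (act (D V) (act P f)) = dot n (act P f) (act (D V)\<^sup>T f)" if "V \<in> VV" for V f
    using dot_act_right[of "D V" n f "act P f"] D[rule_format, OF that] by (simp add: dot_commute)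
  then show ?thesis by (subst scalings_iff) (use D in auto)
qed

lemma loop_scalings_iff:
  assumes D: "\<forall>V\<in>VV. D V \<in> carrier_mat n n"
    and Dc: "\<forall>V\<in>VV. D11 V \<in> carrier_mat r1 r1 \<and> D21 V \<in> carrier_mat r2 r1 \<and> D22 V \<in> carrier_mat r2 r2
        \<and> Dc V = four_block_mat (D11 V) (0\<^sub>m r1 r2) (D21 V) (D22 V)"
  shows "P \<in> scalings VV (n + (r1 + r2)) (\<lambda>V. diag_block_mat [D V, Dc V]) \<longleftrightarrow>
    P \<in> sym_mats (n + (r1 + r2)) \<and> (\<forall>V\<in>VV. \<forall>w\<in>fvecs n. \<forall>wa\<in>fvecs r1. \<forall>wb\<in>fvecs r2.
      w \<noteq> 0 \<or> wa \<noteq> 0 \<or> wb \<noteq> 0 \<longrightarrow>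
      0 < dot (n + (r1 + r2)) (act P (cat n w (cat r1 wa wb)))
        (cat n (act (D V) w) (cat r1 (act (D11 V) wa) (act (D21 V) wa + act (D22 V) wb))))"
proof -
  let ?L = "\<lambda>V. diag_block_mat [D V, Dc V]"
  have c: "?L V \<in> carrier_mat (n + (r1 + r2)) (n + (r1 + r2))" if "V \<in> VV" for V
    using D[rule_format, OF that] Dc[rule_format, OF that] by (intro carrier_diag_block_mat2) auto
  have act: "act (?L V) (cat n w (cat r1 wa wb))
      = cat n (act (D V) w) (cat r1 (act (D11 V) wa) (act (D21 V) wa + act (D22 V) wb))"
    if "V \<in> VV" for V w wa wb
    unfolding act_diag_block_mat2 using D[rule_format, OF that] Dc[rule_format, OF that]
    by (auto simp: act_four_block_mat act_cat)
  have eq: "(\<forall>f\<in>fvecs (n + (r1 + r2)). f \<noteq> 0 \<longrightarrow> 0 < dot (n + (r1 + r2)) (act P f) (act (?L V) f)) \<longleftrightarrow>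
     (\<forall>w\<in>fvecs n. \<forall>wa\<in>fvecs r1. \<forall>wb\<in>fvecs r2. w \<noteq> 0 \<or> wa \<noteq> 0 \<or> wb \<noteq> 0 \<longrightarrow>
      0 < dot (n + (r1 + r2)) (act P (cat n w (cat r1 wa wb))) (act (?L V) (cat n w (cat r1 wa wb))))" for V
  proof -
    have "(\<forall>f\<in>fvecs (n + (r1 + r2)). f \<noteq> 0 \<longrightarrow> Q f) \<longleftrightarrow>
      (\<forall>w\<in>fvecs n. \<forall>wa\<in>fvecs r1. \<forall>wb\<in>fvecs r2. cat n w (cat r1 wa wb) \<noteq> 0 \<longrightarrow> Q (cat n w (cat r1 wa wb)))" for Q
      by (intro iffI ballI impI; (elim cat_exhaust)?) (blast intro: fvecs_cat, auto)
    then show ?thesis by (auto simp: cat_eq_0_iff)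
  qed
  have "P \<in> scalings VV (n + (r1 + r2)) ?L \<longleftrightarrow> P \<in> sym_mats (n + (r1 + r2)) \<and>
      (\<forall>V\<in>VV. \<forall>f\<in>fvecs (n + (r1 + r2)). f \<noteq> 0 \<longrightarrow> 0 < dot (n + (r1 + r2)) (act P f) (act (?L V) f))"
    by (rule scalings_iff) (use c in blast)
  then show ?thesis
    unfolding eq by (simp only: act cong: ball_cong)
qed

section \<open>The two sides of the equivalence, and (b) to (a) in the regular case\<close>

context lifted_loop
begin

definition synthesizable where
  "synthesizable VV Dl \<gamma> \<longleftrightarrow> (\<exists>nc r1 r2 K Dc X P Z.
     structured_controller nc r1 r2 m k K \<and> structured_scheduling VV r1 r2 Dc \<and>
     X \<in> sym_mats (n + nc) \<and> pos_def X \<and>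
     P \<in> scalings VV (r + (r1 + r2)) (\<lambda>V. diag_block_mat [Dl V, Dc V]) \<and>
     Z \<in> sym_mats p \<and> pos_def Z \<and> tr Z < 1 \<and>
     neg_def (LL_sub (neg_corner X) (offdiag P) (P_Z q Z) (closed_loop G K)) \<and>
     neg_def (LL (offdiag X) (offdiag P) (P_gamma q p \<gamma>) (closed_loop G K)))"

definition admissible where
  "admissible VV Dl \<gamma> Z V \<longleftrightarrow> vars_dims n r m k V \<and>
     vQ2 V \<in> scalings VV r Dl \<and> vQ3 V \<in> scalings VV r Dl \<and> vQt V \<in> scalings VV r (\<lambda>V. (Dl V)\<^sup>T) \<and>
     Z \<in> sym_mats p \<and> pos_def Z \<and> tr Z < 1 \<and>
     neg_def (LL_sub (neg_corner (Xmat V)) (offdiag (1\<^sub>m (r + (r + r)))) (P_Z q Z) (loop V)) \<and>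
     neg_def (LL (offdiag (1\<^sub>m (n + n))) (offdiag (1\<^sub>m (r + (r + r)))) (P_gamma q p \<gamma>) (loop V))"

context
  fixes VV :: "real mat set" and Dl :: "real mat \<Rightarrow> real mat"
  assumes Dl: "\<forall>V\<in>VV. Dl V \<in> carrier_mat r r"
begin

text \<open>
  Here \<open>T = I\<close>, \<open>Va = I\<close>, \<open>Vb = 0\<close> and \<open>W = I\<close>, which makes both substitutions invertible. The blocks of
  \<open>\<Delta>\<^sub>c\<close> are chosen to cancel all cross terms of \<open>p1\<close>, \<open>p2\<close>, \<open>p3\<close> in the scaling condition.
\<close>

lemma synthesizable_if_regular:
  assumes adm: "admissible VV Dl \<gamma> Z V"
    and S: "\<And>f. f \<in> fvecs r \<Longrightarrow> act (vQt V) (act (vQ2 V) f) = f \<Longrightarrow> f = 0"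
    and Ub: "\<And>f. f \<in> fvecs r \<Longrightarrow> act (vQ2 V) f = act (vQ3 V) f \<Longrightarrow> f = 0"
  shows "synthesizable VV Dl \<gamma>"
proof -
  have V: "vars_dims n r m k V" using adm by (simp add: admissible_def)
  note dim [simp] = V_dims[OF V] plant_dim
  note sy = V_dim(1-5)[OF V, THEN sym_matsD(5)]
  note trn = V_sym[OF V]
  have Z: "Z \<in> sym_mats p" "pos_def Z" "tr Z < 1" using adm by (simp_all add: admissible_def)
  note Zi = the_mat_inverse_pos_def[OF Z(1,2)]
  define X Y Q2 Q3 Qt where "X = vX V" and "Y = vY V" and "Q2 = vQ2 V" and "Q3 = vQ3 V" and "Qt = vQt V"
  note defs = X_def Y_def Q2_def Q3_def Qt_def
  note [simp] = dim[folded defs]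
  note sy = sy[folded defs] and trn = trn[folded defs]
  have neg: "form \<gamma> V s x p1 p2 p3 d < 0"
    if "s \<in> fvecs n" "x \<in> fvecs n" "p1 \<in> fvecs r" "p2 \<in> fvecs r" "p3 \<in> fvecs r" "d \<in> fvecs q"
      "s \<noteq> 0 \<or> x \<noteq> 0 \<or> p1 \<noteq> 0 \<or> p2 \<noteq> 0 \<or> p3 \<noteq> 0 \<or> d \<noteq> 0" for s x p1 p2 p3 d
    using adm that unfolding admissible_def neg_def_loop_iff[OF V Zi(1)] by blast
  have neg_sub: "form_sub Z V s x p1 p2 p3 < 0"
    if "s \<in> fvecs n" "x \<in> fvecs n" "p1 \<in> fvecs r" "p2 \<in> fvecs r" "p3 \<in> fvecs r"
      "s \<noteq> 0 \<or> x \<noteq> 0 \<or> p1 \<noteq> 0 \<or> p2 \<noteq> 0 \<or> p3 \<noteq> 0" for s x p1 p2 p3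
    using adm that unfolding admissible_def neg_def_loop_iff[OF V Zi(1)] by blast
  \<comment> \<open>At zero uncertainty inputs only the Lyapunov form and the nonnegative term with
    the inverse of \<open>Z\<close> survive in \<open>form_sub\<close>, so \<open>Xmat V\<close> is
    positive definite.\<close>
  have Xpos: "0 < dot n s (act Y s + x) + dot n x (s + act X x)"
    if "s \<in> fvecs n" "x \<in> fvecs n" "s \<noteq> 0 \<or> x \<noteq> 0" for s x
  proof -
    let ?z = "sig_p (top_x V s x) (top_w V 0 0 0) (top_u V s 0)"
    have z: "?z \<in> fvecs p" by (auto simp: sig_p_def intro!: fvecs_add)
    show ?thesis
      using neg_sub[of s x 0 0 0] that Zi(2)[OF z] by (simp add: form_sub_def top_x_def defs)
  qed

  \<comment> \<open>With \<open>T = I\<close>, symmetry of \<open>yt_1\<^sup>T \<X> yt_1\<close>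
    forces \<open>Y X + U = I\<close>.\<close>
  define U where "U = 1\<^sub>m n - Y * X"
  have U: "U \<in> carrier_mat n n" by (rule carrier_matI) (simp_all add: U_def)
  have actU: "act U f = f - act Y (act X f)" if "f \<in> fvecs n" for f
    using that by (simp add: U_def act_minus_mat act_mult_mat)
  obtain Ui where Ui: "Ui \<in> carrier_mat n n" "U * Ui = 1\<^sub>m n" "Ui * U = 1\<^sub>m n"
  proof (rule act_inj_imp_inverse[OF U])
    fix f assume f: "f \<in> fvecs n" "act U f = 0"
    then have "f = act Y (act X f)" by (simp add: actU)
    \<comment> \<open>At \<open>(- X f, f)\<close> the form of \<open>Xmat V\<close> vanishes as
      soon as \<open>f = Y X f\<close>.\<close>
    then have "dot n (- act X f) (act Y (- act X f) + f) + dot n f (- act X f + act X f) = 0" by simp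
    with Xpos[of "- act X f" f] f show "f = 0" by (force intro: fvecs_minus)
  qed blast
  \<comment> \<open>Symmetry of \<open>yt_2\<^sup>T \<P> yt_2\<close> forces
    \<open>Qt Q2 + S' = I\<close>, \<open>Qt Q3 + Ua = I\<close> and \<open>Q3 + Ub' = Q2\<close>,
    which is where this matrix and the next two come from.\<close>
  define S' where "S' = 1\<^sub>m r - Qt * Q2"
  have S': "S' \<in> carrier_mat r r" by (rule carrier_matI) (simp_all add: S'_def)
  have actS: "act S' f = f - act Qt (act Q2 f)" if "f \<in> fvecs r" for f
    using that by (simp add: S'_def act_minus_mat act_mult_mat)
  obtain Si where Si: "Si \<in> carrier_mat r r" "S' * Si = 1\<^sub>m r" "Si * S' = 1\<^sub>m r"
  proof (rule act_inj_imp_inverse[OF S'])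
    fix f assume f: "f \<in> fvecs r" "act S' f = 0"
    with S[OF f(1)] show "f = 0" by (simp add: actS defs)
  qed blast
  define Ua where "Ua = 1\<^sub>m r - Qt * Q3"
  have Ua: "Ua \<in> carrier_mat r r" by (rule carrier_matI) (simp_all add: Ua_def)
  have actUa: "act Ua f = f - act Qt (act Q3 f)" if "f \<in> fvecs r" for f
    using that by (simp add: Ua_def act_minus_mat act_mult_mat)
  define Ub' where "Ub' = Q2 - Q3"
  have Ub': "Ub' \<in> carrier_mat r r" by (rule carrier_matI) (simp_all add: Ub'_def)
  have actUb: "act Ub' f = act Q2 f - act Q3 f" for f
    by (simp add: Ub'_def act_minus_mat)
  obtain Ubi where Ubi: "Ubi \<in> carrier_mat r r" "Ub' * Ubi = 1\<^sub>m r" "Ubi * Ub' = 1\<^sub>m r"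
  proof (rule act_inj_imp_inverse[OF Ub'])
    fix f assume f: "f \<in> fvecs r" "act Ub' f = 0"
    with Ub[OF f(1)] show "f = 0" by (simp add: actUb defs)
  qed blast
  have inv: "act A\<^sup>T (act B\<^sup>T f) = f"
    if "f \<in> fvecs l" "A \<in> carrier_mat l l" "B \<in> carrier_mat l l" "B * A = 1\<^sub>m l" for A B :: "real mat" and f l
  proof -
    have "A\<^sup>T * B\<^sup>T = 1\<^sub>m l" using that by (metis transpose_mult transpose_one)
    then show ?thesis using that act_mult_mat[of "A\<^sup>T" "B\<^sup>T" f] by simp
  qed
  have invU: "act U\<^sup>T (act Ui\<^sup>T f) = f" if "f \<in> fvecs n" for f using inv[OF that U Ui(1,3)] .
  have invS: "act S'\<^sup>T (act Si\<^sup>T f) = f" if "f \<in> fvecs r" for f using inv[OF that S' Si(1,3)] .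
  have invUb: "act Ub'\<^sup>T (act Ubi\<^sup>T f) = f" if "f \<in> fvecs r" for f using inv[OF that Ub' Ubi(1,3)] .
  note [simp] = carrier_matD[OF U] carrier_matD[OF Ui(1)] carrier_matD[OF S'] carrier_matD[OF Si(1)]
    carrier_matD[OF Ua] carrier_matD[OF Ub'] carrier_matD[OF Ubi(1)]

  \<comment> \<open>\<open>linked\<close> is now solved for the controller: with the present
    \<open>T\<close>, \<open>Va\<close>, \<open>Vb\<close>, \<open>W\<close>, each remaining
    equation has a single unknown once \<open>h1\<close>, \<open>h3\<close>, \<open>f21\<close>,
    \<open>f22\<close> are available.\<close>
  define h1 where "h1 = Ui\<^sup>T * L1 V"
  define h3 where "h3 = Ubi\<^sup>T * L3 V"
  define f21 where "f21 = Si\<^sup>T * (K21 V - Q2 * (pl_A G 2 1 * Y + pl_B G 2 * M1 V))"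
  define f22 where "f22 = Si\<^sup>T * (K22 V - Q2 * (pl_A G 2 2 * Qt + pl_B G 2 * M2 V))"
  note [simp] = h1_def[THEN arg_cong[of _ _ dim_row], simplified] h1_def[THEN arg_cong[of _ _ dim_col], simplified]
    h3_def[THEN arg_cong[of _ _ dim_row], simplified] h3_def[THEN arg_cong[of _ _ dim_col], simplified]
    f21_def[THEN arg_cong[of _ _ dim_row], simplified] f21_def[THEN arg_cong[of _ _ dim_col], simplified]
    f22_def[THEN arg_cong[of _ _ dim_row], simplified] f22_def[THEN arg_cong[of _ _ dim_col], simplified]
  define C where "C = \<lparr>
    F11 = Ui\<^sup>T * (K11 V - X * (pl_A G 1 1 * Y + pl_B G 1 * M1 V)) - h1 * (pl_C G 1 * Y),
    F12 = Ui\<^sup>T * (K12 V - X * (pl_A G 1 2 * Qt + pl_B G 1 * M2 V)) - h1 * (pl_C G 2 * Qt),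
    F13 = Ui\<^sup>T * (K13 V - X * pl_A G 1 2) - h1 * pl_C G 2,
    F21 = f21, F22 = f22,
    F31 = Ubi\<^sup>T * (K31 V - Q3 * (pl_A G 2 1 * Y + pl_B G 2 * M1 V) - Ua\<^sup>T * f21) - h3 * (pl_C G 1 * Y),
    F32 = Ubi\<^sup>T * (K32 V - Q3 * (pl_A G 2 2 * Qt + pl_B G 2 * M2 V) - Ua\<^sup>T * f22) - h3 * (pl_C G 2 * Qt),
    F33 = Ubi\<^sup>T * (K33 V - Q3 * pl_A G 2 2) - h3 * pl_C G 2,
    H1 = h1, H3 = h3, J1 = M1 V, J2 = M2 V\<rparr>"
  have C: "ctrl_dims n r r m k C"
    unfolding ctrl_dims_def C_def ctrl.simps by (intro conjI carrier_matI) simp_all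
  have linked: "linked C V (1\<^sub>m n) U (1\<^sub>m r) (0\<^sub>m r r) (1\<^sub>m r) S' Ua Ub'"
    unfolding linked_def C_def ctrl.simps defs[symmetric]
    by (intro conjI allI)
      (simp_all add: act_minus_mat act_plus_mat act_mult_mat act_one_mat act_initial invU invS invUb
        h1_def h3_def f21_def f22_def)
  \<comment> \<open>This is \<open>[I X; 0 U]\<close> times the inverse of \<open>yt_1\<close>,
    which sends \<open>(g, s)\<close> to \<open>(s, g - Y s)\<close>.\<close>
  define \<X> where "\<X> = four_block_mat X (1\<^sub>m n - X * Y) (1\<^sub>m n - Y * X) (Y * X * Y - Y)"
  have cX: "\<X> \<in> carrier_mat (n + n) (n + n)" by (rule carrier_matI) (simp_all add: \<X>_def)
  have actX: "act \<X> (cat n (act Y s + x) s) = cat n (s + act X x) (act U x)"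
    if "s \<in> fvecs n" "x \<in> fvecs n" for s x
    using that by (simp add: \<X>_def act_four_block_mat act_cat act_minus_mat act_mult_mat actU add.commute)
  \<comment> \<open>Every vector is a substituted one, so symmetry and positivity can be checked
    where \<open>\<X>\<close> is explicit.\<close>
  have decX: "\<exists>s\<in>fvecs n. \<exists>x\<in>fvecs n. f = cat n (act Y s + x) s" if f: "f \<in> fvecs (n + n)" for f
  proof -
    obtain g s where "g \<in> fvecs n" "s \<in> fvecs n" "f = cat n g s" using f by (rule cat_exhaust)
    then show ?thesis by (intro bexI[of _ s] bexI[of _ "g - act Y s"]) (auto intro!: fvecs_diff)
  qed
  have symX: "\<X> \<in> sym_mats (n + n)"
  proof (rule sym_matsI[OF cX])
    fix f g assume "f \<in> fvecs (n + n)" "g \<in> fvecs (n + n)"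
    then obtain s x s' x' where *: "s \<in> fvecs n" "x \<in> fvecs n" "s' \<in> fvecs n" "x' \<in> fvecs n"
      "f = cat n (act Y s + x) s" "g = cat n (act Y s' + x') s'"
      using decX by meson
    show "dot (n + n) f (act \<X> g) = dot (n + n) (act \<X> f) g"
      unfolding *(5,6) actX[OF *(1,2)] actX[OF *(3,4)] dot_cat
      using *(1-4) by (simp add: actU sy)
  qed
  have posX: "pos_def \<X>"
    unfolding pos_def_iff[OF symX]
  proof (intro ballI impI)
    fix f assume "f \<in> fvecs (n + n)" "f \<noteq> 0"
    then obtain s x where *: "s \<in> fvecs n" "x \<in> fvecs n" "f = cat n (act Y s + x) s"
      using decX by meson
    with \<open>f \<noteq> 0\<close> have "s \<noteq> 0 \<or> x \<noteq> 0" by auto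
    from Xpos[OF *(1,2) this] show "0 < dot (n + n) f (act \<X> f)"
      unfolding *(3) actX[OF *(1,2)] dot_cat
      using *(1,2) by (simp add: actU sy)
  qed

  \<comment> \<open>Obtained like \<open>\<X>\<close>, by inserting
    \<open>p3 = w - Qt p1 - p2\<close> into the prescribed image
    \<open>(p1 + Q2 p2 + Q3 p3, S' p2 + Ua p3, Ub' p3)\<close>.\<close>
  define \<P> where "\<P> = four_block_mat Q3 ((1\<^sub>m r - Q3 * Qt) @\<^sub>c (Q2 - Q3)) ((1\<^sub>m r - Qt * Q3) @\<^sub>r (Q2 - Q3))
    (four_block_mat (Qt * Q3 * Qt - Qt) (- (Qt * (Q2 - Q3))) (- ((Q2 - Q3) * Qt)) (Q3 - Q2))"
  have cP: "\<P> \<in> carrier_mat (r + (r + r)) (r + (r + r))" by (rule carrier_matI) (simp_all add: \<P>_def)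
  have actP: "act \<P> (cat r (act Qt p1 + p2 + p3) (cat r p1 p2))
      = cat r (p1 + act Q2 p2 + act Q3 p3) (cat r (act S' p2 + act Ua p3) (act Ub' p3))"
    if "p1 \<in> fvecs r" "p2 \<in> fvecs r" "p3 \<in> fvecs r" for p1 p2 p3
    using that
    by (simp add: \<P>_def act_four_block_mat act_append_cols act_append_rows act_cat act_minus_mat act_mult_mat
        actS actUa actUb cat_add, simp add: algebra_simps)
  have decP: "\<exists>p1\<in>fvecs r. \<exists>p2\<in>fvecs r. \<exists>p3\<in>fvecs r. f = cat r (act Qt p1 + p2 + p3) (cat r p1 p2)"
    if f: "f \<in> fvecs (r + (r + r))" for f
  proof -
    obtain w h where 1: "w \<in> fvecs r" "h \<in> fvecs (r + r)" "f = cat r w h" using f by (rule cat_exhaust)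
    obtain p1 p2 where 2: "p1 \<in> fvecs r" "p2 \<in> fvecs r" "h = cat r p1 p2" using 1(2) by (rule cat_exhaust)
    show ?thesis using 1 2
      by (intro bexI[of _ p1] bexI[of _ p2] bexI[of _ "w - (act Qt p1 + p2)"])
        (auto intro!: fvecs_diff fvecs_add)
  qed
  have symP: "\<P> \<in> sym_mats (r + (r + r))"
  proof (rule sym_matsI[OF cP])
    fix f g assume "f \<in> fvecs (r + (r + r))" "g \<in> fvecs (r + (r + r))"
    then obtain p1 p2 p3 p1' p2' p3' where *: "p1 \<in> fvecs r" "p2 \<in> fvecs r" "p3 \<in> fvecs r"
      "p1' \<in> fvecs r" "p2' \<in> fvecs r" "p3' \<in> fvecs r"
      "f = cat r (act Qt p1 + p2 + p3) (cat r p1 p2)" "g = cat r (act Qt p1' + p2' + p3') (cat r p1' p2')"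
      using decP by meson
    show "dot (r + (r + r)) f (act \<P> g) = dot (r + (r + r)) (act \<P> f) g"
      unfolding *(7,8) actP[OF *(1-3)] actP[OF *(4-6)] dot_cat
      using *(1-6) by (simp add: actS actUa actUb sy)
  qed

  \<comment> \<open>\<open>D11\<close> cancels the cross terms of \<open>p2\<close> with
    \<open>p1\<close>, \<open>D22\<close> those of \<open>p3\<close> with \<open>p2\<close>, and
    \<open>D21\<close>, which needs \<open>D11\<close>, those of \<open>p3\<close> with
    \<open>p1\<close>. Each equation is solved by inverting the transpose of \<open>S'\<close> or
    \<open>Ub'\<close>.\<close>
  define D11 where "D11 W = - (Si\<^sup>T * ((Dl W)\<^sup>T + Q2 * Dl W * Qt))" for W
  define D22 where "D22 W = - (Ubi\<^sup>T * ((Dl W)\<^sup>T * Q2 + Q3 * Dl W))" for W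
  define D21 where "D21 W = - (Ubi\<^sup>T * ((Dl W)\<^sup>T + Q3 * Dl W * Qt + Ua\<^sup>T * D11 W))" for W
  define Dc where "Dc W = four_block_mat (D11 W) (0\<^sub>m r r) (D21 W) (D22 W)" for W
  have cD: "\<forall>W\<in>VV. D11 W \<in> carrier_mat r r \<and> D21 W \<in> carrier_mat r r \<and> D22 W \<in> carrier_mat r r
      \<and> Dc W = four_block_mat (D11 W) (0\<^sub>m r r) (D21 W) (D22 W)"
    by (intro ballI conjI carrier_matI) (use Dl[THEN bspec, THEN carrier_matD(1)] Dl[THEN bspec, THEN carrier_matD(2)] in \<open>simp_all add: D11_def D21_def D22_def Dc_def\<close>)
  have sched: "structured_scheduling VV r r Dc"
    unfolding structured_scheduling_def using cD by blast
  have scal: "\<P> \<in> scalings VV (r + (r + r)) (\<lambda>V. diag_block_mat [Dl V, Dc V])"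
    unfolding loop_scalings_iff[where D = Dl, OF Dl cD]
  proof (intro conjI symP ballI impI)
    fix W w p1 p2
    assume W: "W \<in> VV" and w: "w \<in> fvecs r" and p: "p1 \<in> fvecs r" "p2 \<in> fvecs r"
      and nz: "w \<noteq> 0 \<or> p1 \<noteq> 0 \<or> p2 \<noteq> 0"
    define p3 where "p3 = w - (act Qt p1 + p2)"
    have p3: "p3 \<in> fvecs r" using w p by (auto simp: p3_def intro!: fvecs_diff fvecs_add)
    have w_eq: "w = act Qt p1 + p2 + p3" by (simp add: p3_def)
    note [simp] = carrier_matD[OF Dl[rule_format, OF W]]
    have nz': "p1 \<noteq> 0 \<or> p2 \<noteq> 0 \<or> p3 \<noteq> 0" using nz w_eq by auto
    have tr: "dot r (act A f) g = dot r f (act A\<^sup>T g)" if "A \<in> carrier_mat r r" for A f g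
      using dot_act_left[of A r f g] that by simp
    have d11: "act S'\<^sup>T (act (D11 W) f) = - (act (Dl W)\<^sup>T f + act Q2 (act (Dl W) (act Qt f)))" for f
      by (simp add: D11_def act_plus_mat act_mult_mat invS)
    have d22: "act Ub'\<^sup>T (act (D22 W) f) = - (act (Dl W)\<^sup>T (act Q2 f) + act Q3 (act (Dl W) f))" for f
      by (simp add: D22_def act_plus_mat act_mult_mat invUb)
    have [simp]: "dim_row (D11 W) = r" "dim_col (D11 W) = r" using cD W by auto
    have d21: "act Ub'\<^sup>T (act (D21 W) f) = - (act (Dl W)\<^sup>T f + act Q3 (act (Dl W) (act Qt f))
        + act Ua\<^sup>T (act (D11 W) f))" for f
      by (simp add: D21_def act_plus_mat act_mult_mat invUb)
    have q1: "0 < dot r p1 (act (Dl W) (act Qt p1))" if "p1 \<noteq> 0"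
      using adm W p that unfolding admissible_def dual_scalings_iff[where D = Dl, OF Dl] defs by blast
    have q2: "0 < dot r (act Q2 p2) (act (Dl W) p2)" if "p2 \<noteq> 0"
      using adm W p that unfolding admissible_def scalings_iff[where D = Dl, OF Dl] defs by blast
    have q3: "0 < dot r (act Q3 p3) (act (Dl W) p3)" if "p3 \<noteq> 0"
      using adm W p3 that unfolding admissible_def scalings_iff[where D = Dl, OF Dl] defs by blast
    have dl: "dot r f (act (Dl W)\<^sup>T g) = dot r g (act (Dl W) f)" for f g
      using tr[OF Dl[rule_format, OF W], of f g] by (simp add: dot_commute)
    have "dot (r + (r + r)) (act \<P> (cat r w (cat r p1 p2)))
        (cat r (act (Dl W) w) (cat r (act (D11 W) p1) (act (D21 W) p1 + act (D22 W) p2)))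
      = dot r p1 (act (Dl W) (act Qt p1)) + dot r (act Q2 p2) (act (Dl W) p2) + dot r (act Q3 p3) (act (Dl W) p3)"
      unfolding w_eq actP[OF p p3] dot_cat
      by (simp add: tr[OF S'] tr[OF Ua] tr[OF Ub'] d11 d21 d22 dl sy)
    also have "\<dots> > 0" using q1 q2 q3 nz'
      by (cases "p1 = 0"; cases "p2 = 0"; cases "p3 = 0") (auto intro: add_pos_pos)
    finally show "0 < dot (r + (r + r)) (act \<P> (cat r w (cat r p1 p2)))
        (cat r (act (Dl W) w) (cat r (act (D11 W) p1) (act (D21 W) p1 + act (D22 W) p2)))" .
  qed

  let ?K = "ctrl_lfr r r m k C"
  have KK: "lfr_eq ?K ?K" by (simp add: lfr_eq_def)
  note link = linked V U S' Ua Ub'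
  have lX: "\<forall>s\<in>fvecs n. \<forall>x\<in>fvecs n.
      act \<X> (cat n (top_x V s x) (act (1\<^sub>m n) s)) = cat n (s + act (vX V) x) (act U x)"
    using actX by (simp add: top_x_def defs)
  have lP: "\<forall>p1\<in>fvecs r. \<forall>p2\<in>fvecs r. \<forall>p3\<in>fvecs r.
      act \<P> (cat r (top_w V p1 p2 p3) (cat r (act (1\<^sub>m r) p1) (act (0\<^sub>m r r) p1 + act (1\<^sub>m r) p2)))
      = cat r (p1 + act (vQ2 V) p2 + act (vQ3 V) p3) (cat r (act S' p2 + act Ua p3) (act Ub' p3))"
    using actP by (simp add: top_w_def defs)
  have "neg_def (LL (offdiag \<X>) (offdiag \<P>) (P_gamma q p \<gamma>) (closed_loop G ?K))"
    unfolding neg_def_closed_loop_iff[OF C KK symX symP Zi(1)]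
  proof (intro ballI impI)
    fix xh s w p1 p2 d
    assume v: "xh \<in> fvecs n" "s \<in> fvecs n" "w \<in> fvecs r" "p1 \<in> fvecs r" "p2 \<in> fvecs r" "d \<in> fvecs q"
      and nz: "xh \<noteq> 0 \<or> s \<noteq> 0 \<or> w \<noteq> 0 \<or> p1 \<noteq> 0 \<or> p2 \<noteq> 0 \<or> d \<noteq> 0"
    \<comment> \<open>The substitution is inverted, so that the transformed inequality can be
      evaluated at the preimage of an arbitrary closed-loop vector.\<close>
    define x where "x = xh - act Y s"
    define p3 where "p3 = w - (act Qt p1 + p2)"
    have x: "x \<in> fvecs n" using v by (auto simp: x_def intro!: fvecs_diff)
    have p3: "p3 \<in> fvecs r" using v by (auto simp: p3_def intro!: fvecs_diff fvecs_add)
    have xh: "top_x V s x = xh" "top_w V p1 p2 p3 = w"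
      by (simp_all add: x_def p3_def top_x_def top_w_def defs)
    have "s \<noteq> 0 \<or> x \<noteq> 0 \<or> p1 \<noteq> 0 \<or> p2 \<noteq> 0 \<or> p3 \<noteq> 0 \<or> d \<noteq> 0"
      using nz by (auto simp: x_def p3_def)
    from neg[OF v(2) x v(4,5) p3 v(6) this]
    show "2 * dot (n + n) (act \<X> (cat n xh s)) (cat n (sig_x xh w d (ctl_u C s p1)) (ctl_x C xh s w p1 p2 d))
      + 2 * dot (r + (r + r)) (act \<P> (cat r w (cat r p1 p2)))
          (cat r (sig_z xh w d (ctl_u C s p1)) (cat r (ctl_a C s p1) (ctl_b C xh s w p1 p2 d)))
      - \<gamma> * dot q d d < 0"
      using v x p3 by (simp add: form_linked[OF link lX lP] xh del: dot_add_left dot_add_right)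
  qed
  moreover have "neg_def (LL_sub (neg_corner \<X>) (offdiag \<P>) (P_Z q Z) (closed_loop G ?K))"
    unfolding neg_def_closed_loop_sub_iff[OF C KK symX symP Zi(1)]
  proof (intro ballI impI)
    fix xh s w p1 p2
    assume v: "xh \<in> fvecs n" "s \<in> fvecs n" "w \<in> fvecs r" "p1 \<in> fvecs r" "p2 \<in> fvecs r"
      and nz: "xh \<noteq> 0 \<or> s \<noteq> 0 \<or> w \<noteq> 0 \<or> p1 \<noteq> 0 \<or> p2 \<noteq> 0"
    define x where "x = xh - act Y s"
    define p3 where "p3 = w - (act Qt p1 + p2)"
    have x: "x \<in> fvecs n" using v by (auto simp: x_def intro!: fvecs_diff)
    have p3: "p3 \<in> fvecs r" using v by (auto simp: p3_def intro!: fvecs_diff fvecs_add)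
    have xh: "top_x V s x = xh" "top_w V p1 p2 p3 = w"
      by (simp_all add: x_def p3_def top_x_def top_w_def defs)
    have TU: "dot n (act (vY V) s) (act (vX V) x) + dot n (act (1\<^sub>m n) s) (act U x) = dot n s x"
      using x v by (simp add: actU defs[symmetric] sy)
    have "s \<noteq> 0 \<or> x \<noteq> 0 \<or> p1 \<noteq> 0 \<or> p2 \<noteq> 0 \<or> p3 \<noteq> 0"
      using nz by (auto simp: x_def p3_def)
    from neg_sub[OF v(2) x v(4,5) p3 this]
    show "- dot (n + n) (cat n xh s) (act \<X> (cat n xh s))
      + 2 * dot (r + (r + r)) (act \<P> (cat r w (cat r p1 p2)))
          (cat r (sig_z xh w 0 (ctl_u C s p1)) (cat r (ctl_a C s p1) (ctl_b C xh s w p1 p2 0)))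
      + dot p (sig_p xh w (ctl_u C s p1)) (act (the (mat_inverse Z)) (sig_p xh w (ctl_u C s p1))) < 0"
      using v x p3 by (simp add: form_sub_linked[OF link lX lP _ _ _ _ _ TU] xh del: dot_add_left dot_add_right)
  qed
  ultimately show ?thesis
    unfolding synthesizable_def
    using structured_controller_ctrl_lfr[OF C] sched symX posX scal Z by blast
qed

end

end

lemma split_blocksE:
  assumes "A \<in> carrier_mat (n1 + n2) (m1 + m2)"
  obtains A1 A2 A3 A4 where "A1 \<in> carrier_mat n1 m1" "A2 \<in> carrier_mat n1 m2"
    "A3 \<in> carrier_mat n2 m1" "A4 \<in> carrier_mat n2 m2" "A = four_block_mat A1 A2 A3 A4"
proof -
  obtain A1 A2 A3 A4 where "split_block A n1 m1 = (A1, A2, A3, A4)" by (metis prod_cases4)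
  from split_block[OF this, of n2 m2] assms that show ?thesis by auto
qed

section \<open>Scaling \<open>Q2\<close> and perturbing the transformed variables\<close>

context lifted_loop
begin

definition scale_Q2 :: "real \<Rightarrow> vars \<Rightarrow> vars" where
  "scale_Q2 e V = V\<lparr>vQ2 := (1 + e) \<cdot>\<^sub>m vQ2 V\<rparr>"

text \<open>\<open>Q2\<close> enters linearly, also through the block
  \<open>Q\<^sub>2\<^sup>T A\<^sub>2\<^sub>2\<close>, so the form at \<open>e\<close> lies on the
  line through those at 0 and 1.\<close>

lemma form_scale_Q2:
  "form \<gamma> (scale_Q2 e V) s x p1 p2 p3 d
    = (1 - e) * form \<gamma> V s x p1 p2 p3 d + e * form \<gamma> (scale_Q2 1 V) s x p1 p2 p3 d"
  by (simp add: form_def scale_Q2_def top_x_def top_w_def top_u_def low_x_def low_a_def low_b_def algebra_simps)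

lemma form_sub_scale_Q2:
  "form_sub Z (scale_Q2 e V) s x p1 p2 p3
    = (1 - e) * form_sub Z V s x p1 p2 p3 + e * form_sub Z (scale_Q2 1 V) s x p1 p2 p3"
  by (simp add: form_sub_def scale_Q2_def top_x_def top_w_def top_u_def low_x_def low_a_def low_b_def algebra_simps)

lemma smult_sym_mats: "M \<in> sym_mats l \<Longrightarrow> c \<cdot>\<^sub>m M \<in> sym_mats l"
  by (rule sym_matsI) (auto simp: sym_matsD)

lemma vars_dims_scale_Q2: "vars_dims n r m k V \<Longrightarrow> vars_dims n r m k (scale_Q2 e V)"
  by (simp add: vars_dims_def scale_Q2_def smult_sym_mats)

text \<open>
  On vectors mapped to zero by both substitutions, \<open>x = - Y s\<close> and \<open>p3 = - Qt p1 - p2\<close>, so that the terms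
  added with factor \<open>2 e\<close> reduce to \<open>- s \<bullet> Y s - |Qt p1|\<^sup>2 - |p2|\<^sup>2\<close>. This dictates the multiples of \<open>Qt\<close>.
\<close>

definition perturb :: "real \<Rightarrow> vars \<Rightarrow> vars" where
  "perturb e V = V\<lparr>vX := vX V + e \<cdot>\<^sub>m 1\<^sub>m n,
     K11 := K11 V + e \<cdot>\<^sub>m (pl_A G 1 1 * vY V + pl_B G 1 * M1 V + 1\<^sub>m n),
     K12 := K12 V + e \<cdot>\<^sub>m (pl_A G 1 2 * vQt V + pl_B G 1 * M2 V),
     K13 := K13 V + e \<cdot>\<^sub>m pl_A G 1 2,
     K22 := K22 V + (2 * e) \<cdot>\<^sub>m vQt V,
     K32 := K32 V + e \<cdot>\<^sub>m vQt V,
     K33 := K33 V + e \<cdot>\<^sub>m 1\<^sub>m r\<rparr>"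

context
  fixes V assumes V: "vars_dims n r m k V"
begin

lemma vars_dims_perturb: "vars_dims n r m k (perturb e V)"
proof -
  have "vX V + e \<cdot>\<^sub>m 1\<^sub>m n \<in> sym_mats n"
    using V_dim(1)[OF V] by (auto simp: sym_mats_def transpose_add[of _ n n])
  moreover have "K11 V + e \<cdot>\<^sub>m (pl_A G 1 1 * vY V + pl_B G 1 * M1 V + 1\<^sub>m n) \<in> carrier_mat n n"
    "K12 V + e \<cdot>\<^sub>m (pl_A G 1 2 * vQt V + pl_B G 1 * M2 V) \<in> carrier_mat n r"
    "K13 V + e \<cdot>\<^sub>m pl_A G 1 2 \<in> carrier_mat n r" "K22 V + (2 * e) \<cdot>\<^sub>m vQt V \<in> carrier_mat r r"
    "K32 V + e \<cdot>\<^sub>m vQt V \<in> carrier_mat r r" "K33 V + e \<cdot>\<^sub>m 1\<^sub>m r \<in> carrier_mat r r"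
    by (rule carrier_matI; simp add: V_dims[OF V] plant_dim)+
  ultimately show ?thesis
    using V by (simp add: vars_dims_def perturb_def)
qed

text \<open>The multiples added to \<open>K11\<close>, \<open>K12\<close>, \<open>K13\<close>
  complete the change of \<open>X_1\<close> to the full state derivative of the substituted signals,
  which vanishes with them; the identity added to \<open>K11\<close> leaves the term with
  \<open>s\<close>.\<close>

lemma form_perturb_eq:
  "form \<gamma> (perturb e V) s x p1 p2 p3 d = form \<gamma> V s x p1 p2 p3 d
    + 2 * e * (dot n x (sig_x (top_x V s x) (top_w V p1 p2 p3) d (top_u V s p1)) + dot n x s
        + 2 * dot r p2 (act (vQt V) p1) + dot r p3 (act (vQt V) p1 + p2))"
  by (simp add: form_def perturb_def top_x_def top_w_def top_u_def low_x_def low_a_def low_b_def sig_x_def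
      act_plus_mat act_mult_mat act_one_mat V_dims[OF V] plant_dim algebra_simps)

text \<open>Increasing \<open>X_1\<close> strengthens the Lyapunov term by the square of
  \<open>x\<close>; the uncertainty terms change as in \<open>form\<close>.\<close>

lemma form_sub_perturb_eq:
  "form_sub Z (perturb e V) s x p1 p2 p3 = form_sub Z V s x p1 p2 p3
    + e * (- dot n x x + 4 * dot r p2 (act (vQt V) p1) + 2 * dot r p3 (act (vQt V) p1 + p2))"
  by (simp add: form_sub_def perturb_def top_x_def top_w_def top_u_def low_a_def low_b_def
      act_plus_mat act_mult_mat act_one_mat V_dims[OF V] plant_dim algebra_simps)

end

context
  fixes VV :: "real mat set" and Dl :: "real mat \<Rightarrow> real mat"
  assumes Dl: "\<forall>V\<in>VV. Dl V \<in> carrier_mat r r" and VV: "VV \<noteq> {}"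
begin

lemma synthesizable_if_admissible:
  assumes adm: "admissible VV Dl \<gamma> Z V"
  shows "synthesizable VV Dl \<gamma>"
proof -
  have V: "vars_dims n r m k V" and Z: "Z \<in> sym_mats p" "pos_def Z" "tr Z < 1"
    using adm by (simp_all add: admissible_def)
  note Zi = the_mat_inverse_pos_def[OF Z(1,2)]
  note [simp] = V_dims[OF V]
  have neg: "form \<gamma> V s x p1 p2 p3 d < 0"
    if "s \<in> fvecs n" "x \<in> fvecs n" "p1 \<in> fvecs r" "p2 \<in> fvecs r" "p3 \<in> fvecs r" "d \<in> fvecs q"
      "s \<noteq> 0 \<or> x \<noteq> 0 \<or> p1 \<noteq> 0 \<or> p2 \<noteq> 0 \<or> p3 \<noteq> 0 \<or> d \<noteq> 0" for s x p1 p2 p3 d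
    using adm that unfolding admissible_def neg_def_loop_iff[OF V Zi(1)] by blast
  have neg_sub: "form_sub Z V s x p1 p2 p3 < 0"
    if "s \<in> fvecs n" "x \<in> fvecs n" "p1 \<in> fvecs r" "p2 \<in> fvecs r" "p3 \<in> fvecs r"
      "s \<noteq> 0 \<or> x \<noteq> 0 \<or> p1 \<noteq> 0 \<or> p2 \<noteq> 0 \<or> p3 \<noteq> 0" for s x p1 p2 p3
    using adm that unfolding admissible_def neg_def_loop_iff[OF V Zi(1)] by blast
  \<comment> \<open>The forms of \<open>V\<close> are already negative, so the first alternative of
    \<open>form_perturb\<close> holds throughout; \<open>scale_Q2 1 V\<close> only fixes the
    direction of the change.\<close>
  obtain e0 where e0: "0 < e0"
    "\<And>e. 0 < e \<Longrightarrow> e < e0 \<Longrightarrow>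
      neg_def (LL (offdiag (1\<^sub>m (n + n))) (offdiag (1\<^sub>m (r + (r + r)))) (P_gamma q p \<gamma>) (loop (scale_Q2 e V))) \<and>
      neg_def (LL_sub (neg_corner (Xmat (scale_Q2 e V))) (offdiag (1\<^sub>m (r + (r + r)))) (P_Z q Z) (loop (scale_Q2 e V)))"
  proof (rule form_perturb[OF V vars_dims_scale_Q2[OF V] Zi(1), of \<gamma> 1])
    fix e0 assume *: "0 < e0" "\<And>e V'. 0 < e \<Longrightarrow> e < e0 \<Longrightarrow> vars_dims n r m k V' \<Longrightarrow>
      (\<And>s x p1 p2 p3 d. form \<gamma> V' s x p1 p2 p3 d
          = (1 - e) * form \<gamma> V s x p1 p2 p3 d + e * form \<gamma> (scale_Q2 1 V) s x p1 p2 p3 d) \<Longrightarrow>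
      (\<And>s x p1 p2 p3. form_sub Z V' s x p1 p2 p3
          = (1 - e) * form_sub Z V s x p1 p2 p3 + e * form_sub Z (scale_Q2 1 V) s x p1 p2 p3) \<Longrightarrow>
      neg_def (LL (offdiag (1\<^sub>m (n + n))) (offdiag (1\<^sub>m (r + (r + r)))) (P_gamma q p \<gamma>) (loop V')) \<and>
      neg_def (LL_sub (neg_corner (Xmat V')) (offdiag (1\<^sub>m (r + (r + r)))) (P_Z q Z) (loop V'))"
    show thesis
      by (rule that[OF *(1)], rule *(2))
        (assumption | rule vars_dims_scale_Q2[OF V] form_scale_Q2 form_sub_scale_Q2)+
  qed ((rule disjI1, rule neg, assumption+) | (rule disjI1, rule neg_sub, assumption+))+
  obtain W where W: "W \<in> VV" using VV by blast
  have Q2pos: "0 < dot r (act (vQ2 V) f) (act (Dl U) f)" if "U \<in> VV" "f \<in> fvecs r" "f \<noteq> 0" for f U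
    using adm that unfolding admissible_def scalings_iff[where D = Dl, OF Dl] by blast
  have cQ: "vQ2 V \<in> carrier_mat r r" "vQ3 V \<in> carrier_mat r r" "vQt V \<in> carrier_mat r r"
    using V_dim(3-5)[OF V] by (auto simp: sym_mats_def)
  obtain Q2i where Q2i: "Q2i \<in> carrier_mat r r" "vQ2 V * Q2i = 1\<^sub>m r" "Q2i * vQ2 V = 1\<^sub>m r"
    by (rule act_inj_imp_inverse[OF cQ(1)]) (use Q2pos[OF W] in force)
  \<comment> \<open>The first regularity condition fails when \<open>1 / (1 + e)\<close> is an
    eigenvalue of \<open>Qt Q2\<close>, the second when \<open>1 + e\<close> is one of the inverse
    of \<open>Q2\<close> times \<open>Q3\<close>. Solving for \<open>e\<close> gives the two images
    below; an eigenvalue 0 in the first contributes -1 by \<open>1 / 0 = 0\<close>, outside the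
    interval.\<close>
  let ?E1 = "{c. \<exists>f \<in> fvecs r. f \<noteq> 0 \<and> act (vQt V * vQ2 V) f = scl c f}"
  let ?E2 = "{c. \<exists>f \<in> fvecs r. f \<noteq> 0 \<and> act (Q2i * vQ3 V) f = scl c f}"
  have "finite ((\<lambda>c. 1 / c - 1) ` ?E1 \<union> (\<lambda>c. c - 1) ` ?E2)"
    using finite_eigenvalues_act[of "vQt V * vQ2 V" r] finite_eigenvalues_act[of "Q2i * vQ3 V" r] cQ Q2i(1) by simp
  from Diff_infinite_finite[OF this infinite_Ioo[OF e0(1)]]
  have "{0<..<e0} - ((\<lambda>c. 1 / c - 1) ` ?E1 \<union> (\<lambda>c. c - 1) ` ?E2) \<noteq> {}" by (metis finite.emptyI)
  then obtain e where "e \<in> {0<..<e0} - ((\<lambda>c. 1 / c - 1) ` ?E1 \<union> (\<lambda>c. c - 1) ` ?E2)" by (meson ex_in_conv)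
  then have e: "0 < e" "e < e0" "e \<notin> (\<lambda>c. 1 / c - 1) ` ?E1" "e \<notin> (\<lambda>c. c - 1) ` ?E2"
    by (simp_all only: Diff_iff Un_iff greaterThanLessThan_iff) blast+
  have "(1 + e) \<cdot>\<^sub>m vQ2 V \<in> scalings VV r Dl"
    unfolding scalings_iff[where D = Dl, OF Dl]
    using Q2pos e(1) smult_sym_mats[OF V_dim(3)[OF V]] by simp
  with adm e0(2)[OF e(1,2)] have adm': "admissible VV Dl \<gamma> Z (scale_Q2 e V)"
    using vars_dims_scale_Q2[OF V] by (simp add: admissible_def) (simp add: scale_Q2_def)
  show ?thesis
  proof (rule synthesizable_if_regular[OF Dl adm'])
    fix f assume f: "f \<in> fvecs r" "act (vQt (scale_Q2 e V)) (act (vQ2 (scale_Q2 e V)) f) = f"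
    then have "scl (1 + e) (act (vQt V * vQ2 V) f) = f"
      by (simp add: scale_Q2_def act_mult_mat)
    then have "act (vQt V * vQ2 V) f = scl (1 / (1 + e)) f"
      using e(1) by (auto simp: scl_def fun_eq_iff field_simps)
    moreover have "e = 1 / (1 / (1 + e)) - 1" using e(1) by simp
    ultimately show "f = 0" using e(3) f(1) by blast
  next
    fix f assume f: "f \<in> fvecs r" "act (vQ2 (scale_Q2 e V)) f = act (vQ3 (scale_Q2 e V)) f"
    then have "act Q2i (act (vQ3 V) f) = scl (1 + e) (act (Q2i * vQ2 V) f)"
      using Q2i(1) by (simp add: scale_Q2_def act_mult_mat flip: act_scl)
    then have "act (Q2i * vQ3 V) f = scl (1 + e) f"
      using Q2i f(1) by (simp add: act_mult_mat)
    moreover have "e = (1 + e) - 1" by simp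
    ultimately show "f = 0" using e(4) f(1) by blast
  qed
qed

section \<open>From a controller to transformed variables\<close>

lemma admissible_if_synthesizable:
  assumes "synthesizable VV Dl \<gamma>"
  obtains Z V where "admissible VV Dl \<gamma> Z V"
proof -
  obtain nc r1 r2 K Dc \<X> \<P> Z where
    K: "structured_controller nc r1 r2 m k K" and Dc: "structured_scheduling VV r1 r2 Dc" and
    symX: "\<X> \<in> sym_mats (n + nc)" and posX: "pos_def \<X>" and
    scal: "\<P> \<in> scalings VV (r + (r1 + r2)) (\<lambda>V. diag_block_mat [Dl V, Dc V])" and
    Z: "Z \<in> sym_mats p" "pos_def Z" "tr Z < 1" and
    lmi_sub: "neg_def (LL_sub (neg_corner \<X>) (offdiag \<P>) (P_Z q Z) (closed_loop G K))" and
    lmi: "neg_def (LL (offdiag \<X>) (offdiag \<P>) (P_gamma q p \<gamma>) (closed_loop G K))"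
    using assms unfolding synthesizable_def by blast
  \<comment> \<open>Vectors padded with a zero block must keep the form \<open>cat n f 0\<close>,
    for which the column rules below are stated.\<close>
  note [simp del] = cat_0_right
  note Zi = the_mat_inverse_pos_def[OF Z(1,2)]
  obtain C where C: "ctrl_dims nc r1 r2 m k C" and KC: "lfr_eq K (ctrl_lfr r1 r2 m k C)"
    using K by (rule structured_controllerE)
  have symP: "\<P> \<in> sym_mats (r + (r1 + r2))" using scal by (simp add: scalings_def)
  note neg = lmi[unfolded neg_def_closed_loop_iff[OF C KC symX symP Zi(1)], rule_format]
  note neg_sub = lmi_sub[unfolded neg_def_closed_loop_sub_iff[OF C KC symX symP Zi(1)], rule_format]
  from Dc obtain D11 D21 D22 where D: "\<forall>V\<in>VV. D11 V \<in> carrier_mat r1 r1 \<and> D21 V \<in> carrier_mat r2 r1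
      \<and> D22 V \<in> carrier_mat r2 r2 \<and> Dc V = four_block_mat (D11 V) (0\<^sub>m r1 r2) (D21 V) (D22 V)"
    unfolding structured_scheduling_def by metis
  have Ppos: "0 < dot (r + (r1 + r2)) (act \<P> (cat r w (cat r1 wa wb)))
        (cat r (act (Dl W) w) (cat r1 (act (D11 W) wa) (act (D21 W) wa + act (D22 W) wb)))"
    if "W \<in> VV" "w \<in> fvecs r" "wa \<in> fvecs r1" "wb \<in> fvecs r2" "w \<noteq> 0 \<or> wa \<noteq> 0 \<or> wb \<noteq> 0" for W w wa wb
    using scal that unfolding loop_scalings_iff[where D = Dl, OF Dl D] by blast
  obtain W0 where W0: "W0 \<in> VV" using VV by blast
  note cX = sym_matsD(3)[OF symX] and cP = sym_matsD(3)[OF symP]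
  note syX = sym_matsD(5)[OF symX] and syP = sym_matsD(5)[OF symP]
  have Xpos: "0 < dot (n + nc) f (act \<X> f)" if "f \<in> fvecs (n + nc)" "f \<noteq> 0" for f
    using posX that unfolding pos_def_iff[OF symX] by blast

  obtain \<X>i where \<X>i: "\<X>i \<in> carrier_mat (n + nc) (n + nc)" "\<X> * \<X>i = 1\<^sub>m (n + nc)"
    by (rule act_inj_imp_inverse[OF cX]) (use Xpos in force)
  obtain X X2 U X4 where X: "X \<in> carrier_mat n n" "X2 \<in> carrier_mat n nc" "U \<in> carrier_mat nc n"
    "X4 \<in> carrier_mat nc nc" "\<X> = four_block_mat X X2 U X4" using cX by (rule split_blocksE)
  obtain Y Y2 T Y4 where Y: "Y \<in> carrier_mat n n" "Y2 \<in> carrier_mat n nc" "T \<in> carrier_mat nc n"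
    "Y4 \<in> carrier_mat nc nc" "\<X>i = four_block_mat Y Y2 T Y4" using \<X>i(1) by (rule split_blocksE)
  note [simp] = X(1-4)[THEN carrier_matD(1)] X(1-4)[THEN carrier_matD(2)]
    Y(1-4)[THEN carrier_matD(1)] Y(1-4)[THEN carrier_matD(2)]
  have actX: "act \<X> (cat n x 0) = cat n (act X x) (act U x)" for x
    by (simp add: X(5) act_four_block_mat act_cat)
  have actY: "act \<X> (cat n (act Y s) (act T s)) = cat n s 0" if "s \<in> fvecs n" for s
  proof -
    have "act \<X>i (cat n s 0) = cat n (act Y s) (act T s)" by (simp add: Y(5) act_four_block_mat act_cat)
    moreover have "act \<X> (act \<X>i (cat n s 0)) = cat n s 0"
      using act_mult_mat[of \<X> \<X>i "cat n s 0"] \<X>i cX that by (simp add: fvecs_cat)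
    ultimately show ?thesis by simp
  qed
  have lX: "act \<X> (cat n (act Y s + x) (act T s)) = cat n (s + act X x) (act U x)" if "s \<in> fvecs n" for s x
  proof -
    have eq: "cat n (act Y s + x) (act T s) = cat n (act Y s) (act T s) + cat n x 0" by (simp add: cat_add)
    show ?thesis
      by (subst eq, simp only: act_add, simp only: actX actY[OF that], simp add: cat_add)
  qed
  have symX1: "X \<in> sym_mats n"
  proof (rule sym_matsI[OF X(1)])
    fix f g assume "f \<in> fvecs n" "g \<in> fvecs n"
    show "dot n f (act X g) = dot n (act X f) g"
      using syX[of "cat n f 0" "cat n g 0"] by (simp add: actX dot_cat)
  qed
  have symY: "Y \<in> sym_mats n"
  proof (rule sym_matsI[OF Y(1)])
    fix f g assume fg: "f \<in> fvecs n" "g \<in> fvecs n"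
    show "dot n f (act Y g) = dot n (act Y f) g"
      using syX[of "cat n (act Y f) (act T f)" "cat n (act Y g) (act T g)"]
      by (simp add: actY fg dot_cat)
  qed
  have TU: "dot n (act Y s) (act X x) + dot nc (act T s) (act U x) = dot n s x" if "s \<in> fvecs n" for s x
    using syX[of "cat n (act Y s) (act T s)" "cat n x 0"] by (simp add: actY that actX dot_cat)
  have Ypos: "0 < dot n (act Y s) s" if "s \<in> fvecs n" "s \<noteq> 0" for s
  proof -
    have "cat n (act Y s) (act T s) \<noteq> 0"
      using actY[OF that(1)] that by (metis act_0 cat_eq_0_iff)
    from Xpos[OF _ this] show ?thesis by (simp add: actY that fvecs_cat dot_cat)
  qed

  \<comment> \<open>\<open>\<P>\<close> has no prescribed sign; it is nonsingular because the
    scaling condition at a single value pairs its image of a nonzero vector strictly positively with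
    another vector.\<close>
  have Pinj: "f = 0" if f: "f \<in> fvecs (r + (r1 + r2))" "act \<P> f = 0" for f
  proof (rule ccontr)
    assume "f \<noteq> 0"
    obtain w h where 1: "w \<in> fvecs r" "h \<in> fvecs (r1 + r2)" "f = cat r w h" using f(1) by (rule cat_exhaust)
    obtain wa wb where 2: "wa \<in> fvecs r1" "wb \<in> fvecs r2" "h = cat r1 wa wb" using 1(2) by (rule cat_exhaust)
    have "w \<noteq> 0 \<or> wa \<noteq> 0 \<or> wb \<noteq> 0" using \<open>f \<noteq> 0\<close> 1(3) 2(3) by auto
    from Ppos[OF W0 1(1) 2(1,2) this] f(2) show False unfolding 1(3) 2(3) by simp
  qed
  obtain \<P>i where \<P>i: "\<P>i \<in> carrier_mat (r + (r1 + r2)) (r + (r1 + r2))" "\<P> * \<P>i = 1\<^sub>m (r + (r1 + r2))"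
    by (rule act_inj_imp_inverse[OF cP]) (use Pinj in auto)
  obtain Q3 R12 R21 R22 where P: "Q3 \<in> carrier_mat r r" "R12 \<in> carrier_mat r (r1 + r2)"
    "R21 \<in> carrier_mat (r1 + r2) r" "R22 \<in> carrier_mat (r1 + r2) (r1 + r2)" "\<P> = four_block_mat Q3 R12 R21 R22"
    using cP by (rule split_blocksE)
  obtain P12 P13 where P12: "P12 \<in> carrier_mat r r1" "P13 \<in> carrier_mat r r2" "R12 = P12 @\<^sub>c P13"
    using P(2) by (rule split_colsE)
  obtain Ua Ub where Uab: "Ua \<in> carrier_mat r1 r" "Ub \<in> carrier_mat r2 r" "R21 = Ua @\<^sub>r Ub"
    using P(3) by (rule split_rowsE)
  obtain P22 P23 P32 P33 where P22: "P22 \<in> carrier_mat r1 r1" "P23 \<in> carrier_mat r1 r2"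
    "P32 \<in> carrier_mat r2 r1" "P33 \<in> carrier_mat r2 r2" "R22 = four_block_mat P22 P23 P32 P33"
    using P(4) by (rule split_blocksE)
  obtain Qt T12 Tab T22 where Pi: "Qt \<in> carrier_mat r r" "T12 \<in> carrier_mat r (r1 + r2)"
    "Tab \<in> carrier_mat (r1 + r2) r" "T22 \<in> carrier_mat (r1 + r2) (r1 + r2)" "\<P>i = four_block_mat Qt T12 Tab T22"
    using \<P>i(1) by (rule split_blocksE)
  obtain Va Vb where Vab: "Va \<in> carrier_mat r1 r" "Vb \<in> carrier_mat r2 r" "Tab = Va @\<^sub>r Vb"
    using Pi(3) by (rule split_rowsE)
  note [simp] = P(1-4)[THEN carrier_matD(1)] P(1-4)[THEN carrier_matD(2)]
    P12(1,2)[THEN carrier_matD(1)] P12(1,2)[THEN carrier_matD(2)]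
    Uab(1,2)[THEN carrier_matD(1)] Uab(1,2)[THEN carrier_matD(2)]
    P22(1-4)[THEN carrier_matD(1)] P22(1-4)[THEN carrier_matD(2)]
    Pi(1-4)[THEN carrier_matD(1)] Pi(1-4)[THEN carrier_matD(2)]
    Vab(1,2)[THEN carrier_matD(1)] Vab(1,2)[THEN carrier_matD(2)]
  have actP: "act \<P> (cat r w (cat r1 0 wb)) = cat r (act Q3 w + act P13 wb)
      (cat r1 (act Ua w + act P23 wb) (act Ub w + act P33 wb))" for w wb
    by (simp add: P(5) P12(3) Uab(3) P22(5) act_four_block_mat act_append_cols act_append_rows act_cat cat_add)
  have actPt: "act \<P> (cat r (act Qt f) (cat r1 (act Va f) (act Vb f))) = cat r f 0" if "f \<in> fvecs r" for f
  proof -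
    have "act \<P>i (cat r f 0) = cat r (act Qt f) (cat r1 (act Va f) (act Vb f))"
      by (simp add: Pi(5) Vab(3) act_four_block_mat act_append_rows act_cat)
    moreover have "act \<P> (act \<P>i (cat r f 0)) = cat r f 0"
      using act_mult_mat[of \<P> \<P>i "cat r f 0"] \<P>i cP that by (simp add: fvecs_cat)
    ultimately show ?thesis by simp
  qed
  \<comment> \<open>On \<open>(0, 0, wb)\<close> the triangular \<open>Dc\<close> returns a last
    block only, so the scaling condition sees \<open>\<P>\<close> through \<open>P33\<close>
    alone.\<close>
  obtain P33i where P33i: "P33i \<in> carrier_mat r2 r2" "P33 * P33i = 1\<^sub>m r2"
  proof (rule act_inj_imp_inverse[OF P22(4)])
    fix f assume f: "f \<in> fvecs r2" "act P33 f = 0"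
    show "f = 0"
    proof (rule ccontr)
      assume "f \<noteq> 0"
      with Ppos[OF W0 fvecs_zero fvecs_zero f(1)]
      show False by (simp add: actP dot_cat f(2))
    qed
  qed blast
  \<comment> \<open>\<open>W\<close> solves \<open>P33 W = - Ub\<close>, so
    \<open>(f, 0, W f)\<close> is mapped to a vector with vanishing last block, and
    \<open>Q2\<close>, \<open>S\<close> are the other two blocks of its image.\<close>
  define W where "W = - (P33i * Ub)"
  define Q2 where "Q2 = Q3 + P13 * W"
  define S where "S = Ua + P23 * W"
  have W: "W \<in> carrier_mat r2 r" and Q2: "Q2 \<in> carrier_mat r r" and S: "S \<in> carrier_mat r1 r"
    using P33i(1) by (auto simp: W_def Q2_def S_def intro!: carrier_matI)
  note [simp] = carrier_matD[OF W] carrier_matD[OF Q2] carrier_matD[OF S] carrier_matD[OF P33i(1)]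
  have P33W: "act P33 (act W f) = - act Ub f" for f
    using act_mult_mat[of P33 P33i "act Ub f"] P33i by (simp add: W_def act_mult_mat)
  have actPW: "act \<P> (cat r f (cat r1 0 (act W f))) = cat r (act Q2 f) (cat r1 (act S f) 0)" for f
    by (simp add: actP P33W Q2_def S_def act_plus_mat act_mult_mat)
  have actP0: "act \<P> (cat r f 0) = cat r (act Q3 f) (cat r1 (act Ua f) (act Ub f))" for f
    using actP[of f 0] by simp
  have lP: "act \<P> (cat r (act Qt p1 + p2 + p3) (cat r1 (act Va p1) (act Vb p1 + act W p2)))
      = cat r (p1 + act Q2 p2 + act Q3 p3) (cat r1 (act S p2 + act Ua p3) (act Ub p3))"
    if "p1 \<in> fvecs r" for p1 p2 p3
  proof -
    have eq: "cat r (act Qt p1 + p2 + p3) (cat r1 (act Va p1) (act Vb p1 + act W p2))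
      = cat r (act Qt p1) (cat r1 (act Va p1) (act Vb p1)) + cat r p2 (cat r1 0 (act W p2)) + cat r p3 (cat r1 0 0)"
      by (simp only: cat_add add_0_left add_0_right)
    have "act \<P> (cat r (act Qt p1 + p2 + p3) (cat r1 (act Va p1) (act Vb p1 + act W p2)))
      = cat r p1 (cat r1 0 0) + cat r (act Q2 p2) (cat r1 (act S p2) 0)
        + cat r (act Q3 p3) (cat r1 (act Ua p3) (act Ub p3))"
      by (subst eq, simp only: act_add cat_zero, simp only: actPt[OF that] actPW actP0)
    also have "\<dots> = cat r (p1 + act Q2 p2 + act Q3 p3) (cat r1 (act S p2 + act Ua p3) (act Ub p3))"
      by (simp only: cat_add add_0_left add_0_right)
    finally show ?thesis .
  qed
  have symQ3: "Q3 \<in> sym_mats r"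
  proof (rule sym_matsI[OF P(1)])
    fix f g assume "f \<in> fvecs r" "g \<in> fvecs r"
    show "dot r f (act Q3 g) = dot r (act Q3 f) g"
      using syP[of "cat r f 0" "cat r g 0"] by (simp add: actP0 dot_cat)
  qed
  \<comment> \<open>Pairing \<open>(f, 0, W f)\<close> with \<open>(Q2 g, S g, 0)\<close> leaves
    only \<open>Q2\<close>, since the zeros are complementary. The scheduling matrix preserves the
    zero in the middle block, so the same happens in \<open>scQ2\<close>.\<close>
  have symQ2: "Q2 \<in> sym_mats r"
  proof (rule sym_matsI[OF Q2])
    fix f g assume "f \<in> fvecs r" "g \<in> fvecs r"
    show "dot r f (act Q2 g) = dot r (act Q2 f) g"
      using syP[of "cat r f (cat r1 0 (act W f))" "cat r g (cat r1 0 (act W g))"]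
      by (simp add: actPW dot_cat)
  qed
  have symQt: "Qt \<in> sym_mats r"
  proof (rule sym_matsI[OF Pi(1)])
    fix f g assume fg: "f \<in> fvecs r" "g \<in> fvecs r"
    show "dot r f (act Qt g) = dot r (act Qt f) g"
      using syP[of "cat r (act Qt f) (cat r1 (act Va f) (act Vb f))" "cat r (act Qt g) (cat r1 (act Va g) (act Vb g))"]
      by (simp add: actPt fg dot_cat)
  qed
  have scQ2: "Q2 \<in> scalings VV r Dl"
    unfolding scalings_iff[where D = Dl, OF Dl]
  proof (intro conjI symQ2 ballI impI)
    fix V f assume "V \<in> VV" "f \<in> fvecs r" "f \<noteq> 0"
    with Ppos[of V f 0 "act W f"] show "0 < dot r (act Q2 f) (act (Dl V) f)"
      by (simp add: actPW dot_cat)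
  qed
  have scQ3: "Q3 \<in> scalings VV r Dl"
    unfolding scalings_iff[where D = Dl, OF Dl]
  proof (intro conjI symQ3 ballI impI)
    fix V f assume "V \<in> VV" "f \<in> fvecs r" "f \<noteq> 0"
    with Ppos[of V f 0 0] show "0 < dot r (act Q3 f) (act (Dl V) f)"
      by (simp add: actP0 dot_cat)
  qed
  have Qtpos: "0 < dot r f (act (Dl V) (act Qt f))" if "V \<in> VV" "f \<in> fvecs r" "f \<noteq> 0" for V f
  proof -
    \<comment> \<open>Strictness needs a nonzero argument: \<open>\<P>\<close> maps the vector with
      these three blocks to \<open>(f, 0, 0)\<close>, which is nonzero.\<close>
    have "act Qt f \<noteq> 0 \<or> act Va f \<noteq> 0 \<or> act Vb f \<noteq> 0"
      using actPt[OF that(2)] that(2,3) by (metis act_0 cat_eq_0_iff cat_zero)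
    with Ppos[of V "act Qt f" "act Va f" "act Vb f"] that show ?thesis
      by (simp add: actPt dot_cat)
  qed
  have scQt: "Qt \<in> scalings VV r (\<lambda>V. (Dl V)\<^sup>T)"
    unfolding dual_scalings_iff[where D = Dl, OF Dl] using symQt Qtpos by blast

  note cC = C[unfolded ctrl_dims_def]
  have [simp]: "dim_row (F11 C) = nc" "dim_col (F11 C) = nc" "dim_row (F12 C) = nc" "dim_col (F12 C) = r1"
    "dim_row (F13 C) = nc" "dim_col (F13 C) = r2" "dim_row (F21 C) = r1" "dim_col (F21 C) = nc"
    "dim_row (F22 C) = r1" "dim_col (F22 C) = r1" "dim_row (F31 C) = r2" "dim_col (F31 C) = nc"
    "dim_row (F32 C) = r2" "dim_col (F32 C) = r1" "dim_row (F33 C) = r2" "dim_col (F33 C) = r2"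
    "dim_row (H1 C) = nc" "dim_col (H1 C) = k" "dim_row (H3 C) = r2" "dim_col (H3 C) = k"
    "dim_row (J1 C) = m" "dim_col (J1 C) = nc" "dim_row (J2 C) = m" "dim_col (J2 C) = r1"
    using cC by auto
  note [simp] = plant_dim
  define V where "V = \<lparr>vX = X, vY = Y, vQ2 = Q2, vQ3 = Q3, vQt = Qt,
    K11 = X * (pl_A G 1 1 * Y + pl_B G 1 * (J1 C * T)) + U\<^sup>T * (F11 C * T + H1 C * (pl_C G 1 * Y)),
    K12 = X * (pl_A G 1 2 * Qt + pl_B G 1 * (J2 C * Va))
      + U\<^sup>T * (F12 C * Va + F13 C * Vb + H1 C * (pl_C G 2 * Qt)),
    K13 = X * pl_A G 1 2 + U\<^sup>T * (F13 C * W + H1 C * pl_C G 2),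
    K21 = Q2 * (pl_A G 2 1 * Y + pl_B G 2 * (J1 C * T)) + S\<^sup>T * (F21 C * T),
    K22 = Q2 * (pl_A G 2 2 * Qt + pl_B G 2 * (J2 C * Va)) + S\<^sup>T * (F22 C * Va),
    K31 = Q3 * (pl_A G 2 1 * Y + pl_B G 2 * (J1 C * T)) + Ua\<^sup>T * (F21 C * T)
      + Ub\<^sup>T * (F31 C * T + H3 C * (pl_C G 1 * Y)),
    K32 = Q3 * (pl_A G 2 2 * Qt + pl_B G 2 * (J2 C * Va)) + Ua\<^sup>T * (F22 C * Va)
      + Ub\<^sup>T * (F32 C * Va + F33 C * Vb + H3 C * (pl_C G 2 * Qt)),
    K33 = Q3 * pl_A G 2 2 + Ub\<^sup>T * (F33 C * W + H3 C * pl_C G 2),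
    L1 = U\<^sup>T * H1 C, L3 = Ub\<^sup>T * H3 C, M1 = J1 C * T, M2 = J2 C * Va\<rparr>"
  have V: "vars_dims n r m k V"
    unfolding vars_dims_def V_def vars.simps
    by (intro conjI symX1 symY symQ2 symQ3 symQt carrier_matI) simp_all
  have linked: "linked C V T U Va Vb W S Ua Ub"
    unfolding linked_def V_def vars.simps
    by (intro conjI allI) (simp_all add: act_plus_mat act_mult_mat)
  have Vsel: "vX V = X" "vY V = Y" "vQ2 V = Q2" "vQ3 V = Q3" "vQt V = Qt" by (simp_all add: V_def)
  have lX': "\<forall>s\<in>fvecs n. \<forall>x\<in>fvecs n.
      act \<X> (cat n (top_x V s x) (act T s)) = cat n (s + act (vX V) x) (act U x)"
    unfolding top_x_def Vsel using lX by blast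
  have lP': "\<forall>p1\<in>fvecs r. \<forall>p2\<in>fvecs r. \<forall>p3\<in>fvecs r.
      act \<P> (cat r (top_w V p1 p2 p3) (cat r1 (act Va p1) (act Vb p1 + act W p2)))
      = cat r (p1 + act (vQ2 V) p2 + act (vQ3 V) p3) (cat r1 (act S p2 + act Ua p3) (act Ub p3))"
    unfolding top_w_def Vsel using lP by blast
  note fl = form_linked[OF linked V X(3) S Uab(1,2) lX' lP']
  note fsl = form_sub_linked[OF linked V X(3) S Uab(1,2) lX' lP']
  have Qt0: "p1 = 0" if "p1 \<in> fvecs r" "act Qt p1 = 0" for p1
    using Qtpos[OF W0 that(1)] that(2) by fastforce
  \<comment> \<open>For \<open>g = Qt p1\<close> this is
    \<open>2 p2 \<bullet> g - |g + p2|^2 = - |g|^2 - |p2|^2\<close>: the mixed term is cancelled by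
    the doubled multiple in \<open>K22\<close>.\<close>
  have gain: "2 * dot r p2 (act Qt p1) + dot r p3 (act Qt p1 + p2) = - dot r (act Qt p1) (act Qt p1) - dot r p2 p2"
    if "act Qt p1 + p2 + p3 = 0" for p1 p2 p3
  proof -
    have "p3 = - (act Qt p1 + p2)" using that by (simp only: add_eq_0_iff)
    then show ?thesis by (simp add: dot_commute[of r p2 "act Qt p1"])
  qed
  note VB = vars_dims_perturb[OF V]
  have sig0: "top_u V s p1 = 0" if "act T s = 0" "act Va p1 = 0" for s p1
    unfolding linked_top_u[OF linked] that by (simp add: ctl_u_def)
  have form: "form \<gamma> V s x p1 p2 p3 d < 0 \<or>
      form \<gamma> V s x p1 p2 p3 d = 0 \<and> form \<gamma> (perturb 1 V) s x p1 p2 p3 d < 0"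
    if v: "s \<in> fvecs n" "x \<in> fvecs n" "p1 \<in> fvecs r" "p2 \<in> fvecs r" "p3 \<in> fvecs r" "d \<in> fvecs q"
      and nz: "s \<noteq> 0 \<or> x \<noteq> 0 \<or> p1 \<noteq> 0 \<or> p2 \<noteq> 0 \<or> p3 \<noteq> 0 \<or> d \<noteq> 0" for s x p1 p2 p3 d
  \<comment> \<open>Outside the kernel of the substitution the value is that of the closed-loop form
    at a nonzero vector. On the kernel the form is zero and its first variation decides.\<close>
  proof (cases "top_x V s x = 0 \<and> act T s = 0 \<and> top_w V p1 p2 p3 = 0 \<and> act Va p1 = 0
      \<and> act Vb p1 + act W p2 = 0 \<and> d = 0")
    case False
    have f: "top_x V s x \<in> fvecs n" "act T s \<in> fvecs nc" "top_w V p1 p2 p3 \<in> fvecs r" "act Va p1 \<in> fvecs r1"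
      "act Vb p1 + act W p2 \<in> fvecs r2"
      using v by (auto simp: top_x_def top_w_def Vsel intro!: fvecs_add)
    from neg[OF f v(6)] False show ?thesis unfolding fl[OF v(1-5)] by blast
  next
    case True
    then have 0: "top_x V s x = 0" "act T s = 0" "top_w V p1 p2 p3 = 0" "act Va p1 = 0"
      "act Vb p1 + act W p2 = 0" "d = 0" by auto
    have z: "form \<gamma> V s x p1 p2 p3 d = 0" unfolding fl[OF v(1-5)] 0 by simp
    have x: "x = - act Y s" using 0(1) by (simp add: top_x_def Vsel eq_neg_iff_add_eq_0 add.commute)
    have w: "act Qt p1 + p2 + p3 = 0" using 0(3) by (simp add: top_w_def Vsel)
    have "form \<gamma> (perturb 1 V) s x p1 p2 p3 d
        = 2 * (dot n x s + (2 * dot r p2 (act Qt p1) + dot r p3 (act Qt p1 + p2)))"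
      unfolding form_perturb_eq[OF V] z unfolding 0 sig0[OF 0(2,4)] by (simp add: sig_x_def Vsel)
    also have "\<dots> = - 2 * (dot n (act Y s) s + dot r (act Qt p1) (act Qt p1) + dot r p2 p2)"
      unfolding gain[OF w] by (simp add: x)
    also have "\<dots> < 0"
    proof -
      \<comment> \<open>On the kernel \<open>x\<close> and \<open>p3\<close> are determined by
        \<open>s\<close>, \<open>p1\<close>, \<open>p2\<close>, so these three cannot all
        vanish.\<close>
      have "s \<noteq> 0 \<or> p1 \<noteq> 0 \<or> p2 \<noteq> 0" using nz w x 0(6) by auto
      then have "dot n (act Y s) s > 0 \<or> dot r (act Qt p1) (act Qt p1) > 0 \<or> dot r p2 p2 > 0"
        using Ypos[OF v(1)] dot_self_pos[of "act Qt p1" r] dot_self_pos[OF v(4)] Qt0[OF v(3)] by auto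
      moreover have "dot n (act Y s) s \<ge> 0" using Ypos[OF v(1)] by (cases "s = 0") auto
      ultimately show ?thesis using dot_self_ge0[of r "act Qt p1"] dot_self_ge0[of r p2] by (smt (verit))
    qed
    finally show ?thesis using z by blast
  qed
  have form_sub: "form_sub Z V s x p1 p2 p3 < 0 \<or>
      form_sub Z V s x p1 p2 p3 = 0 \<and> form_sub Z (perturb 1 V) s x p1 p2 p3 < 0"
    if v: "s \<in> fvecs n" "x \<in> fvecs n" "p1 \<in> fvecs r" "p2 \<in> fvecs r" "p3 \<in> fvecs r"
      and nz: "s \<noteq> 0 \<or> x \<noteq> 0 \<or> p1 \<noteq> 0 \<or> p2 \<noteq> 0 \<or> p3 \<noteq> 0" for s x p1 p2 p3
  proof -
    have TU': "dot n (act (vY V) s) (act (vX V) x) + dot nc (act T s) (act U x) = dot n s x"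
      unfolding Vsel by (rule TU[OF v(1)])
    note fsl = fsl[OF v TU']
    show ?thesis
    proof (cases "top_x V s x = 0 \<and> act T s = 0 \<and> top_w V p1 p2 p3 = 0 \<and> act Va p1 = 0
        \<and> act Vb p1 + act W p2 = 0")
      case False
      have f: "top_x V s x \<in> fvecs n" "act T s \<in> fvecs nc" "top_w V p1 p2 p3 \<in> fvecs r" "act Va p1 \<in> fvecs r1"
        "act Vb p1 + act W p2 \<in> fvecs r2"
        using v by (auto simp: top_x_def top_w_def Vsel intro!: fvecs_add)
      from neg_sub[OF f] False show ?thesis unfolding fsl by blast
    next
      case True
      then have 0: "top_x V s x = 0" "act T s = 0" "top_w V p1 p2 p3 = 0" "act Va p1 = 0"
        "act Vb p1 + act W p2 = 0" by auto
      have z: "form_sub Z V s x p1 p2 p3 = 0"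
        unfolding fsl 0 by (simp add: ctl_u_def sig_p_def)
      have x: "x = - act Y s" using 0(1) by (simp add: top_x_def Vsel eq_neg_iff_add_eq_0 add.commute)
      have w: "act Qt p1 + p2 + p3 = 0" using 0(3) by (simp add: top_w_def Vsel)
      have "form_sub Z (perturb 1 V) s x p1 p2 p3
          = - dot n x x + 2 * (2 * dot r p2 (act Qt p1) + dot r p3 (act Qt p1 + p2))"
        unfolding form_sub_perturb_eq[OF V] z Vsel by simp
      also have "\<dots> = - (dot n x x + 2 * dot r (act Qt p1) (act Qt p1) + 2 * dot r p2 p2)"
        unfolding gain[OF w] by simp
      also have "\<dots> < 0"
      proof -
        \<comment> \<open>A vanishing \<open>x = - Y s\<close> forces \<open>s = 0\<close> by
          definiteness of \<open>Y\<close>, so the square of \<open>x\<close> controls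
          \<open>s\<close> as well.\<close>
        have "x \<noteq> 0 \<or> p1 \<noteq> 0 \<or> p2 \<noteq> 0"
          using nz w x Ypos[OF v(1)] by force
        then have "dot n x x > 0 \<or> dot r (act Qt p1) (act Qt p1) > 0 \<or> dot r p2 p2 > 0"
          using dot_self_pos[OF v(2)] dot_self_pos[of "act Qt p1" r] dot_self_pos[OF v(4)] Qt0[OF v(3)] by auto
        then show ?thesis
          using dot_self_ge0[of n x] dot_self_ge0[of r "act Qt p1"] dot_self_ge0[of r p2] by (smt (verit))
      qed
      finally show ?thesis using z by blast
    qed
  qed
  obtain e0 where e0: "0 < e0"
    "\<And>e. 0 < e \<Longrightarrow> e < e0 \<Longrightarrow>
      neg_def (LL (offdiag (1\<^sub>m (n + n))) (offdiag (1\<^sub>m (r + (r + r)))) (P_gamma q p \<gamma>) (loop (perturb e V))) \<and>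
      neg_def (LL_sub (neg_corner (Xmat (perturb e V))) (offdiag (1\<^sub>m (r + (r + r)))) (P_Z q Z) (loop (perturb e V)))"
  proof (rule form_perturb[OF V VB Zi(1), of \<gamma> 1])
    fix e0 assume *: "0 < e0" "\<And>e V'. 0 < e \<Longrightarrow> e < e0 \<Longrightarrow> vars_dims n r m k V' \<Longrightarrow>
      (\<And>s x p1 p2 p3 d. form \<gamma> V' s x p1 p2 p3 d
          = (1 - e) * form \<gamma> V s x p1 p2 p3 d + e * form \<gamma> (perturb 1 V) s x p1 p2 p3 d) \<Longrightarrow>
      (\<And>s x p1 p2 p3. form_sub Z V' s x p1 p2 p3
          = (1 - e) * form_sub Z V s x p1 p2 p3 + e * form_sub Z (perturb 1 V) s x p1 p2 p3) \<Longrightarrow>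
      neg_def (LL (offdiag (1\<^sub>m (n + n))) (offdiag (1\<^sub>m (r + (r + r)))) (P_gamma q p \<gamma>) (loop V')) \<and>
      neg_def (LL_sub (neg_corner (Xmat V')) (offdiag (1\<^sub>m (r + (r + r)))) (P_Z q Z) (loop V'))"
    \<comment> \<open>A quantity whose change is proportional to \<open>e\<close> interpolates
      between its values at 0 and 1.\<close>
    have affine: "a + 2 * e * b = (1 - e) * a + e * (a + 2 * 1 * b)"
      "a + e * b = (1 - e) * a + e * (a + 1 * b)" for a b e :: real
      by (simp_all add: algebra_simps)
    have lin: "form \<gamma> (perturb e V) s x p1 p2 p3 d
          = (1 - e) * form \<gamma> V s x p1 p2 p3 d + e * form \<gamma> (perturb 1 V) s x p1 p2 p3 d" for e s x p1 p2 p3 d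
      unfolding form_perturb_eq[OF V, of _ e] form_perturb_eq[OF V, of _ 1] by (rule affine(1))
    have lin': "form_sub Z (perturb e V) s x p1 p2 p3
          = (1 - e) * form_sub Z V s x p1 p2 p3 + e * form_sub Z (perturb 1 V) s x p1 p2 p3" for e s x p1 p2 p3
      unfolding form_sub_perturb_eq[OF V, of _ e] form_sub_perturb_eq[OF V, of _ 1] by (rule affine(2))
    show thesis
      by (rule that[OF *(1)], rule *(2)) (assumption | rule VB lin lin')+
  qed ((rule form, assumption+) | (rule form_sub, assumption+))+
  \<comment> \<open>Any positive \<open>e\<close> below \<open>e0\<close> would do.
    \<open>perturb\<close> leaves \<open>Q2\<close>, \<open>Q3\<close>, \<open>Qt\<close> alone, so
    their scaling conditions carry over.\<close>
  have "admissible VV Dl \<gamma> Z (perturb (e0 / 2) V)"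
    unfolding admissible_def
    using VB[of "e0 / 2"] scQ2 scQ3 scQt Z e0(2)[of "e0 / 2"] e0(1) by (simp add: perturb_def V_def)
  with that show ?thesis by blast
qed

end

end

theorem theorem5:
  fixes n\<^sub>s a b n\<^sub>w n\<^sub>z m k N u v r\<^sub>s :: nat
    and \<gamma> :: real
    and G\<^sub>0 G :: plant
    and \<Delta> :: "nat \<Rightarrow> real mat"
    and VV :: "real mat set"
  assumes gamma: "\<gamma> > 0"
    and plant: "original_plant n\<^sub>s a b n\<^sub>w n\<^sub>z m k G\<^sub>0"
    and val: "value_set a b N \<Delta> VV"
    and u: "u = a + a" and v: "v = b + b" and r: "r\<^sub>s = u + v"
    and lift: "G = lifted_plant G\<^sub>0"
  shows
    "(\<exists>n\<^sub>c r\<^sub>1 r\<^sub>2 K \<Delta>\<^sub>c X\<^sub>1 P Z.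
        structured_controller n\<^sub>c r\<^sub>1 r\<^sub>2 m k K \<and>
        structured_scheduling VV r\<^sub>1 r\<^sub>2 \<Delta>\<^sub>c \<and>
        X\<^sub>1 \<in> sym_mats (n\<^sub>s + n\<^sub>c) \<and> pos_def X\<^sub>1 \<and>
        P \<in> loop_scalings VV u v (r\<^sub>1 + r\<^sub>2) \<Delta>\<^sub>c \<and>
        Z \<in> sym_mats n\<^sub>z \<and> pos_def Z \<and> tr Z < 1 \<and>
        neg_def (LL_sub (neg_corner X\<^sub>1) (offdiag P) (P_Z n\<^sub>w Z) (closed_loop G K)) \<and>
        neg_def (LL (offdiag X\<^sub>1) (offdiag P) (P_gamma n\<^sub>w n\<^sub>z \<gamma>) (closed_loop G K)))
     \<longleftrightarrow>
     (\<exists>X\<^sub>1 Y\<^sub>1 Q\<^sub>2 Q\<^sub>3 Qt\<^sub>1 K11 K12 K13 K21 K22 K31 K32 K33 L1 L3 M1 M2 X\<^sub>2 Y\<^sub>2 X Y K XX Z.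
        X\<^sub>1 \<in> sym_mats n\<^sub>s \<and> Y\<^sub>1 \<in> sym_mats n\<^sub>s \<and>
        Q\<^sub>2 \<in> primal_scalings VV u v \<and> Q\<^sub>3 \<in> primal_scalings VV u v \<and>
        Qt\<^sub>1 \<in> dual_scalings VV u v \<and>
        X\<^sub>2 = Q\<^sub>2 @\<^sub>c Q\<^sub>3 \<and> Y\<^sub>2 = Qt\<^sub>1 @\<^sub>c 1\<^sub>m r\<^sub>s \<and>
        X = pair X\<^sub>1 X\<^sub>2 \<and> Y = pair Y\<^sub>1 Y\<^sub>2 \<and>
        K11 \<in> carrier_mat n\<^sub>s n\<^sub>s \<and> K12 \<in> carrier_mat n\<^sub>s r\<^sub>s \<and> K13 \<in> carrier_mat n\<^sub>s r\<^sub>s \<and>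
        K21 \<in> carrier_mat r\<^sub>s n\<^sub>s \<and> K22 \<in> carrier_mat r\<^sub>s r\<^sub>s \<and>
        K31 \<in> carrier_mat r\<^sub>s n\<^sub>s \<and> K32 \<in> carrier_mat r\<^sub>s r\<^sub>s \<and> K33 \<in> carrier_mat r\<^sub>s r\<^sub>s \<and>
        L1 \<in> carrier_mat n\<^sub>s k \<and> L3 \<in> carrier_mat r\<^sub>s k \<and>
        M1 \<in> carrier_mat m n\<^sub>s \<and> M2 \<in> carrier_mat m r\<^sub>s \<and>
        K = \<lparr>lfr_A = pair2
               K11            (K12 @\<^sub>c K13)
               (K21 @\<^sub>r K31)  (four_block_mat K22 (Q\<^sub>2\<^sup>T * pl_A G 2 2) K32 K33),
             lfr_B = pair L1 (0\<^sub>m r\<^sub>s k @\<^sub>r L3),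
             lfr_C = pair M1 (M2 @\<^sub>c 0\<^sub>m m r\<^sub>s),
             lfr_D = 0\<^sub>m m k\<rparr> \<and>
        XX = four_block_mat Y\<^sub>1 (1\<^sub>m n\<^sub>s) (1\<^sub>m n\<^sub>s) X\<^sub>1 \<and>
        Z \<in> sym_mats n\<^sub>z \<and> pos_def Z \<and> tr Z < 1 \<and>
        neg_def (LL_sub (neg_corner XX) (offdiag (1\<^sub>m (r\<^sub>s + (r\<^sub>s + r\<^sub>s)))) (P_Z n\<^sub>w Z)
                  (transformed_loop G X Y K)) \<and>
        neg_def (LL (offdiag (1\<^sub>m (n\<^sub>s + n\<^sub>s))) (offdiag (1\<^sub>m (r\<^sub>s + (r\<^sub>s + r\<^sub>s)))) (P_gamma n\<^sub>w n\<^sub>z \<gamma>)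
                  (transformed_loop G X Y K)))"
  (is "?lhs \<longleftrightarrow> ?rhs")
proof -
  have pd: "plant_dims n\<^sub>s r\<^sub>s n\<^sub>w n\<^sub>z m k G"
    using plant_dims_lifted_plant[OF plant] by (simp add: lift r u v)
  interpret lifted_loop n\<^sub>s r\<^sub>s n\<^sub>w n\<^sub>z m k G by unfold_locales (rule pd)
  let ?Dl = "Delta_l u v"
  have Dl: "\<forall>V\<in>VV. ?Dl V \<in> carrier_mat r\<^sub>s r\<^sub>s"
    by (auto simp: Delta_l_def r)
  \<comment> \<open>The zero matrix belongs to the value set; nonemptiness supplies the value at
    which multipliers are shown to be nonsingular.\<close>
  have ne: "VV \<noteq> {}" using val by (auto simp: value_set_def)
  have sc: "primal_scalings VV u v = scalings VV r\<^sub>s ?Dl"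
    "dual_scalings VV u v = scalings VV r\<^sub>s (\<lambda>V. (?Dl V)\<^sup>T)"
    by (simp_all add: primal_scalings_def dual_scalings_def r)
  have "?lhs \<longleftrightarrow> synthesizable VV ?Dl \<gamma>"
    unfolding synthesizable_def loop_scalings_def r[symmetric] ..
  also have "\<dots> \<longleftrightarrow> (\<exists>Z V. admissible VV ?Dl \<gamma> Z V)"
    using synthesizable_if_admissible[OF Dl ne] admissible_if_synthesizable[OF Dl ne] by blast
  also have "\<dots> \<longleftrightarrow> ?rhs"
  proof
    assume "\<exists>Z V. admissible VV ?Dl \<gamma> Z V"
    then obtain Z V where "admissible VV ?Dl \<gamma> Z V" by blast
    note adm = this[unfolded admissible_def vars_dims_def loop_def vars_lfr_def Xmat_def]
    show ?rhs
      unfolding sc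
      \<comment> \<open>The six abbreviations from \<open>X\<^sub>2\<close> to \<open>XX\<close> get
        schematic witnesses, which their defining equations then instantiate by reflexivity.\<close>
      by (rule exI[of _ "vX V"], rule exI[of _ "vY V"], rule exI[of _ "vQ2 V"], rule exI[of _ "vQ3 V"],
        rule exI[of _ "vQt V"], rule exI[of _ "K11 V"], rule exI[of _ "K12 V"], rule exI[of _ "K13 V"],
        rule exI[of _ "K21 V"], rule exI[of _ "K22 V"], rule exI[of _ "K31 V"], rule exI[of _ "K32 V"],
        rule exI[of _ "K33 V"], rule exI[of _ "L1 V"], rule exI[of _ "L3 V"], rule exI[of _ "M1 V"],
        rule exI[of _ "M2 V"],
        rule exI, rule exI, rule exI, rule exI, rule exI, rule exI, rule exI[of _ Z], intro conjI)
        (rule refl | (insert adm, elim conjE, assumption))+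
  next
    assume ?rhs
    then obtain X\<^sub>1 Y\<^sub>1 Q\<^sub>2 Q\<^sub>3 Qt\<^sub>1 K11 K12 K13 K21 K22 K31 K32 K33 L1 L3 M1 M2 X\<^sub>2 Y\<^sub>2 X Y K XX Z where
      *: "X\<^sub>1 \<in> sym_mats n\<^sub>s" "Y\<^sub>1 \<in> sym_mats n\<^sub>s"
        "Q\<^sub>2 \<in> primal_scalings VV u v" "Q\<^sub>3 \<in> primal_scalings VV u v" "Qt\<^sub>1 \<in> dual_scalings VV u v"
        "X\<^sub>2 = Q\<^sub>2 @\<^sub>c Q\<^sub>3" "Y\<^sub>2 = Qt\<^sub>1 @\<^sub>c 1\<^sub>m r\<^sub>s" "X = pair X\<^sub>1 X\<^sub>2" "Y = pair Y\<^sub>1 Y\<^sub>2"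
        "K11 \<in> carrier_mat n\<^sub>s n\<^sub>s" "K12 \<in> carrier_mat n\<^sub>s r\<^sub>s" "K13 \<in> carrier_mat n\<^sub>s r\<^sub>s"
        "K21 \<in> carrier_mat r\<^sub>s n\<^sub>s" "K22 \<in> carrier_mat r\<^sub>s r\<^sub>s"
        "K31 \<in> carrier_mat r\<^sub>s n\<^sub>s" "K32 \<in> carrier_mat r\<^sub>s r\<^sub>s" "K33 \<in> carrier_mat r\<^sub>s r\<^sub>s"
        "L1 \<in> carrier_mat n\<^sub>s k" "L3 \<in> carrier_mat r\<^sub>s k"
        "M1 \<in> carrier_mat m n\<^sub>s" "M2 \<in> carrier_mat m r\<^sub>s"
        "K = \<lparr>lfr_A = pair2
               K11            (K12 @\<^sub>c K13)
               (K21 @\<^sub>r K31)  (four_block_mat K22 (Q\<^sub>2\<^sup>T * pl_A G 2 2) K32 K33),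
             lfr_B = pair L1 (0\<^sub>m r\<^sub>s k @\<^sub>r L3),
             lfr_C = pair M1 (M2 @\<^sub>c 0\<^sub>m m r\<^sub>s),
             lfr_D = 0\<^sub>m m k\<rparr>"
        "XX = four_block_mat Y\<^sub>1 (1\<^sub>m n\<^sub>s) (1\<^sub>m n\<^sub>s) X\<^sub>1"
        "Z \<in> sym_mats n\<^sub>z" "pos_def Z" "tr Z < 1"
        "neg_def (LL_sub (neg_corner XX) (offdiag (1\<^sub>m (r\<^sub>s + (r\<^sub>s + r\<^sub>s)))) (P_Z n\<^sub>w Z)
                  (transformed_loop G X Y K))"
        "neg_def (LL (offdiag (1\<^sub>m (n\<^sub>s + n\<^sub>s))) (offdiag (1\<^sub>m (r\<^sub>s + (r\<^sub>s + r\<^sub>s)))) (P_gamma n\<^sub>w n\<^sub>z \<gamma>)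
                  (transformed_loop G X Y K))"
      by (elim exE conjE)
    let ?V = "\<lparr>vX = X\<^sub>1, vY = Y\<^sub>1, vQ2 = Q\<^sub>2, vQ3 = Q\<^sub>3, vQt = Qt\<^sub>1, K11 = K11, K12 = K12, K13 = K13,
      K21 = K21, K22 = K22, K31 = K31, K32 = K32, K33 = K33, L1 = L1, L3 = L3, M1 = M1, M2 = M2\<rparr>"
    have sy: "Q\<^sub>2 \<in> sym_mats r\<^sub>s" "Q\<^sub>3 \<in> sym_mats r\<^sub>s" "Qt\<^sub>1 \<in> sym_mats r\<^sub>s"
      using *(3-5) by (simp_all add: sc scalings_def)
    have "admissible VV ?Dl \<gamma> Z ?V"
      unfolding admissible_def vars_dims_def loop_def vars_lfr_def Xmat_def vars.simps
      using *(1-5,10-21,24-28) sy unfolding *(6-9,22,23) sc by - (intro conjI; assumption)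
    then show "\<exists>Z V. admissible VV ?Dl \<gamma> Z V" by blast
  qed
  finally show ?thesis .
qed

end
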